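(* Let $\alpha_0\in(0,2)$ and let $M_{\alpha_0}$ be a complex isotropic $\alpha_0$-stable random measure on $\mathbb{R}^d$ with Lebesgue control measure. Let $\psi_{\alpha_0}:\mathbb{R}^d\to\mathbb{C}$ be a Borel function such that $\int_{\mathbb{R}^d}\min(1,\|\xi\|^{\alpha_0})|\psi_{\alpha_0}(\xi)|^{\alpha_0}\,\mathrm{d}\xi<+\infty$, and let $$X_{\alpha_0}(u)=\int_{\mathbb{R}^d}\big(e^{i\langle u,\xi\rangle}-1\big)\psi_{\alpha_0}(\xi)\,M_{\alpha_0}(\mathrm{d}\xi),\qquad u\in\mathbb{R}^d.$$ Let $E$ be a real $d\times d$ matrix whose eigenvalues have positive real parts, let $\tau_E$ and $\tau_{E^t}$ be functions associated with $E$ and $E^t$ as described in the context, and set $q(E)=\operatorname{trace}(E)$ and $a_1=\min_{\lambda\in\operatorname{Sp}(E)}\Re(\lambda)$, with $\operatorname{Sp}(E)$ the set of eigenvalues of $E$. Assume that there exist finite positive constants $c_\psi$, $A$ and $\beta\in(0,a_1)$ such that $$|\psi_{\alpha_0}(\xi)|\le c_\psi\,\tau_{E^t}(\xi)^{-\beta-q(E)/\alpha_0}\qquad\text{for almost every }\xi\text{ with }\|\xi\|>A.$$ Then there exists a modification $X_{\alpha_0}^*$ of $X_{\alpha_0}$ such that almost surely, for any $\varepsilon>0$, for any non-empty compact set $K_d\subset\mathbb{R}^d$, $$\sup_{u,v\in K_d,\; u\ne v}\frac{|X_{\alpha_0}^*(u)-X_{\alpha_0}^*(v)|}{\tau_E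(u-v)^{\beta}\,\big[\log\big(1+\tau_E(u-v)^{-1}\big)\big]^{\varepsilon+1/2+1/\alpha_0}}<+\infty.$$
   Context: For a real $d\times d$ matrix $E$ whose eigenvalues have positive real parts, $\tau_E:\mathbb{R}^d\to[0,\infty)$ denotes a continuous even function such that (i) $\tau_E(x)>0$ for all $x\ne0$; (ii) $\tau_E(r^Ex)=r\,\tau_E(x)$ for all $r>0$ and $x\in\mathbb{R}^d$, where $r^E=\exp((\ln r)E)$. $\tau_{E^t}$ is such a function for the transpose $E^t$. A complex isotropic $\alpha_0$-stable random measure $M_{\alpha_0}$ with control measure $\nu$ (here Lebesgue measure) is characterized, for $f\in L^{\alpha_0}(\mathbb{R}^d,\nu;\mathbb{C})$, by linearity of $f\mapsto\int f\,\mathrm{d}M_{\alpha_0}$ and $\mathbb{E}\exp\big(i\Re(\overline z\int f\,\mathrm{d}M_{\alpha_0})\big)=\exp\big(-c(\alpha_0)|z|^{\alpha_0}\int|f|^{\alpha_0}\,\mathrm{d}\nu\big)$ for all $z\in\mathbb{C}$, with $c(\alpha_0)=\frac1{2\pi}\int_0^{2\pi}|\cos\theta|^{\alpha_0}\,\mathrm{d}\theta$. $\|\cdot\|$ and $\langle\cdot,\cdot\rangle$ are the Euclidean norm and inner product. A modification of $X$ is a field $X^*$ with $\mathbb{P}(X^*(u)=X(u))=1$ for every $u$. *)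

theory Defs
  imports "HOL-Probability.Probability"
begin

definition complex_spectrum :: "real^'n^'n \<Rightarrow> complex set" where
  "complex_spectrum E =
     {l. \<exists>v :: complex^'n. v \<noteq> 0 \<and> (\<chi> i j. complex_of_real (E $ i $ j)) *v v = l *s v}"

(* The library's exp is unavailable here: real^'n^'n is not an instance of
   real_normed_algebra_1, and its class-level product is componentwise. *)
definition matrix_exp :: "real^'n^'n \<Rightarrow> real^'n^'n" where
  "matrix_exp A = (\<Sum>k. (1 / fact k) *\<^sub>R ((\<lambda>B. A ** B) ^^ k) (mat 1))"

definition matrix_rpow :: "real \<Rightarrow> real^'n^'n \<Rightarrow> real^'n^'n" where
  "matrix_rpow r E = matrix_exp (ln r *\<^sub>R E)"

definition homogeneous_gauge :: "real^'n^'n \<Rightarrow> (real^'n \<Rightarrow> real) \<Rightarrow> bool" where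
  "homogeneous_gauge E \<tau> \<longleftrightarrow>
     continuous_on UNIV \<tau> \<and>
     (\<forall>x. 0 \<le> \<tau> x) \<and>
     (\<forall>x. \<tau> (- x) = \<tau> x) \<and>
     (\<forall>x. x \<noteq> 0 \<longrightarrow> 0 < \<tau> x) \<and>
     (\<forall>r>0. \<forall>x. \<tau> (matrix_rpow r E *v x) = r * \<tau> x)"

definition L_alpha :: "'a measure \<Rightarrow> real \<Rightarrow> ('a \<Rightarrow> complex) set" where
  "L_alpha \<nu> \<alpha> = {f. f \<in> borel_measurable \<nu> \<and> integrable \<nu> (\<lambda>x. cmod (f x) powr \<alpha>)}"

definition stable_const :: "real \<Rightarrow> real" where
  "stable_const \<alpha> = 1 / (2 * pi) * (LBINT \<theta>:{0..2 * pi}. \<bar>cos \<theta>\<bar> powr \<alpha>)"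

(* A random measure M is represented by its stochastic integral: "M f" stands for the
   random variable "integral of f with respect to M", for f in L_alpha; the random measure
   of a set B of finite control measure is M (indicator B). Linearity is over the complex
   numbers and holds almost surely, since the integral is only determined up to null sets. *)
definition isotropic_stable_random_measure ::
  "'w measure \<Rightarrow> real \<Rightarrow> 'a measure \<Rightarrow> (('a \<Rightarrow> complex) \<Rightarrow> 'w \<Rightarrow> complex) \<Rightarrow> bool" where
  "isotropic_stable_random_measure P \<alpha> \<nu> M \<longleftrightarrow>
     (\<forall>f\<in>L_alpha \<nu> \<alpha>. M f \<in> borel_measurable P) \<and>
     (\<forall>f\<in>L_alpha \<nu> \<alpha>. \<forall>g\<in>L_alpha \<nu> \<alpha>. \<forall>a b.
        AE \<omega> in P. M (\<lambda>x. a * f x + b * g x) \<omega> = a * M f \<omega> + b * M g \<omega>) \<and>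
     (\<forall>f\<in>L_alpha \<nu> \<alpha>. \<forall>z.
        (LINT \<omega>|P. exp (\<i> * complex_of_real (Re (cnj z * M f \<omega>)))) =
        complex_of_real
          (exp (- stable_const \<alpha> * cmod z powr \<alpha> * (LINT x|\<nu>. cmod (f x) powr \<alpha>))))"

definition modification ::
  "'w measure \<Rightarrow> ('t \<Rightarrow> 'w \<Rightarrow> complex) \<Rightarrow> ('t \<Rightarrow> 'w \<Rightarrow> complex) \<Rightarrow> bool" where
  "modification P X Y \<longleftrightarrow>
     (\<forall>u. Y u \<in> borel_measurable P) \<and> (\<forall>u. AE \<omega> in P. Y u \<omega> = X u \<omega>)"

definition harmonizable_field ::
  "((real^'n \<Rightarrow> complex) \<Rightarrow> 'w \<Rightarrow> complex) \<Rightarrow> (real^'n \<Rightarrow> complex) \<Rightarrow> real^'n \<Rightarrow> 'w \<Rightarrow> complex" where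
  "harmonizable_field M \<psi> u = M (\<lambda>\<xi>. (exp (\<i> * complex_of_real (u \<bullet> \<xi>)) - 1) * \<psi> \<xi>)"

end

theory Submission
  imports Defs
    "HOL-Computational_Algebra.Fundamental_Theorem_Algebra"
    "HOL-Real_Asymp.Real_Asymp"
begin

text \<open>A union bound over heavy-tailed increments would cost a power of their number. What saves the modulus is that an
isotropic stable integral is sub-Gaussian conditionally on the sizes of its jumps. The proof expresses this through
characteristic functions, by an exponential inequality for the integrals \<open>W i\<close> of a fixed envelope over the cells of a
finite partition: for coefficients bounded by 1, the linear form in the \<open>W i\<close> has a Gaussian tail on the event
that the sum of \<open>(cmod (W i))\<^sup>2\<close> is small. It follows from the factorization of the joint
characteristic function (lemma \<open>expectation_exp_minus_half_squares_le_1\<close>). The square sum is the same for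
all linear forms and has the tail of one stable variable, whence \<open>maximal_inequality\<close>: the maximum of \<open>N\<close>
integrals under a common envelope exceeds its stable scale by a factor of order \<open>sqrt (ln N)\<close> only, apart from one
heavy-tailed factor.

Let \<open>n\<close> index the scales \<open>exp (- n)\<close> of the gauge. The increments of the field between neighbours in a grid of
mesh \<open>exp (- n)\<close> have a common envelope whose stable scale is of order \<open>exp (- (\<beta> * n))\<close>
(\<open>increment_mass_bound\<close>). This is a computation over shells of the gauge of the transposed matrix,
and it rests on two facts about the matrix exponential: the dilations multiply volume by the exponential of the trace
(\<open>measure_flow_image\<close>), and they contract at any rate below the smallest real part of an
eigenvalue (\<open>flow_decay\<close>). There are exponentially many pairs, so \<open>sqrt (ln N)\<close> is of order \<open>sqrt n\<close>, while
Borel-Cantelli for the heavy-tailed factor costs \<open>n powr (1 / \<alpha>0 + \<delta>)\<close> (\<open>links_eventually_bounded\<close>). Chaining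
over the grids (\<open>chaining_modulus\<close>) gives the modulus for the limit of the field along the grid
projections, and this limit is a modification by \<open>project_tendsto\<close>.\<close>

section \<open>Gaussian weights and factorizing characteristic functions\<close>

lemma cosh_le_exp_half_square: "cosh (x::real) \<le> exp (x\<^sup>2 / 2)"
proof -
  have *: "cosh x \<le> exp (x\<^sup>2 / 2)" if "0 \<le> x" for x :: real
  proof -
    have t: "tanh y \<le> y" if "0 \<le> y" for y :: real
    proof -
      have "0 - tanh 0 \<le> y - tanh y"
        by (rule DERIV_nonneg_imp_nondecreasing[OF that, where f="\<lambda>y. y - tanh y"])
           (auto intro!: exI derivative_eq_intros)
      then show ?thesis by simp
    qed
    have "0\<^sup>2 / 2 - ln (cosh 0) \<le> x\<^sup>2 / 2 - ln (cosh x)"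
    proof (rule DERIV_nonneg_imp_nondecreasing[OF that, where f="\<lambda>x. x\<^sup>2/2 - ln (cosh x)"])
      fix y :: real assume y: "0 \<le> y"
      have "((\<lambda>x. x\<^sup>2/2 - ln (cosh x)) has_real_derivative (y - tanh y)) (at y)"
        by (auto intro!: derivative_eq_intros simp: tanh_def field_simps cosh_real_pos)
      with t[OF y] show "\<exists>d. ((\<lambda>x. x\<^sup>2/2 - ln (cosh x)) has_real_derivative d) (at y) \<and> 0 \<le> d"
        by auto
    qed
    then have "ln (cosh x) \<le> x\<^sup>2 / 2" by simp
    then show ?thesis
      by (metis cosh_real_pos exp_le_cancel_iff exp_ln)
  qed
  have "cosh x = cosh \<bar>x\<bar>" by (simp add: abs_real_def)
  then show ?thesis using *[of "\<bar>x\<bar>"] by simp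
qed

lemma exp_minus_half_square_le: "exp (x - x\<^sup>2 / 2) \<le> exp (1/2 :: real)"
proof -
  have "0 \<le> (x - 1)\<^sup>2" by simp
  then show ?thesis by (simp add: power2_eq_square algebra_simps)
qed

text \<open>The self-normalising weight \<open>exp (x - x\<^sup>2 / 2)\<close> is a shifted Gaussian, hence the Fourier transform of an
explicit bounded density against the normal law. Fubini's theorem then expresses expectations of such weights
through characteristic functions.\<close>

lemma exp_minus_half_square_fourier:
  "complex_of_real (exp (x - x\<^sup>2 / 2)) =
     (CLINT s|std_normal_distribution. exp (1/2) * iexp (- s) * iexp (s * x))"
proof -
  have "(CLINT s|std_normal_distribution. exp (1/2) * iexp (- s) * iexp (s * x)) =
        (CLINT s|std_normal_distribution. exp (1/2) * iexp ((x - 1) * s))"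
    by (rule Bochner_Integration.integral_cong) (auto simp: exp_add[symmetric] algebra_simps)
  also have "\<dots> = exp (1/2) * char std_normal_distribution (x - 1)"
    unfolding char_def by simp
  also have "\<dots> = complex_of_real (exp (1/2) * exp (- (x-1)\<^sup>2 / 2))"
    unfolding char_std_normal_distribution by (simp add: exp_of_real[symmetric] del: exp_of_real)
  also have "exp (1/2) * exp (- (x-1)\<^sup>2 / 2) = exp (x - x\<^sup>2 / 2)"
    by (simp add: exp_add[symmetric] power2_eq_square field_simps)
  finally show ?thesis by simp
qed

text \<open>A joint characteristic function that factorizes makes the joint expectation of Gaussian weights factorize
as well. The induction trades one exponential factor at a time for a Gaussian weight: indices in \<open>B\<close> still
carry exponentials with free frequencies, and moving an index to \<open>A\<close> integrates its frequency out.\<close>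

lemma (in prob_space) gaussian_transform_factorizes:
  fixes V :: "'i \<Rightarrow> 'a \<Rightarrow> real" and \<phi> :: "'i \<Rightarrow> real \<Rightarrow> complex"
  assumes "finite A" and "finite B" and "A \<inter> B = {}"
    and meas: "\<And>i. i \<in> A \<union> B \<Longrightarrow> V i \<in> borel_measurable M"
    and char: "\<And>s. (CLINT \<omega>|M. iexp (\<Sum>i\<in>A \<union> B. s i * V i \<omega>)) = (\<Prod>i\<in>A \<union> B. \<phi> i (s i))"
  shows "(CLINT \<omega>|M. complex_of_real (\<Prod>i\<in>A. exp (V i \<omega> - (V i \<omega>)\<^sup>2 / 2)) * iexp (\<Sum>i\<in>B. s i * V i \<omega>)) =
         (\<Prod>i\<in>A. CLINT r|std_normal_distribution. exp (1/2) * iexp (- r) * \<phi> i r) * (\<Prod>i\<in>B. \<phi> i (s i))"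
  using assms
proof (induction A arbitrary: B s rule: finite_induct)
  case empty
  then show ?case by simp
next
  case (insert a A)
  interpret N: real_distribution std_normal_distribution by (rule real_dist_normal_dist)
  interpret pair_sigma_finite M std_normal_distribution by unfold_locales
  have [measurable]: "V a \<in> borel_measurable M" "\<And>i. i \<in> A \<Longrightarrow> V i \<in> borel_measurable M"
      "\<And>i. i \<in> B \<Longrightarrow> V i \<in> borel_measurable M"
    using insert.prems by auto
  let ?h = "\<lambda>\<omega>. complex_of_real (\<Prod>i\<in>A. exp (V i \<omega> - (V i \<omega>)\<^sup>2 / 2)) * iexp (\<Sum>i\<in>B. s i * V i \<omega>)"
  let ?F = "\<lambda>\<omega> r. ?h \<omega> * (exp (1/2) * iexp (- r) * iexp (r * V a \<omega>))"
  have "norm (?h \<omega>) \<le> exp (1/2) ^ card A" for \<omega>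
  proof -
    have "(\<Prod>i\<in>A. exp (V i \<omega> - (V i \<omega>)\<^sup>2 / 2)) \<le> (\<Prod>i\<in>A. exp (1/2))"
      by (intro prod_mono) (use exp_minus_half_square_le in auto)
    then show ?thesis by (simp add: norm_mult prod_nonneg del: of_real_prod)
  qed
  then have bd: "norm (?F \<omega> r) \<le> exp (1/2) ^ card A * exp (1/2)" for \<omega> r
    by (simp add: norm_mult mult_right_mono)
  have int: "integrable (M \<Otimes>\<^sub>M std_normal_distribution) (case_prod ?F)"
  proof -
    interpret PP: pair_prob_space M std_normal_distribution by unfold_locales
    show ?thesis
      by (rule PP.integrable_const_bound[where B="exp (1/2) ^ card A * exp (1/2)"])
         (use bd in \<open>auto simp del: norm_mult\<close>)
  qed
  have inn: "(CLINT \<omega>|M. ?F \<omega> r) = exp (1/2) * iexp (- r) * \<phi> a r *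
       ((\<Prod>i\<in>A. CLINT r|std_normal_distribution. exp (1/2) * iexp (- r) * \<phi> i r) * (\<Prod>i\<in>B. \<phi> i (s i)))" for r
  proof -
    have "(CLINT \<omega>|M. ?F \<omega> r) = (CLINT \<omega>|M. (exp (1/2) * iexp (- r)) *
        (complex_of_real (\<Prod>i\<in>A. exp (V i \<omega> - (V i \<omega>)\<^sup>2 / 2)) * iexp (\<Sum>i\<in>insert a B. (s(a := r)) i * V i \<omega>)))"
    proof (rule Bochner_Integration.integral_cong)
      fix \<omega>
      have "(\<Sum>i\<in>insert a B. (s(a := r)) i * V i \<omega>) = r * V a \<omega> + (\<Sum>i\<in>B. s i * V i \<omega>)"
        using insert.prems insert.hyps by (subst sum.insert) (auto intro!: sum.cong)
      then show "?F \<omega> r = (exp (1/2) * iexp (- r)) *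
        (complex_of_real (\<Prod>i\<in>A. exp (V i \<omega> - (V i \<omega>)\<^sup>2 / 2)) * iexp (\<Sum>i\<in>insert a B. (s(a := r)) i * V i \<omega>))"
        by (simp add: exp_add distrib_left mult_ac)
    qed auto
    also have "\<dots> = (exp (1/2) * iexp (- r)) * (CLINT \<omega>|M.
        (complex_of_real (\<Prod>i\<in>A. exp (V i \<omega> - (V i \<omega>)\<^sup>2 / 2)) * iexp (\<Sum>i\<in>insert a B. (s(a := r)) i * V i \<omega>)))"
      by (rule integral_mult_right_zero)
    also have "\<dots> = (exp (1/2) * iexp (- r)) *
      ((\<Prod>i\<in>A. CLINT r|std_normal_distribution. exp (1/2) * iexp (- r) * \<phi> i r) * (\<Prod>i\<in>insert a B. \<phi> i ((s(a:=r)) i)))"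
      by (subst insert.IH) (use insert.prems insert.hyps in \<open>auto simp del: of_real_prod\<close>)
    also have "(\<Prod>i\<in>insert a B. \<phi> i ((s(a:=r)) i)) = \<phi> a r * (\<Prod>i\<in>B. \<phi> i (s i))"
      using insert.prems insert.hyps by (subst prod.insert) (auto intro!: prod.cong)
    finally show ?thesis by (simp add: mult_ac)
  qed
  have "(CLINT \<omega>|M. complex_of_real (\<Prod>i\<in>insert a A. exp (V i \<omega> - (V i \<omega>)\<^sup>2 / 2)) * iexp (\<Sum>i\<in>B. s i * V i \<omega>))
      = (CLINT \<omega>|M. CLINT r|std_normal_distribution. ?F \<omega> r)"
  proof (rule Bochner_Integration.integral_cong)
    fix \<omega>
    have "(CLINT r|std_normal_distribution. ?F \<omega> r) =
        ?h \<omega> * (CLINT r|std_normal_distribution. exp (1/2) * iexp (- r) * iexp (r * V a \<omega>))"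
      by (rule integral_mult_right_zero)
    also have "\<dots> = ?h \<omega> * complex_of_real (exp (V a \<omega> - (V a \<omega>)\<^sup>2 / 2))"
      unfolding exp_minus_half_square_fourier ..
    finally show "complex_of_real (\<Prod>i\<in>insert a A. exp (V i \<omega> - (V i \<omega>)\<^sup>2 / 2)) * iexp (\<Sum>i\<in>B. s i * V i \<omega>)
       = (CLINT r|std_normal_distribution. ?F \<omega> r)"
      using insert.hyps by (simp add: mult_ac)
  qed simp
  also have "\<dots> = (CLINT r|std_normal_distribution. CLINT \<omega>|M. ?F \<omega> r)"
    by (rule Fubini_integral[OF int, symmetric])
  also have "\<dots> = (CLINT r|std_normal_distribution. exp (1/2) * iexp (- r) * \<phi> a r) *
       ((\<Prod>i\<in>A. CLINT r|std_normal_distribution. exp (1/2) * iexp (- r) * \<phi> i r) * (\<Prod>i\<in>B. \<phi> i (s i)))"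
    unfolding inn by (rule integral_mult_left_zero)
  finally show ?case using insert.hyps by (simp add: mult_ac)
qed

text \<open>This replaces a conditioning argument: for variables that are jointly symmetric under individual sign
changes, the exponential supermartingale bound holds with the sum of squares as random variance. An even
\<open>\<phi> i\<close> gives each \<open>V i\<close> and its negative the same Gaussian expectation, so a factor equals the mean of
\<open>cosh (V i) * exp (- (V i)\<^sup>2 / 2)\<close>, which is at most 1.\<close>

lemma (in prob_space) expectation_exp_minus_half_squares_le_1:
  fixes V :: "'i \<Rightarrow> 'a \<Rightarrow> real" and \<phi> :: "'i \<Rightarrow> real \<Rightarrow> complex"
  assumes fin: "finite A"
    and meas: "\<And>i. i \<in> A \<Longrightarrow> V i \<in> borel_measurable M"
    and char: "\<And>s. (CLINT \<omega>|M. iexp (\<Sum>i\<in>A. s i * V i \<omega>)) = (\<Prod>i\<in>A. \<phi> i (s i))"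
    and even: "\<And>i s. \<phi> i (- s) = \<phi> i s" and one: "\<And>i. \<phi> i 0 = 1"
  shows "expectation (\<lambda>\<omega>. exp (\<Sum>i\<in>A. V i \<omega> - (V i \<omega>)\<^sup>2 / 2)) \<le> 1"
proof -
  let ?H = "\<lambda>i. CLINT r|std_normal_distribution. exp (1/2) * iexp (- r) * \<phi> i r"
  have H1: "norm (?H i) \<le> 1" if i: "i \<in> A" for i
  proof -
    have [measurable]: "V i \<in> borel_measurable M" using meas i by auto
    have c1: "(CLINT \<omega>|M. iexp (s * V i \<omega>)) = \<phi> i s" for s
    proof -
      have "(\<Sum>j\<in>A. (if j = i then s else 0) * V j \<omega>) = s * V i \<omega>" for \<omega>
      proof -
        have "(\<Sum>j\<in>A. (if j = i then s else 0) * V j \<omega>) = (\<Sum>j\<in>A. if j = i then s * V j \<omega> else 0)"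
          by (rule sum.cong) auto
        then show ?thesis using fin i by simp
      qed
      moreover have "(\<Prod>j\<in>A. \<phi> j (if j = i then s else 0)) = \<phi> i s"
      proof -
        have "(\<Prod>j\<in>A. \<phi> j (if j = i then s else 0)) = (\<Prod>j\<in>A. if j = i then \<phi> j s else 1)"
          by (rule prod.cong) (auto simp: one)
        then show ?thesis using fin i by simp
      qed
      ultimately show ?thesis using char[of "\<lambda>j. if j = i then s else 0"] by simp
    qed
    have e1: "(CLINT \<omega>|M. complex_of_real (exp (V i \<omega> - (V i \<omega>)\<^sup>2 / 2))) = ?H i"
      using gaussian_transform_factorizes[of "{i}" "{}" V \<phi>] c1 by simp
    have e2: "(CLINT \<omega>|M. complex_of_real (exp (- V i \<omega> - (V i \<omega>)\<^sup>2 / 2))) = ?H i"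
      using gaussian_transform_factorizes[of "{i}" "{}" "\<lambda>j \<omega>. - V j \<omega>" \<phi>] c1[of "- s" for s] even by simp
    have i1: "integrable M (\<lambda>\<omega>. exp (V i \<omega> - (V i \<omega>)\<^sup>2 / 2))"
      by (rule integrable_const_bound[where B="exp (1/2)"])
         (use exp_minus_half_square_le in \<open>auto simp del: exp_le_cancel_iff\<close>)
    have i2: "integrable M (\<lambda>\<omega>. exp (- V i \<omega> - (V i \<omega>)\<^sup>2 / 2))"
      by (rule integrable_const_bound[where B="exp (1/2)"]) 
         (use exp_minus_half_square_le[of "- V i \<omega>" for \<omega>] in \<open>auto simp del: exp_le_cancel_iff\<close>)
    have "?H i = complex_of_real ((expectation (\<lambda>\<omega>. exp (V i \<omega> - (V i \<omega>)\<^sup>2 / 2)) +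
        expectation (\<lambda>\<omega>. exp (- V i \<omega> - (V i \<omega>)\<^sup>2 / 2))) / 2)"
      unfolding integral_complex_of_real using e1 e2 by (simp add: integral_complex_of_real)
    also have "\<dots> = complex_of_real (expectation (\<lambda>\<omega>. (exp (V i \<omega> - (V i \<omega>)\<^sup>2 / 2) + exp (- V i \<omega> - (V i \<omega>)\<^sup>2 / 2)) / 2))"
      using i1 i2 by simp
    finally have e3: "?H i = complex_of_real (expectation (\<lambda>\<omega>. (exp (V i \<omega> - (V i \<omega>)\<^sup>2 / 2) + exp (- V i \<omega> - (V i \<omega>)\<^sup>2 / 2)) / 2))" .
    have le: "(exp (x - x\<^sup>2 / 2) + exp (- x - x\<^sup>2 / 2)) / 2 \<le> 1" for x :: real
    proof -
      have "(exp (x - x\<^sup>2 / 2) + exp (- x - x\<^sup>2 / 2)) / 2 = cosh x / exp (x\<^sup>2 / 2)"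
        by (simp add: cosh_field_def exp_diff add_divide_distrib)
      then show ?thesis using cosh_le_exp_half_square[of x] by simp
    qed
    have "expectation (\<lambda>\<omega>. (exp (V i \<omega> - (V i \<omega>)\<^sup>2 / 2) + exp (- V i \<omega> - (V i \<omega>)\<^sup>2 / 2)) / 2) \<le> expectation (\<lambda>\<omega>. 1)"
      using i1 i2 le by (intro integral_mono) auto
    moreover have "0 \<le> expectation (\<lambda>\<omega>. (exp (V i \<omega> - (V i \<omega>)\<^sup>2 / 2) + exp (- V i \<omega> - (V i \<omega>)\<^sup>2 / 2)) / 2)"
      by (intro Bochner_Integration.integral_nonneg) auto
    ultimately show ?thesis unfolding e3 by (simp add: prob_space)
  qed
  have "(CLINT \<omega>|M. complex_of_real (\<Prod>i\<in>A. exp (V i \<omega> - (V i \<omega>)\<^sup>2 / 2))) = (\<Prod>i\<in>A. ?H i)"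
    using gaussian_transform_factorizes[of A "{}" V \<phi>] fin meas char by (simp del: of_real_prod)
  then have "complex_of_real (expectation (\<lambda>\<omega>. exp (\<Sum>i\<in>A. V i \<omega> - (V i \<omega>)\<^sup>2 / 2))) = (\<Prod>i\<in>A. ?H i)"
    by (simp only: integral_complex_of_real exp_sum[OF fin])
  then have "norm (complex_of_real (expectation (\<lambda>\<omega>. exp (\<Sum>i\<in>A. V i \<omega> - (V i \<omega>)\<^sup>2 / 2)))) \<le> 1"
    using H1 by (simp add: prod_norm[symmetric] prod_le_1 del: norm_of_real)
  then show ?thesis by simp
qed

section \<open>A maximal inequality for isotropic stable integrals\<close>

lemma stable_const_nonneg: "0 \<le> stable_const \<alpha>"
  unfolding stable_const_def set_lebesgue_integral_def
  by (intro mult_nonneg_nonneg Bochner_Integration.integral_nonneg) auto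

lemma L_alpha_measurable: "f \<in> L_alpha \<nu> \<alpha> \<Longrightarrow> f \<in> borel_measurable \<nu>"
  by (simp add: L_alpha_def)

lemma L_alpha_integrable: "f \<in> L_alpha \<nu> \<alpha> \<Longrightarrow> integrable \<nu> (\<lambda>x. cmod (f x) powr \<alpha>)"
  by (simp add: L_alpha_def)

lemma L_alpha_dominated:
  assumes g: "g \<in> L_alpha \<nu> \<alpha>" and "0 < \<alpha>" "0 \<le> C" and [measurable]: "f \<in> borel_measurable \<nu>"
    and le: "\<And>x. cmod (f x) \<le> C * cmod (g x)"
  shows "f \<in> L_alpha \<nu> \<alpha>" and "(LINT x|\<nu>. cmod (f x) powr \<alpha>) \<le> C powr \<alpha> * (LINT x|\<nu>. cmod (g x) powr \<alpha>)"
proof -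
  have p: "cmod (f x) powr \<alpha> \<le> C powr \<alpha> * cmod (g x) powr \<alpha>" for x
    using powr_mono2[OF _ _ le[of x], of \<alpha>] assms by (simp add: powr_mult)
  have i: "integrable \<nu> (\<lambda>x. C powr \<alpha> * cmod (g x) powr \<alpha>)"
    using L_alpha_integrable[OF g] by simp
  have "integrable \<nu> (\<lambda>x. cmod (f x) powr \<alpha>)"
    by (rule Bochner_Integration.integrable_bound[OF i]) (use p in auto)
  then show "f \<in> L_alpha \<nu> \<alpha>" by (simp add: L_alpha_def)
  have "(LINT x|\<nu>. cmod (f x) powr \<alpha>) \<le> (LINT x|\<nu>. C powr \<alpha> * cmod (g x) powr \<alpha>)"
    by (rule integral_mono) (use p i \<open>integrable \<nu> (\<lambda>x. cmod (f x) powr \<alpha>)\<close> in auto)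
  then show "(LINT x|\<nu>. cmod (f x) powr \<alpha>) \<le> C powr \<alpha> * (LINT x|\<nu>. cmod (g x) powr \<alpha>)" by simp
qed

lemma L_alpha_lincomb:
  assumes f: "f \<in> L_alpha \<nu> \<alpha>" and g: "g \<in> L_alpha \<nu> \<alpha>" and "0 < \<alpha>"
  shows "(\<lambda>x. a * f x + b * g x) \<in> L_alpha \<nu> \<alpha>"
proof -
  have [measurable]: "f \<in> borel_measurable \<nu>" "g \<in> borel_measurable \<nu>"
    using f g by (auto simp: L_alpha_def)
  have p: "cmod (a * f x + b * g x) powr \<alpha> \<le>
      (2 * cmod a) powr \<alpha> * cmod (f x) powr \<alpha> + (2 * cmod b) powr \<alpha> * cmod (g x) powr \<alpha>" for x
  proof -
    have "cmod (a * f x + b * g x) \<le> 2 * max (cmod a * cmod (f x)) (cmod b * cmod (g x))"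
      by (rule order_trans[OF norm_triangle_ineq]) (simp add: norm_mult)
    then have "cmod (a * f x + b * g x) powr \<alpha> \<le> (2 * max (cmod a * cmod (f x)) (cmod b * cmod (g x))) powr \<alpha>"
      using \<open>0 < \<alpha>\<close> by (intro powr_mono2) auto
    also have "\<dots> \<le> (2 * cmod a * cmod (f x)) powr \<alpha> + (2 * cmod b * cmod (g x)) powr \<alpha>"
      by (simp add: max_def mult.assoc)
    finally show ?thesis by (simp add: powr_mult)
  qed
  have i: "integrable \<nu> (\<lambda>x. (2 * cmod a) powr \<alpha> * cmod (f x) powr \<alpha> + (2 * cmod b) powr \<alpha> * cmod (g x) powr \<alpha>)"
    using L_alpha_integrable[OF f] L_alpha_integrable[OF g] by simp
  have "integrable \<nu> (\<lambda>x. cmod (a * f x + b * g x) powr \<alpha>)"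
    by (rule Bochner_Integration.integrable_bound[OF i]) (use p in auto)
  then show ?thesis by (simp add: L_alpha_def)
qed

lemma one_minus_exp_sum_le:
  fixes a :: "'i \<Rightarrow> real"
  assumes "finite I" "\<And>i. i \<in> I \<Longrightarrow> 0 \<le> a i"
  shows "1 - exp (- (\<Sum>i\<in>I. a i)) \<le> (\<Sum>i\<in>I. 1 - exp (- a i))"
  using assms
proof (induction I rule: finite_induct)
  case (insert i I)
  have "0 \<le> (1 - exp (- a i)) * (1 - exp (- (\<Sum>i\<in>I. a i)))"
    using insert.prems by (intro mult_nonneg_nonneg) (auto intro!: sum_nonneg)
  then have "1 - exp (- a i) * exp (- (\<Sum>i\<in>I. a i)) \<le> (1 - exp (- a i)) + (1 - exp (- (\<Sum>i\<in>I. a i)))"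
    by (simp add: algebra_simps)
  with insert show ?case by (simp add: exp_add[symmetric])
qed simp

locale stable_integral = prob_space P for P :: "'w measure" +
  fixes \<alpha> :: real and \<nu> :: "'a measure" and M :: "('a \<Rightarrow> complex) \<Rightarrow> 'w \<Rightarrow> complex"
  assumes alpha_pos: "0 < \<alpha>" and alpha_less_2: "\<alpha> < 2"
    and stable: "isotropic_stable_random_measure P \<alpha> \<nu> M"
begin

abbreviation mass :: "('a \<Rightarrow> complex) \<Rightarrow> real" where
  "mass f \<equiv> (LINT x|\<nu>. cmod (f x) powr \<alpha>)"

lemma M_measurable: "f \<in> L_alpha \<nu> \<alpha> \<Longrightarrow> M f \<in> borel_measurable P"
  using stable by (auto simp: isotropic_stable_random_measure_def)

lemma M_lincomb: "f \<in> L_alpha \<nu> \<alpha> \<Longrightarrow> g \<in> L_alpha \<nu> \<alpha> \<Longrightarrow>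
    AE \<omega> in P. M (\<lambda>x. a * f x + b * g x) \<omega> = a * M f \<omega> + b * M g \<omega>"
  using stable by (auto simp: isotropic_stable_random_measure_def)

lemma M_char: "f \<in> L_alpha \<nu> \<alpha> \<Longrightarrow> (CLINT \<omega>|P. iexp (Re (cnj z * M f \<omega>))) =
    complex_of_real (exp (- stable_const \<alpha> * cmod z powr \<alpha> * mass f))"
  using stable by (auto simp: isotropic_stable_random_measure_def)

lemma zero_in_L_alpha: "(\<lambda>x. 0) \<in> L_alpha \<nu> \<alpha>"
  by (simp add: L_alpha_def)

lemma M_zero: "AE \<omega> in P. M (\<lambda>x. 0) \<omega> = 0"
  using M_lincomb[OF zero_in_L_alpha zero_in_L_alpha, of 0 0] by simp

lemma M_sum:
  assumes "finite I" "\<And>i. i \<in> I \<Longrightarrow> f i \<in> L_alpha \<nu> \<alpha>"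
  shows "(\<lambda>x. \<Sum>i\<in>I. a i * f i x) \<in> L_alpha \<nu> \<alpha> \<and>
    (AE \<omega> in P. M (\<lambda>x. \<Sum>i\<in>I. a i * f i x) \<omega> = (\<Sum>i\<in>I. a i * M (f i) \<omega>))"
  using assms
proof (induction I rule: finite_induct)
  case empty
  then show ?case using M_zero zero_in_L_alpha by simp
next
  case (insert i I)
  then have 1: "(\<lambda>x. \<Sum>i\<in>I. a i * f i x) \<in> L_alpha \<nu> \<alpha>"
    and 2: "AE \<omega> in P. M (\<lambda>x. \<Sum>i\<in>I. a i * f i x) \<omega> = (\<Sum>i\<in>I. a i * M (f i) \<omega>)" 
    and 3: "f i \<in> L_alpha \<nu> \<alpha>" by auto
  have eq: "(\<lambda>x. \<Sum>i\<in>insert i I. a i * f i x) = (\<lambda>x. a i * f i x + 1 * (\<Sum>i\<in>I. a i * f i x))"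
    using insert by simp
  have "AE \<omega> in P. M (\<lambda>x. \<Sum>i\<in>insert i I. a i * f i x) \<omega> = (\<Sum>i\<in>insert i I. a i * M (f i) \<omega>)"
    using M_lincomb[OF 3 1, of "a i" 1] 2 unfolding eq
    by eventually_elim (use insert in simp)
  moreover have "(\<lambda>x. \<Sum>i\<in>insert i I. a i * f i x) \<in> L_alpha \<nu> \<alpha>"
    unfolding eq by (rule L_alpha_lincomb[OF 3 1 alpha_pos])
  ultimately show ?case by blast
qed

lemma M_diff:
  assumes f: "f \<in> L_alpha \<nu> \<alpha>" and g: "g \<in> L_alpha \<nu> \<alpha>"
  shows "(\<lambda>x. f x - g x) \<in> L_alpha \<nu> \<alpha>" and "AE \<omega> in P. M (\<lambda>x. f x - g x) \<omega> = M f \<omega> - M g \<omega>"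
  using L_alpha_lincomb[OF f g alpha_pos, of 1 "- 1"] M_lincomb[OF f g, of 1 "- 1"] by simp_all

text \<open>The Gaussian average of the characteristic function is a Laplace-type functional of the square of the
integral, and \<open>1 - exp (- r) \<le> r\<close> turns it into the tail rate \<open>x powr - \<alpha>\<close>. The factor 2 is the Gaussian mean
of \<open>1 + s\<^sup>2\<close>, which dominates \<open>\<bar>s\<bar> powr \<alpha>\<close> for every exponent below 2.\<close>

lemma expectation_one_minus_gaussian_le:
  assumes f: "f \<in> L_alpha \<nu> \<alpha>" and x: "0 < x" and z: "cmod z = 1"
  shows "expectation (\<lambda>\<omega>. 1 - exp (- ((Re (cnj z * M f \<omega>))\<^sup>2 / (2 * x\<^sup>2)))) \<le> 2 * stable_const \<alpha> * mass f * x powr - \<alpha>"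
proof -
  interpret N: real_distribution std_normal_distribution by (rule real_dist_normal_dist)
  interpret pair_sigma_finite P std_normal_distribution by unfold_locales
  interpret PP: pair_prob_space P std_normal_distribution by unfold_locales
  have [measurable]: "M f \<in> borel_measurable P" by (rule M_measurable[OF f])
  define V where "V \<omega> = Re (cnj z * M f \<omega>)" for \<omega>
  have [measurable]: "V \<in> borel_measurable P" unfolding V_def by measurable
  let ?c = "stable_const \<alpha> * mass f * x powr - \<alpha>"
  have sc: "0 \<le> mass f" by (intro Bochner_Integration.integral_nonneg) auto
  have c0: "0 \<le> ?c" using stable_const_nonneg[of \<alpha>] sc by simp
  have ch: "(CLINT \<omega>|P. iexp (s * (V \<omega> / x))) = complex_of_real (exp (- (?c * \<bar>s\<bar> powr \<alpha>)))" for s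
  proof -
    have "s * (V \<omega> / x) = Re (cnj (complex_of_real (s/x) * z) * M f \<omega>)" for \<omega>
      by (simp add: V_def field_simps)
    moreover have "- stable_const \<alpha> * cmod (complex_of_real (s/x) * z) powr \<alpha> * mass f = - (?c * \<bar>s\<bar> powr \<alpha>)"
    proof -
      have "cmod (complex_of_real (s/x) * z) = \<bar>s\<bar> / x" using z x by (simp add: norm_mult norm_divide)
      then have "cmod (complex_of_real (s/x) * z) powr \<alpha> = \<bar>s\<bar> powr \<alpha> * x powr - \<alpha>"
        using x by (simp add: powr_divide powr_minus divide_inverse powr_mult inverse_powr del: norm_mult norm_divide)
      then show ?thesis by (simp only:) (simp add: mult_ac)
    qed
    ultimately show ?thesis
      using M_char[OF f, of "complex_of_real (s/x) * z"] by (simp only:)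
  qed
  let ?F = "\<lambda>\<omega> s. iexp (s * (V \<omega> / x))"
  have int: "integrable (P \<Otimes>\<^sub>M std_normal_distribution) (case_prod ?F)"
    by (rule PP.integrable_const_bound[where B=1]) auto
  have "complex_of_real (expectation (\<lambda>\<omega>. exp (- ((V \<omega>)\<^sup>2 / (2 * x\<^sup>2))))) =
        (CLINT \<omega>|P. CLINT s|std_normal_distribution. ?F \<omega> s)"
    unfolding integral_complex_of_real[symmetric]
  proof (rule Bochner_Integration.integral_cong)
    fix \<omega>
    have "(CLINT s|std_normal_distribution. ?F \<omega> s) = char std_normal_distribution (V \<omega> / x)"
      unfolding char_def by (simp add: mult_ac)
    then show "complex_of_real (exp (- ((V \<omega>)\<^sup>2 / (2 * x\<^sup>2)))) = (CLINT s|std_normal_distribution. ?F \<omega> s)"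
      by (simp add: char_std_normal_distribution power_divide del: exp_of_real)
  qed simp
  also have "\<dots> = (CLINT s|std_normal_distribution. CLINT \<omega>|P. ?F \<omega> s)"
    by (rule Fubini_integral[OF int, symmetric])
  also have "\<dots> = complex_of_real (LINT s|std_normal_distribution. exp (- (?c * \<bar>s\<bar> powr \<alpha>)))"
    unfolding ch integral_complex_of_real ..
  finally have eq: "expectation (\<lambda>\<omega>. exp (- ((V \<omega>)\<^sup>2 / (2 * x\<^sup>2)))) =
      (LINT s|std_normal_distribution. exp (- (?c * \<bar>s\<bar> powr \<alpha>)))"
    using of_real_eq_iff by blast
  have i2: "integrable std_normal_distribution (\<lambda>s. s\<^sup>2)"
    using integrable_std_normal_distribution_moment[of 2] by simp
  have m2: "(LINT s|std_normal_distribution. s\<^sup>2) = 1"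
    using std_normal_distribution_even_moments(1)[of 1] by (simp add: fact_numeral)
  have pw: "\<bar>s\<bar> powr \<alpha> \<le> 1 + s\<^sup>2" for s :: real
  proof (cases "\<bar>s\<bar> \<le> 1")
    case True
    then have "\<bar>s\<bar> powr \<alpha> \<le> 1" using alpha_pos by (simp add: powr_le1)
    then show ?thesis by (simp add: add_increasing2)
  next
    case False
    then have "\<bar>s\<bar> powr \<alpha> \<le> \<bar>s\<bar> powr 2" using alpha_less_2 by (intro powr_mono) auto
    then show ?thesis using False by (simp add: powr_numeral)
  qed
  have "(LINT s|std_normal_distribution. 1 - ?c * (1 + s\<^sup>2)) \<le> (LINT s|std_normal_distribution. exp (- (?c * \<bar>s\<bar> powr \<alpha>)))"
  proof (rule integral_mono)
    show "integrable std_normal_distribution (\<lambda>s. exp (- (?c * \<bar>s\<bar> powr \<alpha>)))"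
      by (rule N.integrable_const_bound[where B=1]) (use c0 in auto)
    show "integrable std_normal_distribution (\<lambda>s. 1 - ?c * (1 + s\<^sup>2))"
      using i2 by simp
    fix s :: real
    have "1 + (- (?c * \<bar>s\<bar> powr \<alpha>)) \<le> exp (- (?c * \<bar>s\<bar> powr \<alpha>))" by (rule exp_ge_add_one_self)
    moreover have "?c * \<bar>s\<bar> powr \<alpha> \<le> ?c * (1 + s\<^sup>2)" by (rule mult_left_mono[OF pw c0])
    ultimately show "1 - ?c * (1 + s\<^sup>2) \<le> exp (- (?c * \<bar>s\<bar> powr \<alpha>))" by linarith
  qed
  moreover have "(LINT s|std_normal_distribution. 1 - ?c * (1 + s\<^sup>2)) = 1 - ?c * 2"
    using i2 m2 N.prob_space by simp
  moreover have "integrable P (\<lambda>\<omega>. exp (- ((V \<omega>)\<^sup>2 / (2 * x\<^sup>2))))"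
    by (rule integrable_const_bound[where B=1]) auto
  ultimately show ?thesis using eq unfolding V_def[symmetric] by (simp add: prob_space)
qed

text \<open>Square sums of stable integrals have the same tail as a single integral: \<open>\<lambda>r. 1 - exp (- r)\<close> is subadditive, so
the bound for one Gaussian functional can be summed, and Markov's inequality applies. The
constant 12 is 4 (two real coordinates, factor 2 each) times 3, as \<open>1 - exp (- 1 / 2) \<ge> 1 / 3\<close>.\<close>

lemma prob_square_sum_ge_le:
  assumes fin: "finite I" and h: "\<And>i. i \<in> I \<Longrightarrow> h i \<in> L_alpha \<nu> \<alpha>" and x: "0 < x"
  shows "prob {\<omega>\<in>space P. x\<^sup>2 \<le> (\<Sum>i\<in>I. (cmod (M (h i) \<omega>))\<^sup>2)} \<le>
     12 * stable_const \<alpha> * x powr - \<alpha> * (\<Sum>i\<in>I. mass (h i))"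
proof -
  have [measurable]: "\<And>i. i \<in> I \<Longrightarrow> M (h i) \<in> borel_measurable P" using h M_measurable by auto
  define S where "S \<omega> = (\<Sum>i\<in>I. (cmod (M (h i) \<omega>))\<^sup>2)" for \<omega>
  have [measurable]: "S \<in> borel_measurable P" unfolding S_def by measurable
  have S0: "0 \<le> S \<omega>" for \<omega> by (simp add: S_def sum_nonneg)
  let ?p = "\<lambda>z i \<omega>. 1 - exp (- ((Re (cnj z * M (h i) \<omega>))\<^sup>2 / (2 * x\<^sup>2)))"
  have ip: "integrable P (?p z i)" if "i \<in> I" for z i
    using that by (intro integrable_const_bound[where B=1]) auto
  have pt: "1 - exp (- (S \<omega> / (2 * x\<^sup>2))) \<le> (\<Sum>i\<in>I. ?p 1 i \<omega> + ?p \<i> i \<omega>)" for \<omega>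
  proof -
    have "S \<omega> / (2 * x\<^sup>2) = (\<Sum>i\<in>I. (cmod (M (h i) \<omega>))\<^sup>2 / (2 * x\<^sup>2))"
      by (simp add: S_def sum_divide_distrib)
    then have "1 - exp (- (S \<omega> / (2 * x\<^sup>2))) \<le> (\<Sum>i\<in>I. 1 - exp (- ((cmod (M (h i) \<omega>))\<^sup>2 / (2 * x\<^sup>2))))"
      using one_minus_exp_sum_le[OF fin, of "\<lambda>i. (cmod (M (h i) \<omega>))\<^sup>2 / (2 * x\<^sup>2)"] by simp
    also have "\<dots> \<le> (\<Sum>i\<in>I. ?p 1 i \<omega> + ?p \<i> i \<omega>)"
    proof (rule sum_mono)
      fix i
      let ?a = "\<lambda>b::bool. (if b then (Re (M (h i) \<omega>))\<^sup>2 else (Im (M (h i) \<omega>))\<^sup>2) / (2 * x\<^sup>2)"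
      have "1 - exp (- (\<Sum>b\<in>{True,False}. ?a b)) \<le> (\<Sum>b\<in>{True,False}. 1 - exp (- ?a b))"
        by (rule one_minus_exp_sum_le) auto
      then show "1 - exp (- ((cmod (M (h i) \<omega>))\<^sup>2 / (2 * x\<^sup>2))) \<le> ?p 1 i \<omega> + ?p \<i> i \<omega>"
        by (simp add: cmod_power2 add_divide_distrib)
    qed
    finally show ?thesis .
  qed
  have e: "exp (- (1/2::real)) \<le> 2/3"
  proof -
    have "1 + 1/2 \<le> exp (1/2::real)" by (rule exp_ge_add_one_self)
    then have "inverse (exp (1/2::real)) \<le> inverse (3/2)" by (intro le_imp_inverse_le) auto
    then show ?thesis by (simp add: exp_minus)
  qed
  have "1/3 * prob {\<omega>\<in>space P. x\<^sup>2 \<le> S \<omega>} = expectation (\<lambda>\<omega>. 1/3 * indicator {\<omega>\<in>space P. x\<^sup>2 \<le> S \<omega>} \<omega>)"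
    by simp
  also have "\<dots> \<le> expectation (\<lambda>\<omega>. 1 - exp (- (S \<omega> / (2 * x\<^sup>2))))"
  proof (rule integral_mono)
    show "integrable P (\<lambda>\<omega>. 1 - exp (- (S \<omega> / (2 * x\<^sup>2))))"
      using S0 by (intro integrable_const_bound[where B=1]) auto
    fix \<omega> assume "\<omega> \<in> space P"
    show "1/3 * indicator {\<omega>\<in>space P. x\<^sup>2 \<le> S \<omega>} \<omega> \<le> 1 - exp (- (S \<omega> / (2 * x\<^sup>2)))"
    proof (cases "x\<^sup>2 \<le> S \<omega>")
      case True
      then have "1/2 \<le> S \<omega> / (2 * x\<^sup>2)" using x by (simp add: field_simps)
      then have "exp (- (S \<omega> / (2 * x\<^sup>2))) \<le> exp (- (1/2))" by (simp only: exp_le_cancel_iff neg_le_iff_le)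
      with e have "exp (- (S \<omega> / (2 * x\<^sup>2))) \<le> 2/3" by linarith
      moreover have "(1/3::real) * indicator {\<omega>\<in>space P. x\<^sup>2 \<le> S \<omega>} \<omega> \<le> 1/3" by (simp add: indicator_def)
      ultimately show ?thesis by linarith
    qed (use S0 in \<open>auto simp: indicator_def\<close>)
  qed (auto intro!: integrable_real_indicator simp: emeasure_eq_measure)
  also have "\<dots> \<le> expectation (\<lambda>\<omega>. \<Sum>i\<in>I. ?p 1 i \<omega> + ?p \<i> i \<omega>)"
  proof (rule integral_mono)
    show "integrable P (\<lambda>\<omega>. 1 - exp (- (S \<omega> / (2 * x\<^sup>2))))"
      using S0 by (intro integrable_const_bound[where B=1]) auto
    show "integrable P (\<lambda>\<omega>. \<Sum>i\<in>I. ?p 1 i \<omega> + ?p \<i> i \<omega>)"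
      using ip by (intro Bochner_Integration.integrable_sum Bochner_Integration.integrable_add)
  qed (rule pt)
  also have "\<dots> = (\<Sum>i\<in>I. expectation (?p 1 i) + expectation (?p \<i> i))"
    by (simp only: Bochner_Integration.integral_sum Bochner_Integration.integral_add
          Bochner_Integration.integrable_add ip cong: sum.cong)
  also have "\<dots> \<le> (\<Sum>i\<in>I. 4 * stable_const \<alpha> * x powr - \<alpha> * mass (h i))"
  proof (rule sum_mono)
    fix i assume "i \<in> I"
    from expectation_one_minus_gaussian_le[OF h[OF this] x, of 1] expectation_one_minus_gaussian_le[OF h[OF this] x, of \<i>]
    show "expectation (?p 1 i) + expectation (?p \<i> i) \<le> 4 * stable_const \<alpha> * x powr - \<alpha> * mass (h i)"
      by (simp add: mult_ac)
  qed
  finally show ?thesis unfolding S_def by (simp add: sum_distrib_left[symmetric] mult_ac)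
qed

lemma prob_norm_ge_le:
  assumes "f \<in> L_alpha \<nu> \<alpha>" "0 < x"
  shows "prob {\<omega>\<in>space P. x \<le> cmod (M f \<omega>)} \<le> 12 * stable_const \<alpha> * x powr - \<alpha> * mass f"
  using prob_square_sum_ge_le[of "{()}" "\<lambda>_. f" x] assms by simp

text \<open>On the event that the square sum is at most \<open>x\<^sup>2\<close>, a linear form in integrals over disjoint supports has a
Gaussian tail, although its unconditional tail is only polynomial. The disjoint supports make the
characteristic function of the real parts factorize, and the exponential bound applies to the form
scaled by the optimal \<open>l = t / x\<^sup>2\<close>.\<close>

lemma prob_linear_form_gt_le:
  assumes fin: "finite I" and h: "\<And>i. i \<in> I \<Longrightarrow> h i \<in> L_alpha \<nu> \<alpha>"
    and disj: "\<And>i j x. i \<in> I \<Longrightarrow> j \<in> I \<Longrightarrow> i \<noteq> j \<Longrightarrow> h i x = 0 \<or> h j x = 0"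
    and c: "\<And>i. i \<in> I \<Longrightarrow> cmod (c i) \<le> 1" and x: "0 < x" and t: "0 \<le> t"
  shows "prob {\<omega>\<in>space P. t \<le> Re (\<Sum>i\<in>I. c i * M (h i) \<omega>) \<and> (\<Sum>i\<in>I. (cmod (M (h i) \<omega>))\<^sup>2) \<le> x\<^sup>2}
     \<le> exp (- (t\<^sup>2 / (2 * x\<^sup>2)))"
proof -
  have [measurable]: "\<And>i. i \<in> I \<Longrightarrow> M (h i) \<in> borel_measurable P" using h M_measurable by auto
  define l where "l = t / x\<^sup>2"
  have l0: "0 \<le> l" using t by (simp add: l_def)
  define V where "V i \<omega> = l * Re (c i * M (h i) \<omega>)" for i \<omega>
  have [measurable]: "\<And>i. i \<in> I \<Longrightarrow> V i \<in> borel_measurable P" unfolding V_def by measurable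
  define \<phi> where "\<phi> i s = complex_of_real (exp (- stable_const \<alpha> * (cmod (of_real (s * l) * c i) powr \<alpha> * mass (h i))))" for i s
  have char: "(CLINT \<omega>|P. iexp (\<Sum>i\<in>I. s i * V i \<omega>)) = (\<Prod>i\<in>I. \<phi> i (s i))" for s
  proof -
    let ?a = "\<lambda>i. complex_of_real (s i * l) * c i"
    let ?f = "\<lambda>x. \<Sum>i\<in>I. ?a i * h i x"
    have f: "?f \<in> L_alpha \<nu> \<alpha>" and ae: "AE \<omega> in P. M ?f \<omega> = (\<Sum>i\<in>I. ?a i * M (h i) \<omega>)"
      using M_sum[OF fin h, of "\<lambda>i. i" ?a] by auto
    have [measurable]: "M ?f \<in> borel_measurable P" by (rule M_measurable[OF f])
    have "(CLINT \<omega>|P. iexp (\<Sum>i\<in>I. s i * V i \<omega>)) = (CLINT \<omega>|P. iexp (Re (cnj 1 * M ?f \<omega>)))"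
    proof (rule integral_cong_AE)
      show "AE \<omega> in P. iexp (\<Sum>i\<in>I. s i * V i \<omega>) = iexp (Re (cnj 1 * M ?f \<omega>))"
        using ae
      proof eventually_elim
        case (elim \<omega>)
        have "Re (\<Sum>i\<in>I. ?a i * M (h i) \<omega>) = (\<Sum>i\<in>I. s i * V i \<omega>)"
          unfolding V_def Re_sum by (rule sum.cong) (auto simp: algebra_simps)
        with elim show ?case by simp
      qed
    qed measurable
    also have "\<dots> = complex_of_real (exp (- stable_const \<alpha> * mass ?f))"
      using M_char[OF f, of 1] by simp
    also have "mass ?f = (LINT x|\<nu>. (\<Sum>i\<in>I. cmod (?a i) powr \<alpha> * cmod (h i x) powr \<alpha>))"
    proof (rule Bochner_Integration.integral_cong)
      fix x
      show "cmod (?f x) powr \<alpha> = (\<Sum>i\<in>I. cmod (?a i) powr \<alpha> * cmod (h i x) powr \<alpha>)"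
      proof (cases "\<exists>j\<in>I. h j x \<noteq> 0")
        case True
        then obtain j where j: "j \<in> I" "h j x \<noteq> 0" by auto
        then have z: "h i x = 0" if "i \<in> I - {j}" for i using disj[of i j x] that by auto
        have "?f x = ?a j * h j x" 
          using sum.remove[OF fin j(1), of "\<lambda>i. ?a i * h i x"] z by simp
        moreover have "(\<Sum>i\<in>I. cmod (?a i) powr \<alpha> * cmod (h i x) powr \<alpha>) = cmod (?a j) powr \<alpha> * cmod (h j x) powr \<alpha>"
          using sum.remove[OF fin j(1), of "\<lambda>i. cmod (?a i) powr \<alpha> * cmod (h i x) powr \<alpha>"] z by simp
        ultimately show ?thesis by (simp add: norm_mult powr_mult)
      qed simp
    qed simp
    also have "\<dots> = (\<Sum>i\<in>I. cmod (?a i) powr \<alpha> * mass (h i))"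
      using h by (subst Bochner_Integration.integral_sum) (auto intro!: integrable_mult_right L_alpha_integrable)
    also have "complex_of_real (exp (- stable_const \<alpha> * (\<Sum>i\<in>I. cmod (?a i) powr \<alpha> * mass (h i)))) = (\<Prod>i\<in>I. \<phi> i (s i))"
      unfolding \<phi>_def of_real_prod[symmetric] exp_sum[OF fin, symmetric] by (simp add: sum_distrib_left)
    finally show ?thesis .
  qed
  have E1: "expectation (\<lambda>\<omega>. exp (\<Sum>i\<in>I. V i \<omega> - (V i \<omega>)\<^sup>2 / 2)) \<le> 1"
    by (rule expectation_exp_minus_half_squares_le_1[OF fin _ char]) (auto simp: \<phi>_def norm_mult)
  let ?A = "{\<omega>\<in>space P. t \<le> Re (\<Sum>i\<in>I. c i * M (h i) \<omega>) \<and> (\<Sum>i\<in>I. (cmod (M (h i) \<omega>))\<^sup>2) \<le> x\<^sup>2}"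
  have "exp (t\<^sup>2 / (2 * x\<^sup>2)) * prob ?A = expectation (\<lambda>\<omega>. exp (t\<^sup>2 / (2 * x\<^sup>2)) * indicator ?A \<omega>)"
    by simp
  also have "\<dots> \<le> expectation (\<lambda>\<omega>. exp (\<Sum>i\<in>I. V i \<omega> - (V i \<omega>)\<^sup>2 / 2))"
  proof (rule integral_mono)
    have "(\<Sum>i\<in>I. V i \<omega> - (V i \<omega>)\<^sup>2 / 2) \<le> (\<Sum>i\<in>I. 1/2)" for \<omega>
    proof (rule sum_mono)
      fix i
      have "0 \<le> (V i \<omega> - 1)\<^sup>2" by simp
      then show "V i \<omega> - (V i \<omega>)\<^sup>2 / 2 \<le> 1/2" by (simp add: power2_eq_square algebra_simps)
    qed
    then show "integrable P (\<lambda>\<omega>. exp (\<Sum>i\<in>I. V i \<omega> - (V i \<omega>)\<^sup>2 / 2))"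
      by (intro integrable_const_bound[where B="exp (\<Sum>i\<in>I. 1/2)"]) (auto simp del: sum_constant)
    fix \<omega>
    show "exp (t\<^sup>2 / (2 * x\<^sup>2)) * indicator ?A \<omega> \<le> exp (\<Sum>i\<in>I. V i \<omega> - (V i \<omega>)\<^sup>2 / 2)"
    proof (cases "\<omega> \<in> ?A")
      case True
      then have 1: "t \<le> Re (\<Sum>i\<in>I. c i * M (h i) \<omega>)" and 2: "(\<Sum>i\<in>I. (cmod (M (h i) \<omega>))\<^sup>2) \<le> x\<^sup>2" by auto
      have "(\<Sum>i\<in>I. (V i \<omega>)\<^sup>2) \<le> (\<Sum>i\<in>I. l\<^sup>2 * (cmod (M (h i) \<omega>))\<^sup>2)"
      proof (rule sum_mono)
        fix i assume i: "i \<in> I"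
        have "\<bar>Re (c i * M (h i) \<omega>)\<bar> \<le> cmod (c i * M (h i) \<omega>)" by (rule abs_Re_le_cmod)
        also have "\<dots> \<le> cmod (M (h i) \<omega>)" using c[OF i] by (simp add: norm_mult mult_left_le_one_le)
        finally have "(Re (c i * M (h i) \<omega>))\<^sup>2 \<le> (cmod (M (h i) \<omega>))\<^sup>2"
          by (metis abs_le_square_iff abs_norm_cancel)
        then show "(V i \<omega>)\<^sup>2 \<le> l\<^sup>2 * (cmod (M (h i) \<omega>))\<^sup>2"
          unfolding V_def power_mult_distrib by (rule mult_left_mono) simp
      qed
      also have "\<dots> \<le> l\<^sup>2 * x\<^sup>2" unfolding sum_distrib_left[symmetric] by (rule mult_left_mono[OF 2]) simp
      finally have sq: "(\<Sum>i\<in>I. (V i \<omega>)\<^sup>2) \<le> l\<^sup>2 * x\<^sup>2" .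
      have "(\<Sum>i\<in>I. V i \<omega>) = l * Re (\<Sum>i\<in>I. c i * M (h i) \<omega>)"
        by (simp only: V_def Re_sum sum_distrib_left)
      then have "l * t \<le> (\<Sum>i\<in>I. V i \<omega>)" using 1 l0 by (simp add: mult_left_mono)
      with sq have "l * t - l\<^sup>2 * x\<^sup>2 / 2 \<le> (\<Sum>i\<in>I. V i \<omega> - (V i \<omega>)\<^sup>2 / 2)"
        by (simp add: sum_subtractf sum_divide_distrib[symmetric])
      moreover have "l * t - l\<^sup>2 * x\<^sup>2 / 2 = t\<^sup>2 / (2 * x\<^sup>2)"
        using x by (simp add: l_def power2_eq_square field_simps)
      ultimately show ?thesis using True by simp
    qed auto
  qed (auto intro!: integrable_real_indicator simp: emeasure_eq_measure)
  also have "\<dots> \<le> 1" by (rule E1)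
  finally show ?thesis by (simp add: exp_minus field_simps)
qed


text \<open>Reduces the modulus of a complex linear form to real parts of four rotations of it, each again a linear form.\<close>

lemma norm_gt_imp_rotated_Re_gt:
  assumes "2 * t < cmod y"
  shows "\<exists>u\<in>{1, - 1, \<i>, - \<i>}. t \<le> Re (u * y)"
proof (rule ccontr)
  assume "\<not> ?thesis"
  then have "\<bar>Re y\<bar> < t" "\<bar>Im y\<bar> < t" by auto
  then have "cmod y < 2 * t" using cmod_le[of y] by linarith
  then show False using assms by simp
qed

text \<open>The maximum of \<open>N\<close> integrals with a common envelope \<open>g\<close> behaves like one heavy-tailed variable times the
square root of \<open>ln N\<close>, instead of picking up the factor \<open>N powr (1 / \<alpha>)\<close> of a plain union bound. The
quotients \<open>f k / g\<close> are rounded to a grid of step \<open>1 / Suc m\<close>; this splits the space into finitely many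
cells, common to all \<open>k\<close>, on which every quotient is nearly constant. Each integral is then close to a linear form
with coefficients at most 1 in the integrals of \<open>g\<close> over the cells. Only the square sum of these cell integrals is
heavy-tailed, and it does not depend on \<open>k\<close>; the union bound is paid at Gaussian cost. The rounding errors
vanish as \<open>m\<close> tends to infinity.\<close>

lemma maximal_inequality:
  assumes fin: "finite F" and g: "(\<lambda>x. complex_of_real (g x)) \<in> L_alpha \<nu> \<alpha>" and g0: "\<And>x. 0 \<le> g x"
    and f_meas: "\<And>k. k \<in> F \<Longrightarrow> f k \<in> borel_measurable \<nu>"
    and f_le: "\<And>k x. k \<in> F \<Longrightarrow> cmod (f k x) \<le> g x"
    and x: "0 < x" and t: "0 < t"
  shows "prob {\<omega>\<in>space P. \<exists>k\<in>F. 3 * t < cmod (M (f k) \<omega>)} \<le>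
     12 * stable_const \<alpha> * x powr - \<alpha> * (LINT x|\<nu>. g x powr \<alpha>) + 4 * card F * exp (- (t\<^sup>2 / (2 * x\<^sup>2)))"
proof -
  have gm[measurable]: "g \<in> borel_measurable \<nu>"
    using measurable_compose[OF L_alpha_measurable[OF g] borel_measurable_Re] by simp
  have f_in: "f k \<in> L_alpha \<nu> \<alpha>" if "k \<in> F" for k
    using L_alpha_dominated(1)[OF g alpha_pos, of 1 "f k"] f_meas[OF that] f_le[OF that] g0 by simp
  define c where "c k x = (if g x = 0 then 0 else f k x / of_real (g x))" for k x
  have cg: "f k x = c k x * of_real (g x)" if "k \<in> F" for k x
    using f_le[OF that, of x] by (auto simp: c_def)
  have c1: "cmod (c k x) \<le> 1" if "k \<in> F" for k x
    using f_le[OF that, of x] g0[of x] by (auto simp: c_def norm_divide divide_le_eq)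
  have c_meas: "c k \<in> borel_measurable \<nu>" if "k \<in> F" for k
  proof -
    have [measurable]: "f k \<in> borel_measurable \<nu>" using f_meas that by simp
    show ?thesis unfolding c_def by measurable
  qed
  let ?B = "12 * stable_const \<alpha> * x powr - \<alpha> * (LINT x|\<nu>. g x powr \<alpha>) + 4 * card F * exp (- (t\<^sup>2 / (2 * x\<^sup>2)))"
  let ?D = "card F * (12 * stable_const \<alpha> * t powr - \<alpha> * (LINT x|\<nu>. g x powr \<alpha>))"
  let ?E = "{\<omega>\<in>space P. \<exists>k\<in>F. 3 * t < cmod (M (f k) \<omega>)}"
  have approx: "prob ?E \<le> ?B + ?D * (2 / Suc m) powr \<alpha>" for m
  proof -
    define q where "q x = (\<lambda>k\<in>F. (\<lfloor>Suc m * Re (c k x)\<rfloor>, \<lfloor>Suc m * Im (c k x)\<rfloor>))" for x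
    define Z where "Z = (range q)"
    have "q x \<in> PiE F (\<lambda>_. {- int (Suc m)..int (Suc m)} \<times> {- int (Suc m)..int (Suc m)})" for x
    proof -
      have b: "\<lfloor>real (Suc m) * r\<rfloor> \<in> {- int (Suc m)..int (Suc m)}" if "\<bar>r\<bar> \<le> 1" for r :: real
      proof -
        have "\<bar>real (Suc m) * r\<bar> \<le> real (Suc m) * 1"
          unfolding abs_mult using that by (intro mult_mono) auto
        then have "- real (Suc m) \<le> real (Suc m) * r" and "real (Suc m) * r \<le> real (Suc m)"
          by (auto simp only: abs_le_iff mult_1_right)
        then have "of_int (- int (Suc m)) \<le> real (Suc m) * r" and "real (Suc m) * r \<le> of_int (int (Suc m))"
          by (simp_all only: of_int_minus of_int_of_nat_eq)
        from le_floor_iff[THEN iffD2, OF this(1)] floor_mono[OF this(2)] show ?thesis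
          by (simp only: floor_of_int atLeastAtMost_iff)
      qed
      have "\<bar>Re (c k x)\<bar> \<le> 1" "\<bar>Im (c k x)\<bar> \<le> 1" if "k \<in> F" for k
        using c1[OF that, of x] abs_Re_le_cmod[of "c k x"] abs_Im_le_cmod[of "c k x"] by linarith+
      then show ?thesis unfolding q_def by (intro PiE_I) (auto simp del: of_nat_Suc atLeastAtMost_iff intro!: b)
    qed
    then have finZ: "finite Z" unfolding Z_def
      using finite_PiE[OF fin, of "\<lambda>_. {- int (Suc m)..int (Suc m)} \<times> {- int (Suc m)..int (Suc m)}"]
      by (meson finite_SigmaI finite_atLeastAtMost_int finite_subset image_subsetI)
    \<comment> \<open>A value attained in the cell is used as coefficient, so that its modulus stays at most 1.\<close>
    define rep where "rep z = (SOME x. q x = z)" for z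
    have rep: "q (rep z) = z" if "z \<in> Z" for z
      using that unfolding rep_def Z_def by (auto intro: someI_ex)
    define h where "h z x = (if q x = z then complex_of_real (g x) else 0)" for z x
    have near: "cmod (c k x - c k y) \<le> 2 / Suc m" if k: "k \<in> F" and e: "q x = q y" for k x y
    proof -
      have "\<lfloor>Suc m * Re (c k x)\<rfloor> = \<lfloor>Suc m * Re (c k y)\<rfloor>" "\<lfloor>Suc m * Im (c k x)\<rfloor> = \<lfloor>Suc m * Im (c k y)\<rfloor>"
        using fun_cong[OF e, of k] k by (auto simp: q_def)
      then have "\<bar>Suc m * Re (c k x) - Suc m * Re (c k y)\<bar> \<le> 1" "\<bar>Suc m * Im (c k x) - Suc m * Im (c k y)\<bar> \<le> 1"
        by linarith+
      then have "Suc m * \<bar>Re (c k x - c k y)\<bar> \<le> 1" "Suc m * \<bar>Im (c k x - c k y)\<bar> \<le> 1"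
        by (simp_all add: right_diff_distrib[symmetric] abs_mult del: of_nat_Suc)
      then have "\<bar>Re (c k x - c k y)\<bar> \<le> 1 / Suc m" "\<bar>Im (c k x - c k y)\<bar> \<le> 1 / Suc m"
        by (simp_all add: field_simps)
      then show ?thesis using cmod_le[of "c k x - c k y"] by simp
    qed
    have cell: "{x\<in>space \<nu>. q x = z} \<in> sets \<nu>" if "z \<in> Z" for z
    proof -
      obtain y where y: "z = q y" using \<open>z \<in> Z\<close> by (auto simp: Z_def)
      have "{x\<in>space \<nu>. q x = z} = {x\<in>space \<nu>. \<forall>k\<in>F. (\<lfloor>Suc m * Re (c k x)\<rfloor>, \<lfloor>Suc m * Im (c k x)\<rfloor>) = z k}"
        unfolding y q_def by (auto simp: restrict_def fun_eq_iff)
      also have "\<dots> \<in> sets \<nu>"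
      proof (rule sets.sets_Collect_finite_All[OF _ fin])
        fix k assume "k \<in> F"
        then have [measurable]: "c k \<in> borel_measurable \<nu>" by (rule c_meas)
        have "{x\<in>space \<nu>. (\<lfloor>Suc m * Re (c k x)\<rfloor>, \<lfloor>Suc m * Im (c k x)\<rfloor>) = z k} =
           {x\<in>space \<nu>. \<lfloor>Suc m * Re (c k x)\<rfloor> = fst (z k) \<and> \<lfloor>Suc m * Im (c k x)\<rfloor> = snd (z k)}"
          by (auto simp: prod_eq_iff)
        also have "\<dots> \<in> sets \<nu>" by measurable
        finally show "{x\<in>space \<nu>. (\<lfloor>Suc m * Re (c k x)\<rfloor>, \<lfloor>Suc m * Im (c k x)\<rfloor>) = z k} \<in> sets \<nu>" .
      qed
      finally show ?thesis .
    qed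
    have h_meas: "h z \<in> borel_measurable \<nu>" if "z \<in> Z" for z
      unfolding h_def using cell[OF that] by (intro measurable_If) auto
    have h_in: "h z \<in> L_alpha \<nu> \<alpha>" if "z \<in> Z" for z
      by (rule L_alpha_dominated(1)[OF g alpha_pos, of 1]) (use h_meas[OF that] in \<open>auto simp: h_def\<close>)
    have mass_h: "(\<Sum>z\<in>Z. mass (h z)) = (LINT x|\<nu>. g x powr \<alpha>)"
    proof -
      have "(\<Sum>z\<in>Z. mass (h z)) = (LINT x|\<nu>. (\<Sum>z\<in>Z. cmod (h z x) powr \<alpha>))"
        using h_in by (subst Bochner_Integration.integral_sum) (auto intro!: L_alpha_integrable)
      also have "\<dots> = (LINT x|\<nu>. g x powr \<alpha>)"
      proof (rule Bochner_Integration.integral_cong)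
        fix x
        have "(\<Sum>z\<in>Z. cmod (h z x) powr \<alpha>) = (\<Sum>z\<in>Z. if z = q x then g x powr \<alpha> else 0)"
          using g0 by (intro sum.cong) (auto simp: h_def)
        also have "\<dots> = g x powr \<alpha>" using finZ by (simp add: Z_def)
        finally show "(\<Sum>z\<in>Z. cmod (h z x) powr \<alpha>) = g x powr \<alpha>" .
      qed simp
      finally show ?thesis .
    qed
    define G where "G k x = (\<Sum>z\<in>Z. c k (rep z) * h z x)" for k x
    have G_eq: "G k x = c k (rep (q x)) * of_real (g x)" for k x
    proof -
      have "G k x = (\<Sum>z\<in>Z. if z = q x then c k (rep (q x)) * of_real (g x) else 0)"
        unfolding G_def by (intro sum.cong) (auto simp: h_def)
      then show ?thesis using finZ by (simp add: Z_def)
    qed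
    have G_in: "G k \<in> L_alpha \<nu> \<alpha>" and G_ae: "AE \<omega> in P. M (G k) \<omega> = (\<Sum>z\<in>Z. c k (rep z) * M (h z) \<omega>)" for k
      using M_sum[OF finZ h_in, of "\<lambda>z. z" "\<lambda>z. c k (rep z)"] unfolding G_def by auto
    define R where "R k x = f k x - G k x" for k x
    have R_le: "cmod (R k x) \<le> 2 / Suc m * cmod (complex_of_real (g x))" if "k \<in> F" for k x
    proof -
      have "R k x = (c k x - c k (rep (q x))) * of_real (g x)"
        unfolding R_def G_eq cg[OF that] by (simp add: left_diff_distrib)
      moreover have "cmod (c k x - c k (rep (q x))) \<le> 2 / Suc m"
        using that by (rule near) (simp add: rep Z_def)
      ultimately show ?thesis by (simp only: norm_mult mult_right_mono norm_ge_zero)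
    qed
    have R_in: "R k \<in> L_alpha \<nu> \<alpha>" and R_mass: "mass (R k) \<le> (2 / Suc m) powr \<alpha> * (LINT x|\<nu>. g x powr \<alpha>)"
      and R_ae: "AE \<omega> in P. M (R k) \<omega> = M (f k) \<omega> - M (G k) \<omega>" if "k \<in> F" for k
    proof -
      show i: "R k \<in> L_alpha \<nu> \<alpha>" unfolding R_def by (rule M_diff(1)[OF f_in[OF that] G_in])
      show "AE \<omega> in P. M (R k) \<omega> = M (f k) \<omega> - M (G k) \<omega>" unfolding R_def by (rule M_diff(2)[OF f_in[OF that] G_in])
      show "mass (R k) \<le> (2 / Suc m) powr \<alpha> * (LINT x|\<nu>. g x powr \<alpha>)"
        using L_alpha_dominated(2)[OF g alpha_pos _ L_alpha_measurable[OF i] R_le[OF that]] g0 by simp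
    qed
    let ?S = "\<lambda>\<omega>. \<Sum>z\<in>Z. (cmod (M (h z) \<omega>))\<^sup>2"
    let ?Y = "\<lambda>k \<omega>. \<Sum>z\<in>Z. c k (rep z) * M (h z) \<omega>"
    let ?U = "{1, - 1, \<i>, - \<i>} :: complex set"
    define E0 where "E0 = {\<omega>\<in>space P. x\<^sup>2 \<le> ?S \<omega>}"
    define E1 where "E1 p = {\<omega>\<in>space P. t \<le> Re (\<Sum>z\<in>Z. (snd p * c (fst p) (rep z)) * M (h z) \<omega>) \<and> ?S \<omega> \<le> x\<^sup>2}" for p
    define E2 where "E2 k = {\<omega>\<in>space P. t \<le> cmod (M (R k) \<omega>)}" for k
    have [measurable]: "\<And>z. z \<in> Z \<Longrightarrow> M (h z) \<in> borel_measurable P"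
      "\<And>k. k \<in> F \<Longrightarrow> M (R k) \<in> borel_measurable P"
      using h_in R_in M_measurable by auto
    have m0: "E0 \<in> sets P" and m1: "\<And>p. E1 p \<in> sets P" and m2: "\<And>k. k \<in> F \<Longrightarrow> E2 k \<in> sets P"
      unfolding E0_def E1_def E2_def by measurable
    have p0: "prob E0 \<le> 12 * stable_const \<alpha> * x powr - \<alpha> * (LINT x|\<nu>. g x powr \<alpha>)"
      unfolding E0_def using prob_square_sum_ge_le[where h=h, OF finZ h_in x] mass_h by simp
    have p1: "prob (E1 p) \<le> exp (- (t\<^sup>2 / (2 * x\<^sup>2)))" if "p \<in> F \<times> ?U" for p
      unfolding E1_def
    proof (rule prob_linear_form_gt_le[where h=h, OF finZ h_in _ _ x])
      show "h i x = 0 \<or> h j x = 0" if "i \<noteq> j" for i j x using that by (auto simp: h_def)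
      show "cmod (snd p * c (fst p) (rep i)) \<le> 1" for i
        using that c1[of "fst p" "rep i"] by (auto simp: norm_mult)
    qed (use t in auto)
    have p2: "prob (E2 k) \<le> 12 * stable_const \<alpha> * t powr - \<alpha> * ((2 / Suc m) powr \<alpha> * (LINT x|\<nu>. g x powr \<alpha>))" if "k \<in> F" for k
    proof -
      have "prob (E2 k) \<le> 12 * stable_const \<alpha> * t powr - \<alpha> * mass (R k)"
        unfolding E2_def by (rule prob_norm_ge_le[OF R_in[OF that] t])
      also have "\<dots> \<le> 12 * stable_const \<alpha> * t powr - \<alpha> * ((2 / Suc m) powr \<alpha> * (LINT x|\<nu>. g x powr \<alpha>))"
        using R_mass[OF that] stable_const_nonneg[of \<alpha>] by (intro mult_left_mono) auto
      finally show ?thesis .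
    qed
    have "AE \<omega> in P. \<forall>k\<in>F. M (R k) \<omega> = M (f k) \<omega> - M (G k) \<omega> \<and> M (G k) \<omega> = ?Y k \<omega>"
      using R_ae G_ae fin by (auto simp: AE_finite_all)
    then have "AE \<omega> in P. \<omega> \<in> ?E \<longrightarrow> \<omega> \<in> E0 \<union> (\<Union>p\<in>F \<times> ?U. E1 p) \<union> (\<Union>k\<in>F. E2 k)"
    proof eventually_elim
      case (elim \<omega>)
      show ?case
      proof (intro impI, rule ccontr)
        assume "\<omega> \<in> ?E" and no: "\<omega> \<notin> E0 \<union> (\<Union>p\<in>F \<times> ?U. E1 p) \<union> (\<Union>k\<in>F. E2 k)"
        then obtain k where k: "k \<in> F" "3 * t < cmod (M (f k) \<omega>)" and sp: "\<omega> \<in> space P" by auto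
        have S: "?S \<omega> \<le> x\<^sup>2" using no sp by (auto simp: E0_def)
        have "cmod (M (R k) \<omega>) < t" using no sp k by (auto simp: E2_def)
        moreover have "M (f k) \<omega> = M (R k) \<omega> + ?Y k \<omega>" using elim k by auto
        ultimately have "2 * t < cmod (?Y k \<omega>)"
          using k(2) norm_triangle_ineq[of "M (R k) \<omega>" "?Y k \<omega>"] by simp
        then obtain u where u: "u \<in> ?U" "t \<le> Re (u * ?Y k \<omega>)"
          using norm_gt_imp_rotated_Re_gt by blast
        have "u * ?Y k \<omega> = (\<Sum>z\<in>Z. (u * c k (rep z)) * M (h z) \<omega>)"
          by (simp add: sum_distrib_left mult.assoc)
        then have "\<omega> \<in> E1 (k, u)" using u(2) S sp by (simp add: E1_def)
        then show False using no k(1) u(1) by blast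
      qed
    qed
    moreover have u1: "(\<Union>p\<in>F \<times> ?U. E1 p) \<in> sets P" and u2: "(\<Union>k\<in>F. E2 k) \<in> sets P"
      using m1 m2 fin by (auto intro!: sets.finite_UN simp del: UN_simps UN_insert)
    ultimately have "prob ?E \<le> prob (E0 \<union> (\<Union>p\<in>F \<times> ?U. E1 p) \<union> (\<Union>k\<in>F. E2 k))"
      using m0 by (intro finite_measure_mono_AE sets.Un)
    also have "\<dots> \<le> prob E0 + prob (\<Union>p\<in>F \<times> ?U. E1 p) + prob (\<Union>k\<in>F. E2 k)"
      using m0 u1 u2
      by (intro order_trans[OF measure_Un_le] add_right_mono measure_Un_le sets.Un)
    also have "\<dots> \<le> prob E0 + (\<Sum>p\<in>F \<times> ?U. prob (E1 p)) + (\<Sum>k\<in>F. prob (E2 k))"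
      using m0 m1 m2 fin by (intro add_mono finite_measure_subadditive_finite) auto
    also have "\<dots> \<le> 12 * stable_const \<alpha> * x powr - \<alpha> * (LINT x|\<nu>. g x powr \<alpha>) +
       (\<Sum>p\<in>F \<times> ?U. exp (- (t\<^sup>2 / (2 * x\<^sup>2)))) +
       (\<Sum>k\<in>F. 12 * stable_const \<alpha> * t powr - \<alpha> * ((2 / Suc m) powr \<alpha> * (LINT x|\<nu>. g x powr \<alpha>)))"
      by (intro add_mono sum_mono p0 p1 p2)
    also have "\<dots> \<le> ?B + ?D * (2 / Suc m) powr \<alpha>"
    proof -
      have "card ?U \<le> 4" by (simp add: card_insert_if)
      then have "card F * card ?U \<le> card F * 4" by (rule mult_left_mono) simp
      then have "card (F \<times> ?U) \<le> 4 * card F" by (simp only: card_cartesian_product mult.commute[of 4])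
      then have "real (card (F \<times> ?U)) \<le> 4 * real (card F)" by linarith
      then have "(\<Sum>p\<in>F \<times> ?U. exp (- (t\<^sup>2 / (2 * x\<^sup>2)))) \<le> 4 * real (card F) * exp (- (t\<^sup>2 / (2 * x\<^sup>2)))"
        by (simp only: sum_constant) (rule mult_right_mono, auto)
      then show ?thesis by (simp add: mult_ac)
    qed
    finally show ?thesis .
  qed
  have "(\<lambda>m. (2 / Suc m) powr \<alpha>) \<longlonglongrightarrow> 0"
    using alpha_pos by real_asymp
  then have "(\<lambda>m. ?B + ?D * (2 / Suc m) powr \<alpha>) \<longlonglongrightarrow> ?B + ?D * 0"
    by (intro tendsto_intros)
  from LIMSEQ_le_const[OF this] approx show ?thesis by simp
qed

end

section \<open>One-parameter groups of matrices\<close>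

text \<open>The dilation \<open>r\<^sup>E\<close> with \<open>r = exp t\<close>. The additive parameter turns the dilations into a one-parameter group that
can be differentiated in \<open>t\<close>, and scales become integers.\<close>

definition flow :: "real^'n^'n \<Rightarrow> real \<Rightarrow> real^'n^'n" where
  "flow E t = matrix_exp (t *\<^sub>R E)"

abbreviation mpow :: "real^'n^'n \<Rightarrow> nat \<Rightarrow> real^'n^'n" where
  "mpow A k \<equiv> ((\<lambda>B. A ** B) ^^ k) (mat 1)"

lemma matrix_mult_entry: "(A ** B) $ i $ j = (\<Sum>k\<in>UNIV. A $ i $ k * B $ k $ j)"
  by (simp add: matrix_matrix_mult_def)

lemma scaleR_matrix_mult_left: "(t *\<^sub>R A) ** B = t *\<^sub>R (A ** B :: real^'n^'m)"
  by (simp add: vec_eq_iff matrix_mult_entry sum_distrib_left mult.assoc)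

lemma scaleR_matrix_mult_right: "A ** (t *\<^sub>R B) = t *\<^sub>R (A ** B :: real^'n^'m)"
  by (simp add: vec_eq_iff matrix_mult_entry sum_distrib_left mult_ac)

lemma mpow_commute: "mpow A k ** A = A ** mpow A k"
  by (induction k) (simp_all add: matrix_mul_assoc[symmetric])

lemma mpow_scaleR: "mpow (t *\<^sub>R A) k = t ^ k *\<^sub>R mpow A k"
  by (induction k) (simp_all add: scaleR_matrix_mult_left scaleR_matrix_mult_right mult.commute)

lemma mpow_transpose: "mpow (transpose A) k = transpose (mpow A k)"
  by (induction k) (simp_all add: transpose_mat matrix_transpose_mul[symmetric] mpow_commute)

lemma mpow_entry_bound:
  fixes A :: "real^'n^'n"
  shows "\<bar>mpow A k $ i $ j\<bar> \<le> (real CARD('n) * norm A) ^ k"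
proof (induction k arbitrary: i j)
  case 0
  then show ?case by (simp add: mat_def)
next
  case (Suc k)
  have e: "\<bar>A $ i $ l\<bar> \<le> norm A" for l
    by (rule order_trans[OF component_le_norm_cart Finite_Cartesian_Product.norm_nth_le])
  have "\<bar>mpow A (Suc k) $ i $ j\<bar> \<le> (\<Sum>l\<in>UNIV. \<bar>A $ i $ l * mpow A k $ l $ j\<bar>)"
    by (simp add: matrix_mult_entry)
  also have "\<dots> \<le> (\<Sum>l\<in>(UNIV::'n set). norm A * (real CARD('n) * norm A) ^ k)"
    unfolding abs_mult by (intro sum_mono mult_mono e Suc.IH) auto
  finally show ?case by (simp add: mult_ac)
qed

lemma exp_series_summable:
  fixes A :: "real^'n^'n"
  shows "summable (\<lambda>k. mpow A k $ i $ j / fact k * t ^ k)"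
proof (rule summable_comparison_test')
  show "summable (\<lambda>k. (real CARD('n) * norm A * \<bar>t\<bar>) ^ k / fact k)"
    using summable_exp[of "real CARD('n) * norm A * \<bar>t\<bar>"] by (simp add: divide_inverse mult.commute)
  fix k
  have "\<bar>mpow A k $ i $ j\<bar> * \<bar>t\<bar> ^ k \<le> (real CARD('n) * norm A) ^ k * \<bar>t\<bar> ^ k"
    by (intro mult_right_mono mpow_entry_bound) auto
  then show "norm (mpow A k $ i $ j / fact k * t ^ k) \<le> (real CARD('n) * norm A * \<bar>t\<bar>) ^ k / fact k"
    by (simp add: abs_mult power_abs power_mult_distrib divide_right_mono)
qed

lemma sums_vec_nth:
  assumes "\<And>i. (\<lambda>k. f k $ i) sums (s $ i)"
  shows "f sums s"
  using assms unfolding sums_def by (intro vec_tendstoI) simp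

lemma flow_entry: "flow A t $ i $ j = (\<Sum>k. mpow A k $ i $ j / fact k * t ^ k)"
proof -
  let ?S = "\<chi> i j. (\<Sum>k. mpow A k $ i $ j / fact k * t ^ k)"
  have "(\<lambda>k. (1 / fact k) *\<^sub>R mpow (t *\<^sub>R A) k) sums ?S"
    by (intro sums_vec_nth)
       (use exp_series_summable[of A _ _ t, THEN summable_sums] in \<open>simp add: mpow_scaleR mult_ac\<close>)
  then have "flow A t = ?S" unfolding flow_def matrix_exp_def by (simp add: sums_iff)
  then show ?thesis by simp
qed

lemma flow_0 [simp]: "flow A 0 = mat 1"
proof -
  have "flow A 0 $ i $ j = mat 1 $ i $ j" for i j
    using powser_zero[of "\<lambda>k. mpow A k $ i $ j / fact k"] by (simp add: flow_entry)
  then show ?thesis by (simp add: vec_eq_iff)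
qed

lemma flow_transpose: "flow (transpose A) t = transpose (flow A t)"
proof -
  have "flow (transpose A) t $ i $ j = flow A t $ j $ i" for i j
    unfolding flow_entry mpow_transpose by (simp add: transpose_def)
  then show ?thesis by (simp add: vec_eq_iff transpose_def)
qed

lemma flow_entry_bound:
  fixes A :: "real^'n^'n"
  shows "\<bar>flow A t $ i $ j\<bar> \<le> exp (real CARD('n) * norm A * \<bar>t\<bar>)"
proof -
  let ?x = "real CARD('n) * norm A * \<bar>t\<bar>"
  have b: "\<bar>mpow A k $ i $ j / fact k * t ^ k\<bar> \<le> ?x ^ k /\<^sub>R fact k" for k
  proof -
    have "\<bar>mpow A k $ i $ j\<bar> * \<bar>t\<bar> ^ k \<le> (real CARD('n) * norm A) ^ k * \<bar>t\<bar> ^ k"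
      by (intro mult_right_mono mpow_entry_bound) auto
    then show ?thesis
      by (simp add: abs_mult power_abs power_mult_distrib divide_right_mono divide_inverse_commute)
  qed
  have "\<bar>flow A t $ i $ j\<bar> \<le> (\<Sum>k. ?x ^ k /\<^sub>R fact k)"
    unfolding flow_entry real_norm_def[symmetric]
    by (rule norm_suminf_le) (use b summable_exp_generic[of ?x] in auto)
  then show ?thesis by (simp add: exp_def)
qed

lemma flow_commute: "flow A t ** A = A ** flow A t"
proof -
  have "(flow A t ** A) $ i $ j = (A ** flow A t) $ i $ j" for i j
  proof -
    have s: "(\<lambda>k. mpow A k $ i $ j / fact k * t ^ k) sums flow A t $ i $ j" for i j
      using exp_series_summable[THEN summable_sums] by (simp add: flow_entry)
    have 1: "(\<lambda>k. \<Sum>l\<in>UNIV. mpow A k $ i $ l / fact k * t ^ k * A $ l $ j) sums (flow A t ** A) $ i $ j"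
      unfolding matrix_mult_entry by (intro sums_sum sums_mult2 s)
    have 2: "(\<lambda>k. \<Sum>l\<in>UNIV. A $ i $ l * (mpow A k $ l $ j / fact k * t ^ k)) sums (A ** flow A t) $ i $ j"
      unfolding matrix_mult_entry by (intro sums_sum sums_mult s)
    have "(\<Sum>l\<in>UNIV. mpow A k $ i $ l / fact k * t ^ k * A $ l $ j) =
       (\<Sum>l\<in>UNIV. A $ i $ l * (mpow A k $ l $ j / fact k * t ^ k))" for k
    proof -
      have "(\<Sum>l\<in>UNIV. mpow A k $ i $ l / fact k * t ^ k * A $ l $ j) = (mpow A k ** A) $ i $ j * (t ^ k / fact k)"
        by (simp add: matrix_mult_entry sum_distrib_left sum_distrib_right sum_divide_distrib mult_ac)
      also have "\<dots> = (\<Sum>l\<in>UNIV. A $ i $ l * (mpow A k $ l $ j / fact k * t ^ k))"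
        unfolding mpow_commute by (simp add: matrix_mult_entry sum_distrib_left sum_distrib_right sum_divide_distrib mult_ac)
      finally show ?thesis .
    qed
    with 1 2 show ?thesis by (simp add: sums_iff)
  qed
  then show ?thesis by (simp add: vec_eq_iff)
qed

lemma flow_entry_deriv:
  "((\<lambda>t. flow A t $ i $ j) has_real_derivative (A ** flow A t) $ i $ j) (at t)"
proof -
  let ?c = "\<lambda>k. mpow A k $ i $ j / fact k"
  have "((\<lambda>t. \<Sum>k. ?c k * t ^ k) has_real_derivative (\<Sum>k. diffs ?c k * t ^ k)) (at t)"
    by (rule termdiffs_strong_converges_everywhere) (rule exp_series_summable)
  moreover have "(\<Sum>k. diffs ?c k * t ^ k) = (A ** flow A t) $ i $ j"
  proof -
    have "(\<lambda>k. \<Sum>l\<in>UNIV. A $ i $ l * (mpow A k $ l $ j / fact k * t ^ k)) sums (A ** flow A t) $ i $ j"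
      unfolding matrix_mult_entry
      by (intro sums_sum sums_mult) (use exp_series_summable[THEN summable_sums] in \<open>simp add: flow_entry\<close>)
    moreover have "(\<Sum>l\<in>UNIV. A $ i $ l * (mpow A k $ l $ j / fact k * t ^ k)) = diffs ?c k * t ^ k" for k
    proof -
      have "diffs ?c k = mpow A (Suc k) $ i $ j / fact k"
        by (simp add: diffs_def del: funpow.simps)
      then show ?thesis by (simp add: matrix_mult_entry sum_distrib_left sum_distrib_right sum_divide_distrib mult_ac)
    qed
    ultimately show ?thesis by (simp add: sums_iff)
  qed
  ultimately show ?thesis by (simp add: flow_entry)
qed

lemmas flow_entry_deriv' [derivative_intros] = flow_entry_deriv[THEN DERIV_chain2]

text \<open>The group law comes from the differential equation: the left-hand side has derivative 0 in \<open>s\<close>.\<close>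

lemma flow_add_minus: "flow A (t + s) ** flow A (- s) = flow A t"
proof -
  have "(flow A (t + s) ** flow A (- s)) $ i $ j = flow A t $ i $ j" for i j
  proof -
    let ?G = "\<lambda>s. (flow A (t + s) ** flow A (- s)) $ i $ j"
    have "(?G has_real_derivative 0) (at s)" for s
    proof -
      have "(?G has_real_derivative (\<Sum>k\<in>UNIV. flow A (t + s) $ i $ k * ((A ** flow A (- s)) $ k $ j * - 1) +
           (A ** flow A (t + s)) $ i $ k * 1 * flow A (- s) $ k $ j)) (at s)"
        unfolding matrix_mult_entry[of "flow A (t + s)" for s]
        by (auto intro!: derivative_eq_intros sum.cong simp: algebra_simps)
      also have "(\<Sum>k\<in>UNIV. flow A (t + s) $ i $ k * ((A ** flow A (- s)) $ k $ j * - 1) +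
           (A ** flow A (t + s)) $ i $ k * 1 * flow A (- s) $ k $ j) =
         ((A ** flow A (t + s)) ** flow A (- s)) $ i $ j - (flow A (t + s) ** (A ** flow A (- s))) $ i $ j"
        unfolding matrix_mult_entry[of "A ** flow A (t + s)"] matrix_mult_entry[of "flow A (t + s)" "A ** flow A (- s)"]
        unfolding sum_subtractf[symmetric] by (intro sum.cong) (simp_all add: algebra_simps)
      also have "\<dots> = 0"
        by (simp add: matrix_mul_assoc flow_commute)
      finally show ?thesis .
    qed
    then have "?G s = ?G 0" using DERIV_isconst_all by blast
    then show ?thesis by simp
  qed
  then show ?thesis by (simp add: vec_eq_iff)
qed

lemma flow_inverse: "flow A s ** flow A (- s) = mat 1" "flow A (- s) ** flow A s = mat 1"
  using flow_add_minus[of A 0 s] flow_add_minus[of A 0 "- s"] by simp_all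

lemma flow_add: "flow A (t + s) = flow A t ** flow A s"
proof -
  have "flow A (t + s) = (flow A (t + s) ** flow A (- s)) ** flow A s"
    by (simp add: matrix_mul_assoc[symmetric] flow_inverse)
  then show ?thesis by (simp add: flow_add_minus)
qed

lemma flow_add_vec: "flow A (t + s) *v x = flow A t *v (flow A s *v x)"
  by (simp add: flow_add matrix_vector_mul_assoc)

lemma flow_inverse_vec [simp]: "flow A s *v (flow A (- s) *v x) = x" "flow A (- s) *v (flow A s *v x) = x"
  by (simp_all add: matrix_vector_mul_assoc flow_inverse)

lemma norm_matrix_vector_mult_le:
  fixes A :: "real^'n^'m"
  assumes "\<And>i j. \<bar>A $ i $ j\<bar> \<le> K"
  shows "norm (A *v x) \<le> real CARD('m) * real CARD('n) * K * norm x"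
proof -
  have "norm (A *v x) \<le> (\<Sum>i\<in>UNIV. \<bar>(A *v x) $ i\<bar>)" by (rule norm_le_l1_cart)
  also have "\<dots> \<le> (\<Sum>i\<in>(UNIV::'m set). \<Sum>j\<in>(UNIV::'n set). K * norm x)"
  proof (rule sum_mono)
    fix i
    have "\<bar>(A *v x) $ i\<bar> \<le> (\<Sum>j\<in>UNIV. \<bar>A $ i $ j * x $ j\<bar>)"
      by (simp add: matrix_vector_mult_def)
    also have "\<dots> \<le> (\<Sum>j\<in>(UNIV::'n set). K * norm x)"
      unfolding abs_mult using assms order_trans[OF abs_ge_zero assms]
      by (intro sum_mono mult_mono) (auto simp: component_le_norm_cart)
    finally show "\<bar>(A *v x) $ i\<bar> \<le> (\<Sum>j\<in>(UNIV::'n set). K * norm x)" .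
  qed
  finally show ?thesis by (simp add: mult_ac)
qed

lemma flow_growth:
  fixes A :: "real^'n^'n"
  shows "norm (flow A t *v x) \<le> (real CARD('n))\<^sup>2 * exp (real CARD('n) * norm A * \<bar>t\<bar>) * norm x"
  using norm_matrix_vector_mult_le[of "flow A t", OF flow_entry_bound] by (simp add: power2_eq_square)

lemma continuous_on_flow_vec: "continuous_on UNIV (\<lambda>t. flow A t *v x)"
proof -
  have "isCont (\<lambda>t. flow A t $ i $ j) t" for i j t
    using flow_entry_deriv[THEN DERIV_isCont] .
  then have "continuous_on UNIV (\<lambda>t. flow A t $ i $ j)" for i j
    by (simp add: continuous_at_imp_continuous_on)
  then show ?thesis unfolding matrix_vector_mult_def
    by (intro continuous_on_vec_lambda continuous_on_sum continuous_on_mult continuous_on_const)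
qed

text \<open>In the Leibniz expansion every permutation other than the identity moves at least two indices, so its
term vanishes to second order at the identity matrix.\<close>

lemma det_deriv_at_identity:
  fixes F :: "real \<Rightarrow> real^'n^'n"
  assumes F0: "F s = mat 1" and d: "\<And>i j. ((\<lambda>t. F t $ i $ j) has_real_derivative D $ i $ j) (at s)"
  shows "((\<lambda>t. det (F t)) has_real_derivative trace D) (at s)"
proof -
  let ?P = "{p. p permutes (UNIV :: 'n set)}"
  let ?d = "\<lambda>p. \<Sum>i\<in>UNIV. D $ i $ p i * (\<Prod>j\<in>UNIV - {i}. F s $ j $ p j)"
  have 1: "((\<lambda>t. det (F t)) has_real_derivative (\<Sum>p\<in>?P. of_int (sign p) * ?d p)) (at s)"
    unfolding det_def by (intro DERIV_sum DERIV_cmult has_field_derivative_prod d)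
  have "?d p = 0" if p: "p \<in> ?P - {id}" for p
  proof -
    from p obtain k where k: "p k \<noteq> k" by (auto simp: fun_eq_iff)
    have pp: "p permutes UNIV" using p by simp
    have "(\<Prod>j\<in>UNIV - {i}. F s $ j $ p j) = 0" for i
    proof -
      \<comment> \<open>If the moved index is the one removed from the product, its image is moved too.\<close>
      have "\<exists>j\<in>UNIV - {i}. p j \<noteq> j"
      proof (cases "k = i")
        case True
        have "p (p k) \<noteq> p k" using k permutes_inj[OF pp] by (metis injD)
        then show ?thesis using True k by blast
      qed (use k in auto)
      then obtain j where "j \<in> UNIV - {i}" "p j \<noteq> j" by blast
      then have "F s $ j $ p j = 0" by (auto simp: F0 mat_def dest: not_sym)
      with \<open>j \<in> UNIV - {i}\<close> have "\<exists>j\<in>UNIV - {i}. F s $ j $ p j = 0" ..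
      then show ?thesis by (subst prod_zero_iff) auto
    qed
    then show ?thesis by (simp only: mult_zero_right sum.neutral_const)
  qed
  then have "(\<Sum>p\<in>?P. of_int (sign p) * ?d p) = (\<Sum>p\<in>{id}. of_int (sign p) * ?d p)"
    by (intro sum.mono_neutral_right) (auto simp: permutes_id finite_permutations)
  also have "\<dots> = trace D"
    by (simp add: sign_id F0 mat_def trace_def)
  finally show ?thesis using 1 by simp
qed

lemma det_flow: "det (flow A t) = exp (t * trace A)"
proof -
  have d: "((\<lambda>t. det (flow A t)) has_real_derivative trace A * det (flow A t)) (at t)" for t
  proof -
    have "((\<lambda>s. det (flow A (s + - t))) has_real_derivative trace A) (at t)"
    proof (rule det_deriv_at_identity)
      fix i j
      have "((\<lambda>s. flow A (s + - t) $ i $ j) has_real_derivative (A ** flow A (t + - t)) $ i $ j * 1) (at t)"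
        by (auto intro!: derivative_eq_intros)
      then show "((\<lambda>s. flow A (s + - t) $ i $ j) has_real_derivative A $ i $ j) (at t)" by simp
    qed simp
    then have "((\<lambda>s. det (flow A (s + - t)) * det (flow A t)) has_real_derivative trace A * det (flow A t)) (at t)"
      by (rule DERIV_cmult_right)
    moreover have "det (flow A (s + - t)) * det (flow A t) = det (flow A s)" for s
      by (simp add: det_mul[symmetric] flow_add[symmetric])
    ultimately show ?thesis by simp
  qed
  have "((\<lambda>t. det (flow A t) * exp (- (t * trace A))) has_real_derivative 0) (at t)" for t
    by (auto intro!: derivative_eq_intros d)
  from DERIV_isconst_all[OF allI[OF this], of t 0]
  have "det (flow A t) * exp (- (t * trace A)) = 1" by simp
  then show ?thesis by (simp add: exp_minus field_simps)
qed

section \<open>Exponential decay from the spectrum\<close>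

definition cmat :: "real^'n^'n \<Rightarrow> complex^'n^'n" where
  "cmat A = (\<chi> i j. complex_of_real (A $ i $ j))"

lemma cmat_mult: "cmat (A ** B) = cmat A ** cmat B"
  by (simp add: cmat_def matrix_matrix_mult_def vec_eq_iff)

lemma cmat_one: "cmat (mat 1) = mat 1"
  by (simp add: cmat_def mat_def vec_eq_iff)

lemma cmat_eigen_iff: "l \<in> complex_spectrum E \<longleftrightarrow> (\<exists>v. v \<noteq> 0 \<and> cmat E *v v = l *s v)"
  by (simp add: complex_spectrum_def cmat_def)

text \<open>The vector \<open>p(E) y\<close>, by Horner's scheme, so that only matrix-vector products occur.\<close>

definition poly_at :: "real^'n^'n \<Rightarrow> complex poly \<Rightarrow> complex^'n \<Rightarrow> complex^'n" where
  "poly_at E p y = fold_coeffs (\<lambda>a v. a *s y + cmat E *v v) p 0"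

lemma poly_at_0 [simp]: "poly_at E 0 y = 0"
  by (simp add: poly_at_def)

lemma poly_at_pCons [simp]: "poly_at E (pCons a p) y = a *s y + cmat E *v poly_at E p y"
  by (cases "a = 0 \<and> p = 0") (auto simp: poly_at_def)

lemma poly_at_add: "poly_at E (p + q) y = poly_at E p y + poly_at E q y"
proof (induction p q rule: poly_induct2)
  case (pCons a p b q)
  then show ?case by (simp add: matrix_vector_right_distrib vector_sadd_rdistrib)
qed simp

lemma poly_at_smult: "poly_at E (smult a p) y = a *s poly_at E p y"
  by (induction p) (simp_all add: vector_add_ldistrib vector_smult_assoc vector_scalar_commute)

lemma poly_at_mult: "poly_at E (p * q) y = poly_at E p (poly_at E q y)"
  by (induction p) (simp_all add: poly_at_add poly_at_smult)

lemma poly_at_sum: "finite I \<Longrightarrow> poly_at E (\<Sum>i\<in>I. p i) y = (\<Sum>i\<in>I. poly_at E (p i) y)"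
  by (induction I rule: finite_induct) (simp_all add: poly_at_add)

lemma poly_at_linear: "poly_at E [:- l, 1:] y = cmat E *v y - l *s y"
  by simp

lemma poly_at_monom: "poly_at E (monom c k) y = c *s (cmat (mpow E k) *v y)"
  by (induction k)
     (simp_all add: monom_0 monom_Suc cmat_one cmat_mult matrix_vector_mul_assoc[symmetric] vector_scalar_commute)

lemma poly_at_eigenvector:
  assumes "cmat E *v v = l *s v"
  shows "poly_at E p v = poly p l *s v"
  by (induction p) (simp_all add: vector_scalar_commute assms vector_smult_assoc vector_sadd_rdistrib mult.commute)

lemma ex_linear_relation:
  fixes v :: "nat \<Rightarrow> 'a::euclidean_space"
  shows "\<exists>c. (\<exists>k\<le>DIM('a). c k \<noteq> 0) \<and> (\<Sum>k\<le>DIM('a). c k *\<^sub>R v k) = 0"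
proof (cases "inj_on v {..DIM('a)}")
  case False
  then obtain j k where jk: "j \<le> DIM('a)" "k \<le> DIM('a)" "j \<noteq> k" "v j = v k"
    by (auto simp: inj_on_def)
  have "(\<Sum>i\<le>DIM('a). ((if i = j then 1 else 0) - (if i = k then 1 else 0)) *\<^sub>R v i) = 0"
    using jk by (simp add: scaleR_left_diff_distrib sum_subtractf if_distrib[of "\<lambda>x. x *\<^sub>R _"] cong: if_cong)
  with jk show ?thesis
    by (intro exI[of _ "\<lambda>i. (if i = j then 1 else 0) - (if i = k then 1 else 0)"]) (auto intro!: exI[of _ j])
next
  case True
  have "card (v ` {..DIM('a)}) > DIM('a)" using card_image[OF True] by simp
  then have "dependent (v ` {..DIM('a)})" by (intro dependent_biggerset) auto
  then obtain u w where u: "w \<in> v ` {..DIM('a)}" "u w \<noteq> 0" "(\<Sum>w\<in>v ` {..DIM('a)}. u w *\<^sub>R w) = 0"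
    using dependent_finite[of "v ` {..DIM('a)}"] by auto
  have "(\<Sum>k\<le>DIM('a). u (v k) *\<^sub>R v k) = 0"
    using u(3) sum.reindex[OF True, of "\<lambda>w. u w *\<^sub>R w"] by simp
  with u(1,2) show ?thesis by (intro exI[of _ "\<lambda>k. u (v k)"]) auto
qed

text \<open>The powers of \<open>E\<close> are linearly dependent for dimension reasons. This crude annihilating polynomial is
enough both for the finiteness of the spectrum and for the decay estimate below.\<close>

lemma ex_annihilating_poly: "\<exists>p. p \<noteq> 0 \<and> (\<forall>y. poly_at E p y = 0)"
proof -
  let ?N = "DIM(real^'a^'a)"
  obtain c where c: "\<exists>k\<le>?N. c k \<noteq> 0" "(\<Sum>k\<le>?N. c k *\<^sub>R mpow E k) = 0"
    using ex_linear_relation[of "mpow E"] by blast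
  define p where "p = (\<Sum>k\<le>?N. monom (complex_of_real (c k)) k)"
  have "coeff p k = complex_of_real (c k)" if "k \<le> ?N" for k
    using that by (simp add: p_def coeff_sum)
  then have "p \<noteq> 0" using c(1) by (metis coeff_0 of_real_eq_0_iff)
  moreover have "poly_at E p y = 0" for y
  proof -
    have "poly_at E p y = (\<Sum>k\<le>?N. complex_of_real (c k) *s (cmat (mpow E k) *v y))"
      by (simp add: p_def poly_at_sum poly_at_monom)
    also have "\<dots> = cmat (\<Sum>k\<le>?N. c k *\<^sub>R mpow E k) *v y"
      by (simp add: vec_eq_iff cmat_def matrix_vector_mult_def sum_distrib_left sum_distrib_right mult.assoc)
         (intro allI sum.swap)
    finally show ?thesis unfolding c(2) by (simp add: cmat_def matrix_vector_mult_def vec_eq_iff)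
  qed
  ultimately show ?thesis by blast
qed

lemma finite_complex_spectrum: "finite (complex_spectrum E)"
proof -
  obtain p where p: "p \<noteq> 0" "\<And>y. poly_at E p y = 0" using ex_annihilating_poly by blast
  have "complex_spectrum E \<subseteq> {l. poly p l = 0}"
  proof
    fix l assume "l \<in> complex_spectrum E"
    then obtain v where v: "v \<noteq> 0" "cmat E *v v = l *s v" by (auto simp: cmat_eigen_iff)
    then have "poly p l *s v = 0" using poly_at_eigenvector[OF v(2), of p] p(2) by simp
    then show "l \<in> {l. poly p l = 0}" using v(1) by simp
  qed
  then show ?thesis using poly_roots_finite[OF p(1)] finite_subset by blast
qed

lemma cflow_deriv:
  "((\<lambda>t. (cmat (flow E (- t)) *v y) $ i) has_vector_derivative - ((cmat (flow E (- t)) *v (cmat E *v y)) $ i)) (at t)"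
proof -
  have "((\<lambda>t. complex_of_real (flow E (- t) $ i $ j)) has_vector_derivative complex_of_real (- (flow E (- t) ** E) $ i $ j)) (at t)" for j
  proof -
    have "((\<lambda>t. flow E (- t) $ i $ j) has_real_derivative - (flow E (- t) ** E) $ i $ j) (at t)"
      by (auto intro!: derivative_eq_intros simp: flow_commute)
    then show ?thesis
      by (auto simp: has_real_derivative_iff_has_vector_derivative flow_commute intro!: derivative_eq_intros has_vector_derivative_of_real)
  qed
  then have "((\<lambda>t. \<Sum>j\<in>UNIV. complex_of_real (flow E (- t) $ i $ j) * y $ j) has_vector_derivative
     (\<Sum>j\<in>UNIV. complex_of_real (- (flow E (- t) ** E) $ i $ j) * y $ j)) (at t)"
    by (intro has_vector_derivative_sum has_vector_derivative_mult_left)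
  moreover have "(\<Sum>j\<in>UNIV. complex_of_real (- (flow E (- t) ** E) $ i $ j) * y $ j) =
      - ((cmat (flow E (- t)) *v (cmat E *v y)) $ i)"
    unfolding matrix_vector_mul_assoc cmat_mult[symmetric]
    by (simp add: cmat_def matrix_vector_mult_def sum_negf)
  ultimately show ?thesis by (simp add: cmat_def matrix_vector_mult_def)
qed

text \<open>Variation of constants: if both orbits are multiplied by \<open>exp (t * l)\<close>, the derivative of the orbit of \<open>y\<close> is
the negative of the orbit of \<open>E y - l y\<close>, so the decay of the latter passes to the orbit of \<open>y\<close> if \<open>l\<close> has real part above \<open>a\<close>.\<close>

lemma cflow_decay_step:
  assumes decay: "\<And>t i. 0 \<le> t \<Longrightarrow> cmod ((cmat (flow E (- t)) *v (cmat E *v y - l *s y)) $ i) \<le> C * exp (- a * t)"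
    and l: "a < Re l"
  shows "\<exists>C'. \<forall>t\<ge>0. \<forall>i. cmod ((cmat (flow E (- t)) *v y) $ i) \<le> C' * exp (- a * t)"
proof (intro exI allI impI)
  fix t :: real and i assume t: "0 \<le> t"
  define w where "w t = (cmat (flow E (- t)) *v y) $ i" for t
  define r where "r t = (cmat (flow E (- t)) *v (cmat E *v y - l *s y)) $ i" for t
  define k where "k = Re l - a"
  have k: "0 < k" using l by (simp add: k_def)
  have C0: "0 \<le> C" using order_trans[OF norm_ge_zero decay[of 0 i]] by simp
  have r: "r t = (cmat (flow E (- t)) *v (cmat E *v y)) $ i - l * w t" for t
    by (simp add: r_def w_def matrix_vector_mult_diff_distrib vector_scalar_commute)
  have du: "((\<lambda>t. exp (t *\<^sub>R l) * w t) has_vector_derivative - (exp (t *\<^sub>R l) * r t)) (at t)" for t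
  proof -
    have "((\<lambda>t. exp (t *\<^sub>R l) * w t) has_vector_derivative
       exp (t *\<^sub>R l) * (- ((cmat (flow E (- t)) *v (cmat E *v y)) $ i)) + (exp (t *\<^sub>R l) * l) * w t) (at t)"
      unfolding w_def by (intro has_vector_derivative_mult exp_scaleR_has_vector_derivative_right cflow_deriv)
    then show ?thesis by (simp add: r algebra_simps)
  qed
  have main: "cmod (exp (t *\<^sub>R l) * w t - w 0) \<le> C / k * exp (k * t) - C / k" if "0 < t"
  proof -
    have "norm (exp (t *\<^sub>R l) * w t - exp (0 *\<^sub>R l) * w 0) \<le> C / k * exp (k * t) - C / k * exp (k * 0)"
    proof (rule differentiable_bound_general[OF that])
      show "continuous_on {0..t} (\<lambda>t. exp (t *\<^sub>R l) * w t)"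
        using du by (intro continuous_at_imp_continuous_on ballI has_vector_derivative_continuous) 
      show "((\<lambda>t. C / k * exp (k * t)) has_vector_derivative C * exp (k * x)) (at x)" for x :: real
        unfolding has_real_derivative_iff_has_vector_derivative[symmetric]
        using k by (auto intro!: derivative_eq_intros)
      fix x :: real assume x: "0 < x"
      have "cmod (exp (x *\<^sub>R l) * r x) \<le> exp (x * Re l) * (C * exp (- a * x))"
        unfolding norm_mult r_def using decay[of x i] x by (intro mult_mono) auto
      also have "\<dots> = C * exp (k * x)"
        by (simp add: k_def exp_add[symmetric] algebra_simps)
      finally show "norm (- (exp (x *\<^sub>R l) * r x)) \<le> C * exp (k * x)" by simp
    qed (use du k in \<open>auto intro!: continuous_intros\<close>)
    then show ?thesis by simp
  qed
  have w0: "cmod (w 0) \<le> (\<Sum>i\<in>UNIV. cmod (y $ i))"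
    unfolding w_def by (simp add: cmat_one) (rule member_le_sum, auto)
  have "cmod (w t) \<le> ((\<Sum>i\<in>UNIV. cmod (y $ i)) + C / k) * exp (- a * t)"
  proof (cases "t = 0")
    case True
    have "0 \<le> C / k" using C0 k by simp
    with True w0 show ?thesis by simp
  next
    case False
    then have "cmod (exp (t *\<^sub>R l) * w t) \<le> cmod (w 0) + (C / k * exp (k * t) - C / k)"
      using main t norm_triangle_ineq[of "exp (t *\<^sub>R l) * w t - w 0" "w 0"] by simp
    also have "\<dots> \<le> (\<Sum>i\<in>UNIV. cmod (y $ i)) * exp (k * t) + C / k * exp (k * t)"
    proof -
      have "0 \<le> C / k" using C0 k by simp
      moreover have "cmod (w 0) * 1 \<le> (\<Sum>i\<in>UNIV. cmod (y $ i)) * exp (k * t)"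
        using w0 k t by (intro mult_mono) (auto intro: sum_nonneg)
      ultimately show ?thesis by linarith
    qed
    finally have *: "exp (t * Re l) * cmod (w t) \<le> ((\<Sum>i\<in>UNIV. cmod (y $ i)) + C / k) * exp (k * t)"
      by (simp add: norm_mult algebra_simps)
    have "cmod (w t) = exp (- (t * Re l)) * (exp (t * Re l) * cmod (w t))"
      by (simp add: exp_minus)
    also have "\<dots> \<le> exp (- (t * Re l)) * (((\<Sum>i\<in>UNIV. cmod (y $ i)) + C / k) * exp (k * t))"
      by (rule mult_left_mono[OF *]) simp
    also have "\<dots> = ((\<Sum>i\<in>UNIV. cmod (y $ i)) + C / k) * (exp (- (t * Re l)) * exp (k * t))"
      by (simp only: mult_ac)
    also have "exp (- (t * Re l)) * exp (k * t) = exp (- a * t)"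
      by (simp add: exp_add[symmetric] k_def algebra_simps)
    finally show ?thesis .
  qed
  then show "cmod ((cmat (flow E (- t)) *v y) $ i) \<le> ((\<Sum>i\<in>UNIV. cmod (y $ i)) + C / k) * exp (- a * t)"
    by (simp add: w_def)
qed

text \<open>The growth rate of the matrix exponential is read off the spectrum by removing one linear factor of an
annihilating polynomial at a time. A root with real part above \<open>a\<close> is
handled by variation of constants; any other root is not an eigenvalue, and its factor is injective and
can be cancelled.\<close>

lemma cflow_decay:
  assumes spec: "\<And>l. l \<in> complex_spectrum E \<Longrightarrow> a < Re l"
    and "p \<noteq> 0" and "poly_at E p y = 0"
  shows "\<exists>C. \<forall>t\<ge>0. \<forall>i. cmod ((cmat (flow E (- t)) *v y) $ i) \<le> C * exp (- a * t)"
  using assms(2,3)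
proof (induction "degree p" arbitrary: p y rule: less_induct)
  case less
  show ?case
  proof (cases "degree p = 0")
    case True
    then obtain c where "p = [:c:]" by (rule degree_eq_zeroE)
    with less.prems have "y = 0" by simp
    then show ?thesis by (intro exI[of _ 0]) simp
  next
    case False
    then obtain l where "poly p l = 0"
      using fundamental_theorem_of_algebra constant_degree by metis
    then obtain q where q: "p = [:- l, 1:] * q" by (auto simp: poly_eq_0_iff_dvd)
    with less.prems(1) have q0: "q \<noteq> 0" by auto
    have deg: "degree q < degree p" using q0 unfolding q by (subst degree_mult_eq) auto
    show ?thesis
    proof (cases "a < Re l")
      case True
      have "poly_at E q (cmat E *v y - l *s y) = 0"
        using less.prems(2) unfolding q by (subst (asm) mult.commute) (simp only: poly_at_mult poly_at_linear)
      from less.hyps[OF deg q0 this] show ?thesis using cflow_decay_step[OF _ True] by blast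
    next
      case False
      have "cmat E *v poly_at E q y - l *s poly_at E q y = 0"
        using less.prems(2) unfolding q by (simp only: poly_at_mult poly_at_linear)
      then have "poly_at E q y = 0" using spec[of l] False by (auto simp: cmat_eigen_iff)
      from less.hyps[OF deg q0 this] show ?thesis .
    qed
  qed
qed

lemma flow_decay:
  assumes spec: "\<And>l. l \<in> complex_spectrum E \<Longrightarrow> a < Re l"
  shows "\<exists>C>0. \<forall>t\<ge>0. \<forall>i j. \<bar>flow E (- t) $ i $ j\<bar> \<le> C * exp (- a * t)"
proof -
  obtain p where p: "p \<noteq> 0" "\<And>y. poly_at E p y = 0" using ex_annihilating_poly by blast
  have "\<exists>C. \<forall>t\<ge>0. \<forall>i. cmod ((cmat (flow E (- t)) *v axis j 1) $ i) \<le> C * exp (- a * t)" for j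
    using cflow_decay[OF spec p] by blast
  then obtain C where C: "\<And>j t i. 0 \<le> t \<Longrightarrow> cmod ((cmat (flow E (- t)) *v axis j 1) $ i) \<le> C j * exp (- a * t)"
    by metis
  have e: "cmod ((cmat (flow E (- t)) *v axis j 1) $ i) = \<bar>flow E (- t) $ i $ j\<bar>" for i j t
    by (simp add: cmat_def matrix_vector_mult_def axis_def if_distrib cong: if_cong)
  define K where "K = (\<Sum>j\<in>UNIV. \<bar>C j\<bar>) + 1"
  have "0 \<le> (\<Sum>j\<in>UNIV. \<bar>C j\<bar>)" by (intro sum_nonneg) auto
  then have "K > 0" unfolding K_def by linarith
  moreover have "\<bar>flow E (- t) $ i $ j\<bar> \<le> K * exp (- a * t)" if "0 \<le> t" for t i j
  proof -
    have "C j \<le> K" unfolding K_def using member_le_sum[of j UNIV "\<lambda>j. \<bar>C j\<bar>"] by fastforce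
    then have "C j * exp (- a * t) \<le> K * exp (- a * t)" by (rule mult_right_mono) simp
    then show ?thesis using C[OF that, of j i] unfolding e by linarith
  qed
  ultimately show ?thesis by blast
qed

section \<open>Volume under the flow\<close>

text \<open>A copy of a finite index type that is well-ordered by an enumeration. The transformation rule for volumes under
linear maps (\<open>measure_linear_image\<close>) concerns well-ordered index types; relabelling the coordinates, which
preserves volume, determinant and trace, carries it over to any finite index type.\<close>

datatype 'n ordered_index = Index (unindex: 'n)

lemma bij_unindex: "bij unindex"
  by (rule bijI[OF injI surjI[of unindex Index]]) (auto intro: ordered_index.expand)

instance ordered_index :: (finite) finite
proof
  have "bij (unindex :: 'a ordered_index \<Rightarrow> 'a)" by (rule bij_unindex)
  then show "finite (UNIV :: 'a ordered_index set)" using bij_betw_finite by fastforce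
qed

instantiation ordered_index :: (finite) wellorder
begin

definition less_eq_ordered_index :: "'a ordered_index \<Rightarrow> 'a ordered_index \<Rightarrow> bool" where
  "x \<le> y \<longleftrightarrow> to_nat (unindex x) \<le> to_nat (unindex y)"

definition less_ordered_index :: "'a ordered_index \<Rightarrow> 'a ordered_index \<Rightarrow> bool" where
  "x < y \<longleftrightarrow> to_nat (unindex x) < to_nat (unindex y)"

instance
proof
  fix P :: "'a ordered_index \<Rightarrow> bool" and a
  assume step: "\<And>x. (\<And>y. y < x \<Longrightarrow> P y) \<Longrightarrow> P x"
  show "P a"
    by (induction a rule: measure_induct_rule[of "\<lambda>x. to_nat (unindex x)"])
       (rule step, simp add: less_ordered_index_def)
qed (auto simp: less_eq_ordered_index_def less_ordered_index_def ordered_index.expand)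

end

definition reindex :: "real^'n \<Rightarrow> real^('n ordered_index)" where
  "reindex x = (\<chi> k. x $ unindex k)"

lemma inj_reindex: "inj reindex"
  by (rule injI) (auto simp: reindex_def vec_eq_iff, metis ordered_index.sel)

lemma linear_reindex: "linear reindex"
  by (rule linearI) (auto simp: reindex_def vec_eq_iff)

lemma prod_Basis_cart: "(\<Prod>b\<in>Basis. (x :: real^'n) \<bullet> b) = (\<Prod>i\<in>UNIV. x $ i)"
proof -
  have "(Basis :: (real^'n) set) = (\<lambda>i. axis i 1) ` UNIV" by (auto simp: Basis_vec_def)
  moreover have "inj (\<lambda>i :: 'n. axis i (1::real))" by (rule injI) (simp add: axis_eq_axis)
  ultimately show ?thesis 
    using prod.reindex[of "\<lambda>i :: 'n. axis i (1::real)" UNIV "\<lambda>b. x \<bullet> b"] by (simp add: inner_axis)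
qed

lemma prod_unindex: "(\<Prod>k\<in>UNIV. f (unindex k)) = (\<Prod>i\<in>UNIV. f (i :: 'n::finite))"
  using prod.reindex_bij_betw[OF bij_unindex] .

lemma sum_unindex: "(\<Sum>k\<in>UNIV. f (unindex k)) = (\<Sum>i\<in>UNIV. f (i :: 'n::finite))"
  using sum.reindex_bij_betw[OF bij_unindex] .

lemma reindex_measurable [measurable]: "reindex \<in> borel_measurable borel"
  using linear_continuous_on[OF linear_conv_bounded_linear[THEN iffD1, OF linear_reindex]]
  by (rule borel_measurable_continuous_onI)

lemma lborel_distr_reindex: "distr lborel borel reindex = (lborel :: (real^('n::finite ordered_index)) measure)"
proof (rule lborel_eqI[symmetric])
  fix l u :: "real^('n ordered_index)"
  assume le: "\<And>b. b \<in> Basis \<Longrightarrow> l \<bullet> b \<le> u \<bullet> b"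
  have le': "l $ k \<le> u $ k" for k
    using le[of "axis k 1"] by (auto simp: inner_axis Basis_vec_def)
  let ?l = "\<chi> i. l $ Index i" and ?u = "\<chi> i. u $ Index i"
  have "reindex -` box l u = box ?l ?u"
    by (auto simp: reindex_def mem_box_cart) (metis ordered_index.collapse ordered_index.sel)+
  then have "emeasure (distr lborel borel reindex) (box l u) = emeasure lborel (box ?l ?u)"
    by (simp add: emeasure_distr)
  also have "\<dots> = (\<Prod>b\<in>Basis. (?u - ?l) \<bullet> b)"
    by (rule emeasure_lborel_box) (auto simp: Basis_vec_def inner_axis le')
  also have "(\<Prod>b\<in>Basis. (?u - ?l) \<bullet> b) = (\<Prod>b\<in>Basis. (u - l) \<bullet> b)"
    unfolding prod_Basis_cart by (subst prod_unindex[symmetric]) simp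
  finally show "emeasure (distr lborel borel reindex) (box l u) = (\<Prod>b\<in>Basis. (u - l) \<bullet> b)" .
qed simp

definition reindex_matrix :: "real^'n^'n \<Rightarrow> real^('n ordered_index)^('n ordered_index)" where
  "reindex_matrix A = (\<chi> k l. A $ unindex k $ unindex l)"

lemma reindex_matrix_entry [simp]: "reindex_matrix A $ k $ l = A $ unindex k $ unindex l"
  by (simp add: reindex_matrix_def)

lemma mpow_reindex: "mpow (reindex_matrix A) j = reindex_matrix (mpow A j)"
proof (induction j)
  case 0
  show ?case by (auto simp: vec_eq_iff mat_def ordered_index.expand)
next
  case (Suc j)
  have "reindex_matrix A ** reindex_matrix B = reindex_matrix (A ** B)" for B
    by (simp add: vec_eq_iff matrix_mult_entry sum_unindex[of "\<lambda>i. A $ _ $ i * B $ i $ _"])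
  with Suc show ?case by simp
qed

lemma flow_reindex: "flow (reindex_matrix A) t = reindex_matrix (flow A t)"
  unfolding vec_eq_iff flow_entry mpow_reindex by (simp add: flow_entry)

lemma reindex_mult: "reindex (A *v x) = reindex_matrix A *v reindex x"
  by (simp add: vec_eq_iff reindex_def matrix_vector_mult_def sum_unindex[of "\<lambda>i. A $ _ $ i * x $ i"])

lemma trace_reindex: "trace (reindex_matrix A) = trace A"
  by (simp add: trace_def sum_unindex[of "\<lambda>i. A $ i $ i"])

lemma flow_image_vimage: "(\<lambda>x. flow A t *v x) ` S = (\<lambda>x. flow A (- t) *v x) -` S"
proof
  show "(\<lambda>x. flow A (- t) *v x) -` S \<subseteq> (\<lambda>x. flow A t *v x) ` S"
    by (metis flow_inverse_vec(1) image_eqI subsetI vimage_eq)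
qed auto

lemma matrix_vector_measurable [measurable]: "(\<lambda>x. (A :: real^'n^'m) *v x) \<in> borel_measurable borel"
  by (intro borel_measurable_continuous_onI linear_continuous_on matrix_vector_mul_bounded_linear)

text \<open>Liouville's formula: the dilations multiply volume by the exponential of the trace.\<close>

lemma measure_flow_image:
  fixes A :: "real^'n^'n"
  assumes S: "S \<in> sets borel" "bounded S"
  shows "measure lborel ((\<lambda>x. flow A t *v x) ` S) = exp (t * trace A) * measure lborel S"
proof -
  have img: "(\<lambda>x. flow A t *v x) ` S \<in> sets borel" if "S \<in> sets borel" for A :: "real^'m^'m" and S t
    unfolding flow_image_vimage using that measurable_sets[OF matrix_vector_measurable that] by simp
  have inv: "reindex ` S = (\<lambda>y. \<chi> i. y $ Index i) -` S" for S :: "(real^'n) set"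
  proof
    show "(\<lambda>y. \<chi> i. y $ Index i) -` S \<subseteq> reindex ` S"
    proof
      fix y assume "y \<in> (\<lambda>y. \<chi> i. y $ Index i) -` S"
      moreover have "y = reindex (\<chi> i. y $ Index i)" by (simp add: reindex_def vec_eq_iff)
      ultimately show "y \<in> reindex ` S" by blast
    qed
    show "reindex ` S \<subseteq> (\<lambda>y. \<chi> i. y $ Index i) -` S"
      by (auto simp: reindex_def)
  qed
  have rS: "reindex ` S \<in> sets borel" if "S \<in> sets borel" for S :: "(real^'n) set"
  proof -
    have "linear (\<lambda>y :: real^('n ordered_index). (\<chi> i. y $ Index i) :: real^'n)"
      by (rule linearI) (auto simp: vec_eq_iff)
    then have "(\<lambda>y :: real^('n ordered_index). (\<chi> i. y $ Index i) :: real^'n) \<in> borel_measurable borel"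
      by (intro borel_measurable_continuous_onI linear_continuous_on) (simp add: linear_conv_bounded_linear)
    from measurable_sets[OF this that] show ?thesis unfolding inv by simp
  qed
  have r: "measure lborel (reindex ` S) = measure lborel S" if "S \<in> sets borel" for S :: "(real^'n) set"
  proof -
    have "measure lborel (reindex ` S) = measure (distr lborel borel reindex) (reindex ` S)"
      unfolding lborel_distr_reindex ..
    also have "\<dots> = measure lborel (reindex -` (reindex ` S) \<inter> space lborel)"
      by (rule measure_distr) (use rS[OF that] in auto)
    also have "reindex -` (reindex ` S) \<inter> space lborel = S"
      using inj_vimage_image_eq[OF inj_reindex] by auto
    finally show ?thesis .
  qed
  have bd: "bounded (reindex ` S)"
    using S(2) linear_reindex by (intro bounded_linear_image) (simp_all add: linear_conv_bounded_linear)
  then have lm: "reindex ` S \<in> lmeasurable"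
    using rS[OF S(1)] by (intro bounded_set_imp_lmeasurable) auto
  have "reindex ` ((\<lambda>x. flow A t *v x) ` S) = (\<lambda>y. flow (reindex_matrix A) t *v y) ` (reindex ` S)"
    by (simp add: image_image reindex_mult flow_reindex)
  then have "measure lborel ((\<lambda>x. flow A t *v x) ` S) = measure lborel ((\<lambda>y. flow (reindex_matrix A) t *v y) ` (reindex ` S))"
    using r[OF img[OF S(1)], of A t] by simp
  also have "\<dots> = measure lebesgue ((\<lambda>y. flow (reindex_matrix A) t *v y) ` (reindex ` S))"
    using img[OF rS[OF S(1)], of "reindex_matrix A" t] by simp
  also have "\<dots> = \<bar>det (flow (reindex_matrix A) t)\<bar> * measure lebesgue (reindex ` S)"
    using measure_linear_image[OF matrix_vector_mul_linear lm] by (simp add: matrix_of_matrix_vector_mul)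
  also have "\<dots> = exp (t * trace A) * measure lborel S"
    using rS[OF S(1)] r[OF S(1)] by (simp add: det_flow trace_reindex)
  finally show ?thesis .
qed

section \<open>Gauges and spectral integrals\<close>

lemma gauge_flow:
  assumes "homogeneous_gauge A \<tau>"
  shows "\<tau> (flow A t *v x) = exp t * \<tau> x"
  using assms by (auto simp: homogeneous_gauge_def matrix_rpow_def flow_def dest: spec[of _ "exp t"])

lemma gauge_0:
  assumes "homogeneous_gauge A \<tau>"
  shows "\<tau> 0 = 0"
  using gauge_flow[OF assms, of 1 0] by simp

lemma gauge_pos: "homogeneous_gauge A \<tau> \<Longrightarrow> x \<noteq> 0 \<Longrightarrow> 0 < \<tau> x"
  and gauge_continuous: "homogeneous_gauge A \<tau> \<Longrightarrow> continuous_on S \<tau>"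
  unfolding homogeneous_gauge_def by (blast intro: continuous_on_subset)+

lemma gauge_measurable: "homogeneous_gauge A \<tau> \<Longrightarrow> \<tau> \<in> borel_measurable borel"
  by (intro borel_measurable_continuous_onI gauge_continuous)

text \<open>A long vector is contracted by the flow until it hits the unit sphere, where the gauge is bounded below
by compactness. Since the gauge has decreased by the factor \<open>exp (- t)\<close> on the way, the time \<open>t\<close> needed, and with it
the length of the vector, is controlled by the initial value of the gauge.\<close>

lemma gauge_sublevel_bounded:
  fixes A :: "real^'n^'n"
  assumes \<tau>: "homogeneous_gauge A \<tau>" and "0 < a"
    and contr: "\<And>t x. 0 \<le> t \<Longrightarrow> norm (flow A (- t) *v x) \<le> C * exp (- a * t) * norm x"
  shows "\<exists>R. \<forall>x. \<tau> x \<le> c \<longrightarrow> norm x \<le> R"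
proof -
  let ?S = "sphere (0 :: real^'n) 1"
  have "?S \<noteq> {}" by (simp)
  then obtain x0 where x0: "x0 \<in> ?S" "\<And>x. x \<in> ?S \<Longrightarrow> \<tau> x0 \<le> \<tau> x"
    using continuous_attains_inf[of ?S \<tau>] gauge_continuous[OF \<tau>] by auto
  define d where "d = \<tau> x0"
  have "x0 \<noteq> 0" using x0(1) by auto
  then have d: "0 < d" unfolding d_def by (rule gauge_pos[OF \<tau>])
  define b where "b = real CARD('n) * norm A"
  have b: "0 \<le> b" by (simp add: b_def)
  define R where "R = max 1 ((real CARD('n))\<^sup>2 * (\<bar>c\<bar> / d) powr b)"
  have "norm x \<le> R" if x: "\<tau> x \<le> c" for x
  proof (cases "norm x \<le> 1")
    case True
    then show ?thesis by (simp add: R_def)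
  next
    case False
    have "((\<lambda>t. C * exp (- a * t) * norm x) \<longlongrightarrow> 0) at_top"
      using \<open>0 < a\<close> by real_asymp
    then have "eventually (\<lambda>t. C * exp (- a * t) * norm x < 1) at_top"
      by (rule order_tendstoD) simp
    then obtain T where T: "0 \<le> T" "C * exp (- a * T) * norm x < 1"
      unfolding eventually_at_top_linorder by (metis linear)
    have "continuous_on {0..T} (\<lambda>t. flow A (- t) *v x)"
      by (rule continuous_on_compose2[OF continuous_on_flow_vec]) (auto intro!: continuous_intros)
    then have "continuous_on {0..T} (\<lambda>t. norm (flow A (- t) *v x))" by (rule continuous_on_norm)
    moreover have "norm (flow A (- T) *v x) \<le> 1" using contr[OF T(1), of x] T(2) by linarith
    ultimately obtain t where t: "0 \<le> t" "norm (flow A (- t) *v x) = 1"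
      using IVT2'[of "\<lambda>t. norm (flow A (- t) *v x)" T 1 0] False T(1) by auto
    have "d \<le> \<tau> (flow A (- t) *v x)" unfolding d_def using t by (intro x0(2)) auto
    also have "\<dots> \<le> exp (- t) * \<bar>c\<bar>" unfolding gauge_flow[OF \<tau>] using x by (intro mult_left_mono) auto
    finally have et: "exp t \<le> \<bar>c\<bar> / d" using d by (simp add: exp_minus field_simps)
    have "norm x = norm (flow A t *v (flow A (- t) *v x))" by simp
    also have "\<dots> \<le> (real CARD('n))\<^sup>2 * exp (b * t)"
      using flow_growth[of A t "flow A (- t) *v x"] t by (simp add: b_def)
    also have "exp (b * t) = exp t powr b" by (simp add: powr_def)
    also have "(real CARD('n))\<^sup>2 * exp t powr b \<le> (real CARD('n))\<^sup>2 * (\<bar>c\<bar> / d) powr b"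
      using et b by (intro mult_left_mono powr_mono2) auto
    finally show ?thesis by (simp add: R_def)
  qed
  then show ?thesis by blast
qed

text \<open>Shells play the role of dyadic annuli: the flow maps them onto each other.\<close>

definition shell :: "(real^'n \<Rightarrow> real) \<Rightarrow> int \<Rightarrow> (real^'n) set" where
  "shell \<tau> k = {x. exp (real_of_int k) \<le> \<tau> x \<and> \<tau> x < exp (real_of_int k + 1)}"

lemma shell_eq_flow_image:
  assumes "homogeneous_gauge A \<tau>"
  shows "shell \<tau> k = (\<lambda>x. flow A k *v x) ` shell \<tau> 0"
  unfolding flow_image_vimage shell_def vimage_def
  by (auto simp: gauge_flow[OF assms] exp_add exp_minus field_simps)

lemma shell_borel: "homogeneous_gauge A \<tau> \<Longrightarrow> shell \<tau> k \<in> sets borel"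
proof -
  assume "homogeneous_gauge A \<tau>"
  then have [measurable]: "\<tau> \<in> borel_measurable borel" by (rule gauge_measurable)
  show ?thesis unfolding shell_def by measurable
qed

lemma mem_shell_floor_ln:
  assumes "homogeneous_gauge A \<tau>" "x \<noteq> 0"
  shows "x \<in> shell \<tau> \<lfloor>ln (\<tau> x)\<rfloor>"
proof -
  have p: "0 < \<tau> x" by (rule gauge_pos[OF assms])
  have "exp (real_of_int \<lfloor>ln (\<tau> x)\<rfloor>) \<le> exp (ln (\<tau> x))" by simp
  moreover have "exp (ln (\<tau> x)) < exp (real_of_int \<lfloor>ln (\<tau> x)\<rfloor> + 1)" by (subst exp_less_cancel_iff) linarith
  ultimately show ?thesis using p by (simp add: shell_def)
qed

lemma emeasure_shell:
  assumes \<tau>: "homogeneous_gauge A \<tau>" and bd: "bounded (shell \<tau> 0)"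
  shows "emeasure lborel (shell \<tau> k) = ennreal (exp (k * trace A) * measure lborel (shell \<tau> 0))"
proof -
  have b: "bounded (shell \<tau> k)"
    unfolding shell_eq_flow_image[OF \<tau>, of k] by (intro bounded_linear_image bd matrix_vector_mul_bounded_linear)
  have "emeasure lborel (shell \<tau> k) \<noteq> \<infinity>"
    using emeasure_bounded_finite[OF b] by simp
  then have "emeasure lborel (shell \<tau> k) = ennreal (measure lborel (shell \<tau> k))"
    by (simp add: emeasure_eq_ennreal_measure top.not_eq_extremum)
  also have "measure lborel (shell \<tau> k) = exp (k * trace A) * measure lborel (shell \<tau> 0)"
    unfolding shell_eq_flow_image[OF \<tau>, of k]
    using measure_flow_image[OF shell_borel[OF \<tau>] bd] by simp
  finally show ?thesis .
qed

lemma powr_le_exp: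
  fixes k x p :: real
  assumes "exp k \<le> x" "x < exp (k + 1)"
  shows "x powr p \<le> exp \<bar>p\<bar> * exp (k * p)"
proof -
  have x: "0 < x" using assms(1) exp_gt_zero[of k] by linarith
  have l: "k \<le> ln x" "ln x \<le> k + 1"
    using assms x by (auto simp: ln_ge_iff intro!: less_imp_le ln_less_cancel_iff[THEN iffD2, of x "exp (k+1)", simplified])
  have "(ln x - k) * p \<le> 1 * \<bar>p\<bar>"
    using l by (intro order_trans[OF mult_left_mono[of p "\<bar>p\<bar>"] mult_right_mono]) auto
  then have "ln x * p \<le> \<bar>p\<bar> + k * p" by (simp add: algebra_simps)
  then show ?thesis using x by (simp add: powr_def exp_add[symmetric] mult.commute)
qed

abbreviation cutoff :: "real^'n^'n \<Rightarrow> real \<Rightarrow> nat \<Rightarrow> real^'n \<Rightarrow> real" where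
  "cutoff A \<rho> n x \<equiv> min 2 (\<rho> * norm (flow A (- real n) *v x))"

text \<open>Shell \<open>k\<close> has volume of order \<open>exp (k * trace A)\<close>, which cancels the trace in the exponent of the gauge and
leaves \<open>exp (- k * \<alpha> * \<beta>)\<close>. For \<open>k \<ge> n\<close> this decays since \<open>\<beta> > 0\<close>; for \<open>k < n\<close> the minimum contributes
\<open>exp (- (n - k) * \<alpha> * a)\<close>, which wins because \<open>\<beta> < a\<close>.\<close>

lemma shell_integral_bound:
  fixes A :: "real^'n^'n"
  assumes \<tau>: "homogeneous_gauge A \<tau>" and "0 < \<alpha>" and "0 < \<beta>" and "\<beta> < a" and "0 < C" and "0 < \<rho>"
    and contr: "\<And>t x. 0 \<le> t \<Longrightarrow> norm (flow A (- t) *v x) \<le> C * exp (- a * t) * norm x"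
  shows "\<exists>K>0. \<forall>n k. (\<integral>\<^sup>+x. ennreal (cutoff A \<rho> n x powr \<alpha> * \<tau> x powr (- (\<alpha> * \<beta>) - trace A)) * indicator (shell \<tau> k) x \<partial>lborel)
     \<le> ennreal (K * exp (- (real n * \<alpha> * \<beta>)) * exp (- (\<alpha> * min \<beta> (a - \<beta>)) * \<bar>of_int k - real n\<bar>))"
proof -
  have a0: "0 < a" using assms by linarith
  obtain R where R: "\<And>x. \<tau> x \<le> exp 1 \<Longrightarrow> norm x \<le> R"
    using gauge_sublevel_bounded[OF \<tau> a0 contr] by blast
  have R0: "0 \<le> R" using R[of 0] gauge_0[OF \<tau>] by simp
  have bd: "bounded (shell \<tau> 0)"
    by (rule boundedI[of _ R]) (auto simp: shell_def intro!: R)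
  define p where "p = \<alpha> * \<beta> + trace A"
  define V where "V = measure lborel (shell \<tau> 0)"
  have V0: "0 \<le> V" by (simp add: V_def)
  define L where "L = max 2 (\<rho> * C * R)"
  have L: "2 \<le> L" "\<rho> * C * R \<le> L" by (auto simp: L_def)
  define K where "K = L powr \<alpha> * exp \<bar>p\<bar> * V + 1"
  have "0 \<le> L powr \<alpha> * exp \<bar>p\<bar> * V" using V0 by simp
  then have K: "0 < K" unfolding K_def by linarith
  have "(\<integral>\<^sup>+x. ennreal (cutoff A \<rho> n x powr \<alpha> * \<tau> x powr (- (\<alpha> * \<beta>) - trace A)) * indicator (shell \<tau> k) x \<partial>lborel)
     \<le> ennreal (K * exp (- (real n * \<alpha> * \<beta>)) * exp (- (\<alpha> * min \<beta> (a - \<beta>)) * \<bar>of_int k - real n\<bar>))" for n k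
  proof -
    define m where "m = max 0 (real n - real_of_int k)"
    have m: "0 \<le> m" by (simp add: m_def)
    define B where "B = (L * exp (- a * m)) powr \<alpha> * (exp \<bar>p\<bar> * exp (k * (- p)))"
    have pt: "cutoff A \<rho> n x powr \<alpha> * \<tau> x powr (- (\<alpha> * \<beta>) - trace A) \<le> B"
      if x: "x \<in> shell \<tau> k" for x
    proof -
      have "cutoff A \<rho> n x \<le> L * exp (- a * m)"
      proof (cases "real_of_int k \<le> real n")
        case False
        then have "m = 0" by (simp add: m_def)
        then show ?thesis using L(1) by simp
      next
        case True
        then have mk: "m = real n - real_of_int k" by (simp add: m_def)
        obtain y where y: "y \<in> shell \<tau> 0" "x = flow A k *v y"
          using x shell_eq_flow_image[OF \<tau>, of k] by auto
        have "norm y \<le> R" using y(1) by (intro R) (auto simp: shell_def)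
        have "flow A (- real n) *v x = flow A (- m) *v y"
          unfolding y(2) flow_add_vec[symmetric] by (simp add: mk)
        then have "norm (flow A (- real n) *v x) \<le> C * exp (- a * m) * norm y"
          using contr[OF m, of y] by simp
        also have "\<dots> \<le> C * exp (- a * m) * R"
          using \<open>norm y \<le> R\<close> \<open>0 < C\<close> by (intro mult_left_mono) auto
        finally have "\<rho> * norm (flow A (- real n) *v x) \<le> \<rho> * (C * exp (- a * m) * R)"
          using \<open>0 < \<rho>\<close> by (intro mult_left_mono) auto
        also have "\<dots> = (\<rho> * C * R) * exp (- a * m)" by (simp only: mult_ac)
        also have "\<dots> \<le> L * exp (- a * m)" by (intro mult_right_mono L(2)) simp
        finally show ?thesis by linarith
      qed
      then have 1: "cutoff A \<rho> n x powr \<alpha> \<le> (L * exp (- a * m)) powr \<alpha>"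
        using \<open>0 < \<alpha>\<close> \<open>0 < \<rho>\<close> by (intro powr_mono2) auto
      have e: "- (\<alpha> * \<beta>) - trace A = - p" by (simp add: p_def)
      have 2: "\<tau> x powr (- (\<alpha> * \<beta>) - trace A) \<le> exp \<bar>p\<bar> * exp (k * (- p))"
        using powr_le_exp[of k "\<tau> x" "- p"] x
        unfolding e by (simp add: shell_def)
      show ?thesis unfolding B_def by (intro mult_mono 1 2) auto
    qed
    have "(\<integral>\<^sup>+x. ennreal (cutoff A \<rho> n x powr \<alpha> * \<tau> x powr (- (\<alpha> * \<beta>) - trace A)) * indicator (shell \<tau> k) x \<partial>lborel)
       \<le> (\<integral>\<^sup>+x. ennreal B * indicator (shell \<tau> k) x \<partial>lborel)"
      by (intro nn_integral_mono) (auto simp: indicator_def intro!: ennreal_leI pt)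
    also have "\<dots> = ennreal B * ennreal (exp (k * trace A) * V)"
      using shell_borel[OF \<tau>, of k] emeasure_shell[OF \<tau> bd, of k]
      by (subst nn_integral_cmult_indicator) (auto simp: V_def)
    also have "\<dots> = ennreal (B * (exp (k * trace A) * V))"
      using V0 by (subst ennreal_mult) (auto simp: B_def)
    also have "B * (exp (k * trace A) * V) = L powr \<alpha> * exp \<bar>p\<bar> * V * (exp (- a * m * \<alpha>) * exp (- k * (\<alpha> * \<beta>)))"
    proof -
      have "(L * exp (- a * m)) powr \<alpha> = L powr \<alpha> * exp (- a * m * \<alpha>)"
        using L by (simp add: powr_mult) (simp add: powr_def mult.commute)
      moreover have "exp (k * (- p)) * exp (k * trace A) = exp (- k * (\<alpha> * \<beta>))"
        by (simp add: p_def exp_add[symmetric] algebra_simps)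
      ultimately show ?thesis unfolding B_def by (simp add: mult_ac)
    qed
    also have "\<dots> \<le> K * (exp (- (real n * \<alpha> * \<beta>)) * exp (- (\<alpha> * min \<beta> (a - \<beta>)) * \<bar>of_int k - real n\<bar>))"
    proof (rule mult_mono)
      have "- a * m * \<alpha> + - k * (\<alpha> * \<beta>) \<le> - (real n * \<alpha> * \<beta>) + - (\<alpha> * min \<beta> (a - \<beta>)) * \<bar>of_int k - real n\<bar>"
      proof (cases "real_of_int k \<le> real n")
        case False
        then have "\<alpha> * (min \<beta> (a - \<beta>) * (of_int k - real n)) \<le> \<alpha> * (\<beta> * (of_int k - real n))"
          using \<open>0 < \<alpha>\<close> by (intro mult_left_mono mult_right_mono) auto
        with False show ?thesis by (simp add: m_def algebra_simps)
      next
        case True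
        then have "\<alpha> * (min \<beta> (a - \<beta>) * (real n - of_int k)) \<le> \<alpha> * ((a - \<beta>) * (real n - of_int k))"
          using \<open>0 < \<alpha>\<close> by (intro mult_left_mono mult_right_mono) auto
        with True show ?thesis by (simp add: m_def algebra_simps)
      qed
      then show "exp (- a * m * \<alpha>) * exp (- k * (\<alpha> * \<beta>)) \<le> exp (- (real n * \<alpha> * \<beta>)) * exp (- (\<alpha> * min \<beta> (a - \<beta>)) * \<bar>of_int k - real n\<bar>)"
        unfolding exp_add[symmetric] by (simp only: exp_le_cancel_iff)
    qed (use K V0 in \<open>auto simp: K_def\<close>)
    finally show ?thesis by (simp add: ennreal_leI mult.assoc)
  qed
  with K show ?thesis by blast
qed

lemma ennreal_geometric_suminf_le:
  assumes "0 \<le> c" "0 < \<kappa>" and le: "\<And>j. f j \<le> ennreal (c * exp (- \<kappa> * real j))"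
  shows "(\<Sum>j. f j) \<le> ennreal (c / (1 - exp (- \<kappa>)))"
proof -
  have "(\<lambda>j. c * exp (- \<kappa>) ^ j) sums (c * (1 / (1 - exp (- \<kappa>))))"
    using assms by (intro sums_mult geometric_sums) simp
  moreover have "exp (- \<kappa>) ^ j = exp (- \<kappa> * real j)" for j
    by (simp add: exp_of_nat_mult[symmetric] mult.commute)
  ultimately have "(\<Sum>j. ennreal (c * exp (- \<kappa> * real j))) = ennreal (c / (1 - exp (- \<kappa>)))"
    using \<open>0 \<le> c\<close> by (intro suminf_ennreal_eq) auto
  moreover have "(\<Sum>j. f j) \<le> (\<Sum>j. ennreal (c * exp (- \<kappa> * real j)))"
    by (intro suminf_le le) auto
  ultimately show ?thesis by simp
qed

text \<open>Summation over the shells on both sides of the critical shell \<open>n\<close>, with geometric decay on either side.\<close>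

lemma gauge_integral_bound:
  fixes A :: "real^'n^'n"
  assumes \<tau>: "homogeneous_gauge A \<tau>" and "0 < \<alpha>" and "0 < \<beta>" and "\<beta> < a" and "0 < C" and "0 < \<rho>"
    and contr: "\<And>t x. 0 \<le> t \<Longrightarrow> norm (flow A (- t) *v x) \<le> C * exp (- a * t) * norm x"
  shows "\<exists>K>0. \<forall>n. (\<integral>\<^sup>+x. ennreal (cutoff A \<rho> n x powr \<alpha> * \<tau> x powr (- (\<alpha> * \<beta>) - trace A)) \<partial>lborel)
     \<le> ennreal (K * exp (- (real n * \<alpha> * \<beta>)))"
proof -
  obtain K where K: "0 < K" and bound: "\<And>n k. (\<integral>\<^sup>+x. ennreal (cutoff A \<rho> n x powr \<alpha> * \<tau> x powr (- (\<alpha> * \<beta>) - trace A)) * indicator (shell \<tau> k) x \<partial>lborel)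
     \<le> ennreal (K * exp (- (real n * \<alpha> * \<beta>)) * exp (- (\<alpha> * min \<beta> (a - \<beta>)) * \<bar>of_int k - real n\<bar>))"
    using shell_integral_bound[OF assms] by blast
  have [measurable]: "\<tau> \<in> borel_measurable borel" by (rule gauge_measurable[OF \<tau>])
  have [measurable]: "shell \<tau> k \<in> sets borel" for k by (rule shell_borel[OF \<tau>])
  define \<kappa> where "\<kappa> = \<alpha> * min \<beta> (a - \<beta>)"
  have \<kappa>: "0 < \<kappa>" using assms by (simp add: \<kappa>_def)
  define K' where "K' = 2 * K / (1 - exp (- \<kappa>))"
  have "0 < K'" using K \<kappa> by (simp add: K'_def)
  moreover have "(\<integral>\<^sup>+x. ennreal (cutoff A \<rho> n x powr \<alpha> * \<tau> x powr (- (\<alpha> * \<beta>) - trace A)) \<partial>lborel)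
     \<le> ennreal (K' * exp (- (real n * \<alpha> * \<beta>)))" for n
  proof -
    define h where "h x = ennreal (cutoff A \<rho> n x powr \<alpha> * \<tau> x powr (- (\<alpha> * \<beta>) - trace A))" for x
    have [measurable]: "h \<in> borel_measurable borel" unfolding h_def by measurable
    define s1 where "s1 j = shell \<tau> (int n + int j)" for j
    define s2 where "s2 j = shell \<tau> (int n - 1 - int j)" for j
    have [measurable]: "s1 j \<in> sets borel" "s2 j \<in> sets borel" for j by (simp_all add: s1_def s2_def)
    have "h x \<le> (\<Sum>j. h x * indicator (s1 j) x) + (\<Sum>j. h x * indicator (s2 j) x)" for x
    proof (cases "x = 0")
      case True
      then show ?thesis using \<open>0 < \<alpha>\<close> by (simp add: h_def)
    next
      case False
      have term_le: "f j \<le> (\<Sum>j. f j)" for f :: "nat \<Rightarrow> ennreal" and j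
        using sum_le_suminf[of f "{j}"] by simp
      let ?k = "\<lfloor>ln (\<tau> x)\<rfloor>"
      have mem: "x \<in> shell \<tau> ?k" by (rule mem_shell_floor_ln[OF \<tau> False])
      show ?thesis
      proof (cases "int n \<le> ?k")
        case True
        then have "x \<in> s1 (nat (?k - int n))" using mem by (simp add: s1_def)
        then have "h x \<le> (\<Sum>j. h x * indicator (s1 j) x)"
          using term_le[of "\<lambda>j. h x * indicator (s1 j) x" "nat (?k - int n)"] by simp
        then show ?thesis by (simp add: add_increasing2)
      next
        case False
        then have "x \<in> s2 (nat (int n - 1 - ?k))" using mem by (simp add: s2_def)
        then have "h x \<le> (\<Sum>j. h x * indicator (s2 j) x)"
          using term_le[of "\<lambda>j. h x * indicator (s2 j) x" "nat (int n - 1 - ?k)"] by simp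
        then show ?thesis by (simp add: add_increasing)
      qed
    qed
    then have "(\<integral>\<^sup>+x. h x \<partial>lborel) \<le> (\<integral>\<^sup>+x. (\<Sum>j. h x * indicator (s1 j) x) + (\<Sum>j. h x * indicator (s2 j) x) \<partial>lborel)"
      by (rule nn_integral_mono)
    also have "\<dots> = (\<Sum>j. \<integral>\<^sup>+x. h x * indicator (s1 j) x \<partial>lborel) + (\<Sum>j. \<integral>\<^sup>+x. h x * indicator (s2 j) x \<partial>lborel)"
      by (subst nn_integral_add, measurable, subst (1 2) nn_integral_suminf) auto
    also have "\<dots> \<le> ennreal (K * exp (- (real n * \<alpha> * \<beta>)) / (1 - exp (- \<kappa>))) + ennreal (K * exp (- (real n * \<alpha> * \<beta>)) / (1 - exp (- \<kappa>)))"
    proof (intro add_mono ennreal_geometric_suminf_le)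
      show "(\<integral>\<^sup>+x. h x * indicator (s1 j) x \<partial>lborel) \<le> ennreal (K * exp (- (real n * \<alpha> * \<beta>)) * exp (- \<kappa> * real j))" for j
        using bound[of n "int n + int j"] by (simp add: h_def s1_def \<kappa>_def)
      fix j
      have "(\<integral>\<^sup>+x. h x * indicator (s2 j) x \<partial>lborel) \<le> ennreal (K * exp (- (real n * \<alpha> * \<beta>)) * exp (- \<kappa> * (real j + 1)))"
        using bound[of n "int n - 1 - int j"] by (simp add: h_def s2_def \<kappa>_def)
      also have "\<dots> \<le> ennreal (K * exp (- (real n * \<alpha> * \<beta>)) * exp (- \<kappa> * real j))"
        using K \<kappa> by (intro ennreal_leI mult_left_mono) auto
      finally show "(\<integral>\<^sup>+x. h x * indicator (s2 j) x \<partial>lborel) \<le> ennreal (K * exp (- (real n * \<alpha> * \<beta>)) * exp (- \<kappa> * real j))" .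
    qed (use K \<kappa> in auto)
    also have "\<dots> = ennreal (K' * exp (- (real n * \<alpha> * \<beta>)))"
      using K \<kappa> by (subst ennreal_plus[symmetric]) (auto simp: K'_def)
    finally show ?thesis by (simp add: h_def)
  qed
  ultimately show ?thesis by blast
qed

text \<open>The integrand is an envelope for all kernel increments \<open>(iexp (p \<bullet> \<xi>) - iexp (p' \<bullet> \<xi>)) * \<psi> \<xi>\<close> with
\<open>p - p'\<close> of anisotropic size \<open>exp (- n)\<close>, so one bound serves all neighbours in a grid. High frequencies are covered by the decay of \<open>\<psi>\<close>, low ones by the contraction of the flow, whose rate \<open>a\<close>
exceeds \<open>\<beta>\<close>.\<close>

lemma increment_mass_bound:
  fixes A :: "real^'n^'n" and \<psi> :: "real^'n \<Rightarrow> complex"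
  assumes \<tau>: "homogeneous_gauge A \<tau>" and "0 < \<alpha>" and "0 < \<beta>" and "\<beta> < a" and "0 < C" and "0 < \<rho>"
    and contr: "\<And>t x. 0 \<le> t \<Longrightarrow> norm (flow A (- t) *v x) \<le> C * exp (- a * t) * norm x"
    and psi[measurable]: "\<psi> \<in> borel_measurable borel"
    and low: "integrable lborel (\<lambda>\<xi>. min 1 (norm \<xi> powr \<alpha>) * cmod (\<psi> \<xi>) powr \<alpha>)"
    and "0 < c" "0 < r"
    and high: "AE \<xi> in lborel. norm \<xi> > r \<longrightarrow> cmod (\<psi> \<xi>) \<le> c * \<tau> \<xi> powr (- \<beta> - trace A / \<alpha>)"
  shows "\<exists>K>0. \<forall>n.
     (\<lambda>\<xi>. complex_of_real (cutoff A \<rho> n \<xi> * cmod (\<psi> \<xi>))) \<in> L_alpha lborel \<alpha> \<and>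
     (LINT \<xi>|lborel. (cutoff A \<rho> n \<xi> * cmod (\<psi> \<xi>)) powr \<alpha>) \<le> K * exp (- (real n * \<alpha> * \<beta>))"
proof -
  obtain K where K: "0 < K" and bound: "\<And>n. (\<integral>\<^sup>+x. ennreal (cutoff A \<rho> n x powr \<alpha> * \<tau> x powr (- (\<alpha> * \<beta>) - trace A)) \<partial>lborel)
     \<le> ennreal (K * exp (- (real n * \<alpha> * \<beta>)))"
    using gauge_integral_bound[OF assms(1-7)] by blast
  have [measurable]: "\<tau> \<in> borel_measurable borel" by (rule gauge_measurable[OF \<tau>])
  define w where "w \<xi> = min 1 (norm \<xi> powr \<alpha>) * cmod (\<psi> \<xi>) powr \<alpha>" for \<xi>
  have [measurable]: "w \<in> borel_measurable borel" unfolding w_def by measurable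
  have w0: "0 \<le> w \<xi>" for \<xi> by (simp add: w_def)
  define W where "W = (LINT \<xi>|lborel. w \<xi>)"
  have W0: "0 \<le> W" unfolding W_def using w0 by (intro Bochner_Integration.integral_nonneg) auto
  have W: "(\<integral>\<^sup>+\<xi>. ennreal (w \<xi>) \<partial>lborel) = ennreal W"
    unfolding W_def using low w0 by (intro nn_integral_eq_integral) (auto simp: w_def)
  define D where "D = (\<rho> * C) powr \<alpha> * max 1 (r powr \<alpha>)"
  have D0: "0 \<le> D" by (simp add: D_def)
  define K' where "K' = c powr \<alpha> * K + D * W"
  have K': "0 < K'" using K D0 W0 \<open>0 < c\<close> by (auto simp: K'_def intro!: add_pos_nonneg)
  have "(\<lambda>\<xi>. complex_of_real (cutoff A \<rho> n \<xi> * cmod (\<psi> \<xi>))) \<in> L_alpha lborel \<alpha> \<and>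
     (LINT \<xi>|lborel. (cutoff A \<rho> n \<xi> * cmod (\<psi> \<xi>)) powr \<alpha>) \<le> K' * exp (- (real n * \<alpha> * \<beta>))" for n
  proof -
    let ?e = "exp (- (real n * \<alpha> * \<beta>))"
    define G where "G \<xi> = cutoff A \<rho> n \<xi> * cmod (\<psi> \<xi>)" for \<xi>
    have [measurable]: "G \<in> borel_measurable borel" unfolding G_def by measurable
    have G0: "0 \<le> G \<xi>" for \<xi> using \<open>0 < \<rho>\<close> by (simp add: G_def)
    define h where "h x = cutoff A \<rho> n x powr \<alpha> * \<tau> x powr (- (\<alpha> * \<beta>) - trace A)" for x
    have [measurable]: "h \<in> borel_measurable borel" unfolding h_def by measurable
    have h0: "0 \<le> h \<xi>" for \<xi> by (simp add: h_def)
    have Gp: "G \<xi> powr \<alpha> = cutoff A \<rho> n \<xi> powr \<alpha> * cmod (\<psi> \<xi>) powr \<alpha>" for \<xi>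
      using \<open>0 < \<rho>\<close> by (simp add: G_def powr_mult)
    have lowb: "G \<xi> powr \<alpha> \<le> D * ?e * w \<xi>" if r: "norm \<xi> \<le> r" for \<xi>
    proof -
      have "cutoff A \<rho> n \<xi> \<le> \<rho> * (C * exp (- a * n) * norm \<xi>)"
        using contr[of "real n" \<xi>] \<open>0 < \<rho>\<close> by (intro min.coboundedI2 mult_left_mono) auto
      then have "cutoff A \<rho> n \<xi> powr \<alpha> \<le> (\<rho> * (C * exp (- a * n) * norm \<xi>)) powr \<alpha>"
        using \<open>0 < \<rho>\<close> \<open>0 < \<alpha>\<close> by (intro powr_mono2) auto
      also have "\<rho> * (C * exp (- a * n) * norm \<xi>) = (\<rho> * C) * exp (- a * n) * norm \<xi>" by simp
      also have "\<dots> powr \<alpha> = (\<rho> * C) powr \<alpha> * exp (- a * n * \<alpha>) * norm \<xi> powr \<alpha>"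
        using \<open>0 < \<rho>\<close> \<open>0 < C\<close> by (simp add: powr_mult) (simp add: powr_def mult_ac)
      also have "\<dots> \<le> (\<rho> * C) powr \<alpha> * ?e * (max 1 (r powr \<alpha>) * min 1 (norm \<xi> powr \<alpha>))"
      proof (intro mult_mono order_refl)
        have "real n * \<beta> * \<alpha> \<le> real n * a * \<alpha>"
          using assms by (intro mult_right_mono mult_left_mono) auto
        then show "exp (- a * n * \<alpha>) \<le> ?e" by (simp add: mult_ac)
        show "norm \<xi> powr \<alpha> \<le> max 1 (r powr \<alpha>) * min 1 (norm \<xi> powr \<alpha>)"
        proof (cases "norm \<xi> powr \<alpha> \<le> 1")
          case True
          then show ?thesis using mult_right_mono[of 1 "max 1 (r powr \<alpha>)" "norm \<xi> powr \<alpha>"] by simp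
        next
          case False
          have "norm \<xi> powr \<alpha> \<le> r powr \<alpha>" using r \<open>0 < \<alpha>\<close> by (intro powr_mono2) auto
          then show ?thesis using False by simp
        qed
      qed auto
      finally have "cutoff A \<rho> n \<xi> powr \<alpha> * cmod (\<psi> \<xi>) powr \<alpha> \<le>
          (\<rho> * C) powr \<alpha> * ?e * (max 1 (r powr \<alpha>) * min 1 (norm \<xi> powr \<alpha>)) * cmod (\<psi> \<xi>) powr \<alpha>"
        by (rule mult_right_mono) simp
      then show ?thesis unfolding Gp by (simp add: D_def w_def mult_ac)
    qed
    have highb: "G \<xi> powr \<alpha> \<le> c powr \<alpha> * h \<xi>" if "cmod (\<psi> \<xi>) \<le> c * \<tau> \<xi> powr (- \<beta> - trace A / \<alpha>)" for \<xi>
    proof -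
      have "cmod (\<psi> \<xi>) powr \<alpha> \<le> (c * \<tau> \<xi> powr (- \<beta> - trace A / \<alpha>)) powr \<alpha>"
        using that \<open>0 < \<alpha>\<close> by (intro powr_mono2) auto
      also have "\<dots> = c powr \<alpha> * \<tau> \<xi> powr (- (\<alpha> * \<beta>) - trace A)"
        using \<open>0 < c\<close> \<open>0 < \<alpha>\<close> by (simp add: powr_mult powr_powr right_diff_distrib mult.commute)
      finally have "cutoff A \<rho> n \<xi> powr \<alpha> * cmod (\<psi> \<xi>) powr \<alpha> \<le>
        cutoff A \<rho> n \<xi> powr \<alpha> * (c powr \<alpha> * \<tau> \<xi> powr (- (\<alpha> * \<beta>) - trace A))"
        by (rule mult_left_mono) simp
      then show ?thesis unfolding Gp h_def by (simp add: mult_ac)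
    qed
    have "AE \<xi> in lborel. ennreal (G \<xi> powr \<alpha>) \<le> ennreal (c powr \<alpha>) * ennreal (h \<xi>) + ennreal (D * ?e) * ennreal (w \<xi>)"
      using high
    proof eventually_elim
      case (elim \<xi>)
      have "G \<xi> powr \<alpha> \<le> c powr \<alpha> * h \<xi> + D * ?e * w \<xi>"
      proof (cases "norm \<xi> \<le> r")
        case True
        have "0 \<le> c powr \<alpha> * h \<xi>" using h0 by simp
        with lowb[OF True] show ?thesis by linarith
      next
        case False
        have "0 \<le> D * ?e * w \<xi>" using w0 D0 by simp
        with highb[of \<xi>] elim False show ?thesis by simp
      qed
      then have "ennreal (G \<xi> powr \<alpha>) \<le> ennreal (c powr \<alpha> * h \<xi> + D * ?e * w \<xi>)" by (rule ennreal_leI)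
      also have "\<dots> = ennreal (c powr \<alpha>) * ennreal (h \<xi>) + ennreal (D * ?e) * ennreal (w \<xi>)"
        using h0 w0 D0 by (subst ennreal_plus) (auto simp: ennreal_mult)
      finally show ?case .
    qed
    then have "(\<integral>\<^sup>+\<xi>. ennreal (G \<xi> powr \<alpha>) \<partial>lborel) \<le> (\<integral>\<^sup>+\<xi>. ennreal (c powr \<alpha>) * ennreal (h \<xi>) + ennreal (D * ?e) * ennreal (w \<xi>) \<partial>lborel)"
      by (rule nn_integral_mono_AE)
    also have "\<dots> = ennreal (c powr \<alpha>) * (\<integral>\<^sup>+\<xi>. ennreal (h \<xi>) \<partial>lborel) + ennreal (D * ?e) * (\<integral>\<^sup>+\<xi>. ennreal (w \<xi>) \<partial>lborel)"
      by (subst nn_integral_add) (simp_all add: nn_integral_cmult)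
    also have "\<dots> \<le> ennreal (c powr \<alpha>) * ennreal (K * ?e) + ennreal (D * ?e) * ennreal W"
      unfolding W h_def by (intro add_mono mult_left_mono bound) auto
    also have "\<dots> = ennreal (K' * ?e)"
      using K D0 W0 by (simp add: ennreal_mult[symmetric] ennreal_plus[symmetric] K'_def algebra_simps del: ennreal_plus)
    finally have le: "(\<integral>\<^sup>+\<xi>. ennreal (G \<xi> powr \<alpha>) \<partial>lborel) \<le> ennreal (K' * ?e)" .
    have int: "integrable lborel (\<lambda>\<xi>. G \<xi> powr \<alpha>)"
      by (rule integrableI_nonneg) (use le in \<open>auto simp: less_top[symmetric] top_unique intro: le_less_trans\<close>)
    have "(LINT \<xi>|lborel. G \<xi> powr \<alpha>) = enn2real (\<integral>\<^sup>+\<xi>. ennreal (G \<xi> powr \<alpha>) \<partial>lborel)"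
      by (rule integral_eq_nn_integral) auto
    also have "\<dots> \<le> K' * ?e" using le K' by (intro enn2real_leI) auto
    finally have "(LINT \<xi>|lborel. G \<xi> powr \<alpha>) \<le> K' * ?e" .
    moreover have "(\<lambda>\<xi>. complex_of_real (G \<xi>)) \<in> L_alpha lborel \<alpha>"
      using int G0 by (simp add: L_alpha_def)
    ultimately show ?thesis by (simp add: G_def)
  qed
  with K' show ?thesis by blast
qed

lemma harmonizable_kernel_in_L_alpha:
  fixes \<psi> :: "real^'n \<Rightarrow> complex"
  assumes "0 < \<alpha>" and psi[measurable]: "\<psi> \<in> borel_measurable borel"
    and low: "integrable lborel (\<lambda>\<xi>. min 1 (norm \<xi> powr \<alpha>) * cmod (\<psi> \<xi>) powr \<alpha>)"
  shows "(\<lambda>\<xi>. (iexp (u \<bullet> \<xi>) - 1) * \<psi> \<xi>) \<in> L_alpha lborel \<alpha>"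
proof -
  let ?L = "max 2 (norm u)"
  have pt: "cmod ((iexp (u \<bullet> \<xi>) - 1) * \<psi> \<xi>) powr \<alpha> \<le> ?L powr \<alpha> * (min 1 (norm \<xi> powr \<alpha>) * cmod (\<psi> \<xi>) powr \<alpha>)" for \<xi>
  proof -
    have 1: "cmod (iexp (u \<bullet> \<xi>) - 1) \<le> 2"
      using norm_triangle_ineq4[of "iexp (u \<bullet> \<xi>)" 1] by simp
    have "cmod (iexp (u \<bullet> \<xi>) - 1) \<le> \<bar>u \<bullet> \<xi>\<bar>"
      using iexp_approx1[of "u \<bullet> \<xi>" 0] by simp
    also have "\<dots> \<le> norm u * norm \<xi>" by (rule Cauchy_Schwarz_ineq2)
    finally have 2: "cmod (iexp (u \<bullet> \<xi>) - 1) \<le> norm u * norm \<xi>" .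
    have "cmod (iexp (u \<bullet> \<xi>) - 1) \<le> ?L * min 1 (norm \<xi>)"
    proof (cases "norm \<xi> \<le> 1")
      case True
      have "norm u * norm \<xi> \<le> ?L * norm \<xi>" by (intro mult_right_mono) auto
      with 2 True show ?thesis by simp
    qed (use 1 in auto)
    then have "cmod (iexp (u \<bullet> \<xi>) - 1) powr \<alpha> \<le> (?L * min 1 (norm \<xi>)) powr \<alpha>"
      using \<open>0 < \<alpha>\<close> by (intro powr_mono2) auto
    also have "\<dots> = ?L powr \<alpha> * min 1 (norm \<xi>) powr \<alpha>" by (simp add: powr_mult)
    also have "min 1 (norm \<xi>) powr \<alpha> = min 1 (norm \<xi> powr \<alpha>)"
    proof (cases "norm \<xi> \<le> 1")
      case True
      then show ?thesis using \<open>0 < \<alpha>\<close> powr_le1[of \<alpha> "norm \<xi>"] by simp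
    next
      case False
      then have "1 \<le> norm \<xi> powr \<alpha>" using \<open>0 < \<alpha>\<close> by (intro ge_one_powr_ge_zero) auto
      with False show ?thesis by simp
    qed
    finally have "cmod (iexp (u \<bullet> \<xi>) - 1) powr \<alpha> * cmod (\<psi> \<xi>) powr \<alpha> \<le> ?L powr \<alpha> * min 1 (norm \<xi> powr \<alpha>) * cmod (\<psi> \<xi>) powr \<alpha>"
      by (rule mult_right_mono) simp
    then show ?thesis by (simp add: norm_mult powr_mult mult.assoc)
  qed
  have "integrable lborel (\<lambda>\<xi>. cmod ((iexp (u \<bullet> \<xi>) - 1) * \<psi> \<xi>) powr \<alpha>)"
    by (rule Bochner_Integration.integrable_bound[OF integrable_mult_right[OF low, of "?L powr \<alpha>"]])
       (use pt in auto)
  then show ?thesis by (simp add: L_alpha_def)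
qed

section \<open>Anisotropic grids and chaining\<close>

lemma summable_exp_powr:
  fixes \<beta> P :: real
  assumes "0 < \<beta>"
  shows "summable (\<lambda>j. exp (- (\<beta> * real j)) * (1 + real j) powr P)"
proof (rule summable_comparison_test_bigo)
  show "summable (\<lambda>j. norm (exp (- (\<beta> / 2)) ^ j))"
    using assms by (auto intro!: summable_geometric)
  have "(\<lambda>j. exp (- (\<beta> * real j)) * (1 + real j) powr P) \<in> O(\<lambda>j. exp (- (\<beta> / 2) * real j))"
    using assms by real_asymp
  moreover have "exp (- (\<beta> / 2)) ^ j = exp (- (\<beta> / 2) * real j)" for j
    by (simp add: exp_of_nat_mult[symmetric] mult.commute)
  ultimately show "(\<lambda>j. exp (- (\<beta> * real j)) * (1 + real j) powr P) \<in> O(\<lambda>j. exp (- (\<beta> / 2)) ^ j)"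
    by simp
qed

lemma weighted_geometric_tail:
  fixes P \<beta> :: real
  assumes "1 \<le> m" "0 \<le> P"
  shows "exp (- (\<beta> * real (m + j))) * real (m + j) powr P \<le>
     (exp (- (\<beta> * real m)) * real m powr P) * (exp (- (\<beta> * real j)) * (1 + real j) powr P)"
proof -
  have "real (m + j) \<le> real m * (1 + real j)"
    using assms mult_right_mono[of 1 "real m" "real j"] by (simp add: algebra_simps)
  then have "real (m + j) powr P \<le> (real m * (1 + real j)) powr P"
    using assms by (intro powr_mono2) auto
  also have "\<dots> = real m powr P * (1 + real j) powr P" by (simp add: powr_mult)
  finally have "exp (- (\<beta> * real (m + j))) * real (m + j) powr P \<le>
     exp (- (\<beta> * real (m + j))) * (real m powr P * (1 + real j) powr P)"
    by (rule mult_left_mono) simp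
  also have "exp (- (\<beta> * real (m + j))) * (real m powr P * (1 + real j) powr P) =
     (exp (- (\<beta> * real m)) * real m powr P) * (exp (- (\<beta> * real j)) * (1 + real j) powr P)"
    by (simp add: exp_add[symmetric] algebra_simps)
  finally show ?thesis .
qed

text \<open>Grids of mesh \<open>exp (- n)\<close> with respect to the gauge: images of the integer lattice under the flow. The number of
grid points may grow like any exponential in \<open>n\<close>, since only its logarithm matters; the box is taken so large that
it eventually covers every bounded set.\<close>

locale anisotropic_grid =
  fixes E :: "real^'n^'n" and \<tau> :: "real^'n \<Rightarrow> real" and C a R1 :: real
  assumes gauge: "homogeneous_gauge E \<tau>" and a_pos: "0 < a" and C_pos: "0 < C"
    and contr: "\<And>t x. 0 \<le> t \<Longrightarrow> norm (flow E (- t) *v x) \<le> C * exp (- a * t) * norm x"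
    and R1: "\<And>x. \<tau> x \<le> 1 \<Longrightarrow> norm x \<le> R1"
begin

definition mesh :: nat where
  "mesh = nat \<lceil>exp (real CARD('n) * norm E + 1)\<rceil>"

definition lattice_box :: "nat \<Rightarrow> (real^'n) set" where
  "lattice_box n = (\<lambda>g. \<chi> i. real_of_int (g i)) ` (PiE UNIV (\<lambda>_. {- int (mesh ^ n)..int (mesh ^ n)}))"

definition grid :: "nat \<Rightarrow> (real^'n) set" where
  "grid n = (\<lambda>z. flow E (- real n) *v z) ` lattice_box n"

text \<open>Large enough for both kinds of links: between the projections of one point to consecutive grids, and
between the projections to one grid of two points whose gauge distance is at most the mesh.\<close>

definition reach :: real where
  "reach = R1 + 2 * real CARD('n) + C * real CARD('n) + 1"

definition links :: "nat \<Rightarrow> ((real^'n) \<times> (real^'n)) set" where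
  "links n = {(p, p'). p \<in> grid n \<union> grid (Suc n) \<and> p' \<in> grid n \<union> grid (Suc n) \<and>
     (\<exists>w. norm w \<le> reach \<and> p - p' = flow E (- real n) *v w)}"

definition project :: "nat \<Rightarrow> real^'n \<Rightarrow> real^'n" where
  "project n u = flow E (- real n) *v (\<chi> i. real_of_int \<lfloor>(flow E (real n) *v u) $ i\<rfloor>)"

lemma R1_nonneg: "0 \<le> R1"
  using R1[of 0] gauge_0[OF gauge] by simp

lemma reach_pos: "0 < reach"
  using R1_nonneg C_pos by (auto simp: reach_def intro!: add_nonneg_pos add_nonneg_nonneg)

lemma mesh_ge: "exp (real CARD('n) * norm E + 1) \<le> real mesh"
  unfolding mesh_def by (simp add: of_nat_nat le_of_int_ceiling)

lemma mesh_ge_1: "1 \<le> real mesh"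
proof -
  have "exp 0 \<le> exp (real CARD('n) * norm E + 1)" by (subst exp_le_cancel_iff) (simp add: add_nonneg_nonneg)
  also note mesh_ge
  finally show ?thesis by simp
qed

lemma finite_grid: "finite (grid n)"
  unfolding grid_def lattice_box_def by (intro finite_imageI finite_PiE) auto

lemma card_grid_le: "card (grid n) \<le> (3 * mesh ^ n) ^ CARD('n)"
proof -
  have "card (grid n) \<le> card (lattice_box n)"
    unfolding grid_def lattice_box_def by (intro card_image_le finite_imageI finite_PiE) auto
  also have "\<dots> \<le> card (PiE (UNIV :: 'n set) (\<lambda>_. {- int (mesh ^ n)..int (mesh ^ n)}))"
    unfolding lattice_box_def by (intro card_image_le finite_PiE) auto
  also have "\<dots> = (nat (1 + 2 * int (mesh ^ n))) ^ CARD('n)"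
    by (simp add: card_PiE add.commute)
  also have "\<dots> \<le> (3 * mesh ^ n) ^ CARD('n)"
  proof (rule power_mono)
    have "1 \<le> mesh ^ n" using mesh_ge_1 by simp
    then show "nat (1 + 2 * int (mesh ^ n)) \<le> 3 * mesh ^ n" by linarith
  qed simp
  finally show ?thesis .
qed

lemma links_subset: "links n \<subseteq> (grid n \<union> grid (Suc n)) \<times> (grid n \<union> grid (Suc n))"
  by (auto simp: links_def)

lemma finite_links: "finite (links n)"
  by (rule finite_subset[OF links_subset]) (auto simp: finite_grid)

lemma card_links_le:
  "real (card (links n)) \<le> 4 * (3 * real mesh) ^ (2 * CARD('n)) * exp (real n * (2 * real CARD('n) * ln (real mesh)))"
proof -
  let ?N = "(3 * mesh ^ Suc n) ^ CARD('n)"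
  have "card (grid n) \<le> ?N"
    using mesh_ge_1 by (intro order_trans[OF card_grid_le] power_mono mult_left_mono power_increasing) auto
  moreover have "card (grid (Suc n)) \<le> ?N" by (rule card_grid_le)
  ultimately have "card (grid n \<union> grid (Suc n)) \<le> 2 * ?N"
    using card_Un_le[of "grid n" "grid (Suc n)"] by linarith
  then have "card ((grid n \<union> grid (Suc n)) \<times> (grid n \<union> grid (Suc n))) \<le> (2 * ?N) * (2 * ?N)"
    unfolding card_cartesian_product by (intro mult_le_mono)
  moreover have "card (links n) \<le> card ((grid n \<union> grid (Suc n)) \<times> (grid n \<union> grid (Suc n)))"
    by (rule card_mono[OF _ links_subset]) (auto simp: finite_grid)
  ultimately have "card (links n) \<le> (2 * ?N) * (2 * ?N)" by linarith
  then have "real (card (links n)) \<le> real ((2 * ?N) * (2 * ?N))" by (rule of_nat_mono)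
  also have "\<dots> = 4 * ((3 * real mesh ^ Suc n) ^ CARD('n))\<^sup>2" by (simp add: power2_eq_square)
  also have "\<dots> = 4 * (3 * real mesh) ^ (2 * CARD('n)) * (real mesh ^ n) ^ (2 * CARD('n))"
  proof -
    have "((3 * real mesh ^ Suc n) ^ CARD('n))\<^sup>2 = ((3 * real mesh) * real mesh ^ n) ^ (2 * CARD('n))"
      unfolding power_mult[symmetric] by (simp add: mult_ac)
    then show ?thesis by (simp only: power_mult_distrib mult.assoc)
  qed
  also have "(real mesh ^ n) ^ (2 * CARD('n)) = exp (real n * (2 * real CARD('n) * ln (real mesh)))"
  proof -
    have "exp (real n * (2 * real CARD('n) * ln (real mesh))) = exp (real (n * (2 * CARD('n))) * ln (real mesh))"
      by simp
    also have "\<dots> = real mesh ^ (n * (2 * CARD('n)))"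
      using mesh_ge_1 by (subst exp_of_nat_mult) simp
    finally show ?thesis by (simp add: power_mult)
  qed
  finally show ?thesis .
qed

lemma project_error:
  obtains r where "norm r \<le> real CARD('n)" "u - project n u = flow E (- real n) *v r"
proof
  let ?r = "flow E (real n) *v u - (\<chi> i. real_of_int \<lfloor>(flow E (real n) *v u) $ i\<rfloor>)"
  have "norm ?r \<le> (\<Sum>i\<in>UNIV. \<bar>?r $ i\<bar>)" by (rule norm_le_l1_cart)
  also have "\<dots> \<le> (\<Sum>i\<in>(UNIV :: 'n set). 1)"
    by (intro sum_mono) (simp, linarith)
  finally show "norm ?r \<le> real CARD('n)" by simp
  show "u - project n u = flow E (- real n) *v ?r"
    by (simp add: project_def matrix_vector_mult_diff_distrib)
qed

lemma project_in_grid: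
  assumes u: "norm u \<le> R" and n: "(real CARD('n))\<^sup>2 * R + 1 \<le> exp (real n)"
  shows "project n u \<in> grid n"
proof -
  let ?b = "real CARD('n) * norm E"
  have "\<lfloor>(flow E (real n) *v u) $ i\<rfloor> \<in> {- int (mesh ^ n)..int (mesh ^ n)}" for i
  proof -
    have "\<bar>(flow E (real n) *v u) $ i\<bar> + 1 \<le> (real CARD('n))\<^sup>2 * exp (?b * real n) * norm u + 1"
      using component_le_norm_cart[of "flow E (real n) *v u" i] flow_growth[of E "real n" u] by simp
    also have "\<dots> \<le> (real CARD('n))\<^sup>2 * exp (?b * real n) * R + exp (?b * real n) * 1"
      using u by (intro add_mono mult_left_mono) auto
    also have "\<dots> = exp (?b * real n) * ((real CARD('n))\<^sup>2 * R + 1)"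
      by (simp add: algebra_simps)
    also have "\<dots> \<le> exp (?b * real n) * exp (real n)" by (rule mult_left_mono[OF n]) simp
    also have "\<dots> = exp (?b + 1) ^ n"
      by (simp add: exp_of_nat_mult[symmetric] exp_add[symmetric] algebra_simps)
    also have "\<dots> \<le> real mesh ^ n" by (rule power_mono[OF mesh_ge]) simp
    finally have "\<bar>(flow E (real n) *v u) $ i\<bar> + 1 \<le> real_of_int (int (mesh ^ n))" by simp
    then show ?thesis unfolding atLeastAtMost_iff by linarith
  qed
  then have "(\<chi> i. real_of_int \<lfloor>(flow E (real n) *v u) $ i\<rfloor>) \<in> lattice_box n"
    unfolding lattice_box_def by (intro image_eqI[of _ _ "\<lambda>i. \<lfloor>(flow E (real n) *v u) $ i\<rfloor>"]) auto
  then show ?thesis unfolding project_def grid_def by (rule imageI)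
qed

lemma vertical_link:
  assumes "project n u \<in> grid n" "project (Suc n) u \<in> grid (Suc n)"
  shows "(project (Suc n) u, project n u) \<in> links n"
proof -
  obtain r where r: "norm r \<le> real CARD('n)" "u - project n u = flow E (- real n) *v r"
    by (rule project_error)
  obtain r' where r': "norm r' \<le> real CARD('n)" "u - project (Suc n) u = flow E (- real (Suc n)) *v r'"
    by (rule project_error)
  have "- real (Suc n) = - real n + - 1" by simp
  then have f: "flow E (- real (Suc n)) *v r' = flow E (- real n) *v (flow E (- 1) *v r')"
    by (simp only: flow_add_vec)
  have "project (Suc n) u - project n u = (u - project n u) - (u - project (Suc n) u)" by simp
  also have "\<dots> = flow E (- real n) *v (r - flow E (- 1) *v r')"
    unfolding r(2) r'(2) f by (simp add: matrix_vector_mult_diff_distrib)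
  finally have eq: "project (Suc n) u - project n u = flow E (- real n) *v (r - flow E (- 1) *v r')" .
  have "norm (flow E (- 1) *v r') \<le> C * exp (- a) * norm r'" using contr[of 1 r'] by simp
  also have "\<dots> \<le> C * 1 * real CARD('n)"
    using C_pos a_pos r'(1) by (intro mult_mono) auto
  finally have "norm (flow E (- 1) *v r') \<le> C * real CARD('n)" by simp
  then have "norm (r - flow E (- 1) *v r') \<le> reach"
    using norm_triangle_ineq4[of r "flow E (- 1) *v r'"] r(1) R1_nonneg unfolding reach_def by linarith
  then show ?thesis using eq assms unfolding links_def by blast
qed

lemma horizontal_link:
  assumes "project n u \<in> grid n" "project n v \<in> grid n" and uv: "\<tau> (u - v) \<le> exp (- real n)"
  shows "(project n u, project n v) \<in> links n"
proof -
  obtain r where r: "norm r \<le> real CARD('n)" "u - project n u = flow E (- real n) *v r"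
    by (rule project_error)
  obtain s where s: "norm s \<le> real CARD('n)" "v - project n v = flow E (- real n) *v s"
    by (rule project_error)
  let ?w = "flow E (real n) *v (u - v)"
  have "\<tau> ?w = exp (real n) * \<tau> (u - v)" by (rule gauge_flow[OF gauge])
  also have "\<dots> \<le> exp (real n) * exp (- real n)" by (rule mult_left_mono[OF uv]) simp
  finally have w: "norm ?w \<le> R1" by (intro R1) (simp add: exp_minus)
  have "project n u - project n v = (u - v) - (u - project n u) + (v - project n v)" by simp
  also have "\<dots> = flow E (- real n) *v (?w - r + s)"
    unfolding r(2) s(2) by (simp add: matrix_vector_mult_diff_distrib matrix_vector_right_distrib)
  finally have eq: "project n u - project n v = flow E (- real n) *v (?w - r + s)" .
  have "norm (?w - r + s) \<le> norm ?w + norm r + norm s"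
    using norm_triangle_ineq[of "?w - r" s] norm_triangle_ineq4[of ?w r] by linarith
  moreover have "0 \<le> C * real CARD('n)" using C_pos by simp
  ultimately have "norm (?w - r + s) \<le> reach"
    using w r(1) s(1) unfolding reach_def by linarith
  then show ?thesis using eq assms unfolding links_def by blast
qed

text \<open>Kolmogorov's chaining, purely deterministic. The weights \<open>exp (- (\<beta> * n)) * n powr P\<close> have tails
comparable to their first term, so the telescoping sum from scale \<open>m\<close> on costs no more than the horizontal
link at scale \<open>m\<close>, where \<open>exp (- m)\<close> is the gauge distance of the two points up to a constant factor. Pairs at larger distance are handled by
a bound for the limit on the ball, as the weight on the right-hand side is bounded below there.\<close>

lemma chaining_modulus:
  fixes Y :: "real^'n \<Rightarrow> complex"
  assumes "0 < \<beta>" "0 \<le> P" "0 \<le> L"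
    and links: "\<And>n p p'. N0 \<le> n \<Longrightarrow> (p, p') \<in> links n \<Longrightarrow> cmod (Y p - Y p') \<le> L * (exp (- (\<beta> * real n)) * real n powr P)"
  shows "\<exists>B. \<forall>u v. norm u \<le> R \<longrightarrow> norm v \<le> R \<longrightarrow> u \<noteq> v \<longrightarrow>
     cmod (lim (\<lambda>n. Y (project n u)) - lim (\<lambda>n. Y (project n v))) \<le>
       B * (\<tau> (u - v) powr \<beta> * ln (1 + inverse (\<tau> (u - v))) powr P)"
proof -
  define T where "T n = exp (- (\<beta> * real n)) * real n powr P" for n
  have T0: "0 \<le> T n" for n by (simp add: T_def)
  define H where "H = (\<Sum>j. exp (- (\<beta> * real j)) * (1 + real j) powr P)"
  have H0: "0 \<le> H" unfolding H_def by (intro suminf_nonneg summable_exp_powr assms) auto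
  obtain N1 :: nat where N1: "(real CARD('n))\<^sup>2 * R + 1 \<le> real N1" using real_arch_simple by blast
  define N where "N = max (max N0 N1) 1"
  have N: "N0 \<le> N" "1 \<le> N" by (auto simp: N_def)
  have in_grid: "project n u \<in> grid n" if "norm u \<le> R" "N \<le> n" for n u
  proof (rule project_in_grid[OF that(1)])
    have "real N1 \<le> real n" using that(2) by (auto simp: N_def)
    also have "\<dots> \<le> exp (real n)" using exp_ge_add_one_self[of "real n"] by linarith
    finally show "(real CARD('n))\<^sup>2 * R + 1 \<le> exp (real n)" using N1 by linarith
  qed
  define y where "y u = lim (\<lambda>n. Y (project n u))" for u
  have tail: "cmod (y u - Y (project m u)) \<le> L * H * T m" if u: "norm u \<le> R" and m: "N \<le> m" for u m
  proof -
    have st: "norm (Y (project (m + Suc j) u) - Y (project (m + j) u)) \<le>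
        (L * T m) * (exp (- (\<beta> * real j)) * (1 + real j) powr P)" for j
    proof -
      have "norm (Y (project (Suc (m + j)) u) - Y (project (m + j) u)) \<le> L * T (m + j)"
        unfolding T_def using m N
        by (intro links vertical_link in_grid u) auto
      also have "\<dots> \<le> L * (T m * (exp (- (\<beta> * real j)) * (1 + real j) powr P))"
        unfolding T_def using m N assms by (intro mult_left_mono weighted_geometric_tail) auto
      finally show ?thesis by (simp add: mult.assoc)
    qed
    have s0: "summable (\<lambda>j. (L * T m) * (exp (- (\<beta> * real j)) * (1 + real j) powr P))"
      by (intro summable_mult summable_exp_powr assms)
    have s1: "summable (\<lambda>j. Y (project (m + Suc j) u) - Y (project (m + j) u))"
      by (rule summable_comparison_test'[OF s0, of 0]) (use st in auto)
    let ?S = "\<Sum>j. Y (project (m + Suc j) u) - Y (project (m + j) u)"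
    have "(\<lambda>k. \<Sum>j<k. Y (project (m + Suc j) u) - Y (project (m + j) u)) \<longlonglongrightarrow> ?S"
      using summable_LIMSEQ[OF s1] .
    moreover have "(\<Sum>j<k. Y (project (m + Suc j) u) - Y (project (m + j) u)) = Y (project (m + k) u) - Y (project m u)" for k
      using sum_lessThan_telescope[of "\<lambda>j. Y (project (m + j) u)" k] by simp
    ultimately have "(\<lambda>k. Y (project (m + k) u) - Y (project m u) + Y (project m u)) \<longlonglongrightarrow> ?S + Y (project m u)"
      by (intro tendsto_add) auto
    then have "(\<lambda>k. Y (project (k + m) u)) \<longlonglongrightarrow> ?S + Y (project m u)" by (simp add: add.commute)
    then have "(\<lambda>n. Y (project n u)) \<longlonglongrightarrow> ?S + Y (project m u)" by (rule LIMSEQ_offset)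
    then have "y u = ?S + Y (project m u)" unfolding y_def by (rule limI)
    then have "cmod (y u - Y (project m u)) = cmod ?S" by simp
    also have "\<dots> \<le> (\<Sum>j. (L * T m) * (exp (- (\<beta> * real j)) * (1 + real j) powr P))"
      by (rule norm_suminf_le[OF st s0])
    also have "\<dots> = L * T m * H"
      unfolding H_def by (rule suminf_mult[OF summable_exp_powr[OF \<open>0 < \<beta>\<close>]])
    finally show ?thesis by (simp add: mult_ac)
  qed
  define B1 where "B1 = L * (2 * H + 1) * exp \<beta>"
  have B1: "0 \<le> B1" using H0 \<open>0 \<le> L\<close> by (simp add: B1_def)
  have close: "cmod (y u - y v) \<le> B1 * (\<tau> (u - v) powr \<beta> * ln (1 + inverse (\<tau> (u - v))) powr P)"
    if u: "norm u \<le> R" and v: "norm v \<le> R" and ne: "u \<noteq> v" and small: "\<tau> (u - v) \<le> exp (- real N)" for u v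
  proof -
    have t0: "0 < \<tau> (u - v)" using ne by (intro gauge_pos[OF gauge]) simp
    \<comment> \<open>The scale of the pair: \<open>exp (- m - 1) < \<tau> (u - v) \<le> exp (- m)\<close>.\<close>
    define m where "m = nat \<lfloor>- ln (\<tau> (u - v))\<rfloor>"
    have "ln (\<tau> (u - v)) \<le> ln (exp (- real N))" using small t0 by (subst ln_le_cancel_iff) auto
    then have "ln (\<tau> (u - v)) \<le> - real N" by simp
    then have fl: "int N \<le> \<lfloor>- ln (\<tau> (u - v))\<rfloor>" by (simp add: le_floor_iff)
    then have mN: "N \<le> m" unfolding m_def by linarith
    have rm: "real m = real_of_int \<lfloor>- ln (\<tau> (u - v))\<rfloor>" using fl by (simp add: m_def)
    have m1: "real m \<le> - ln (\<tau> (u - v))" and m2: "- ln (\<tau> (u - v)) \<le> real m + 1"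
      unfolding rm by linarith+
    have "\<tau> (u - v) \<le> exp (- real m)" using m1 t0 by (metis exp_le_cancel_iff exp_ln le_minus_iff)
    then have "cmod (Y (project m u) - Y (project m v)) \<le> L * T m"
      unfolding T_def using N mN by (intro links horizontal_link in_grid u v) auto
    moreover have "y u - y v = (y u - Y (project m u)) + (Y (project m u) - Y (project m v)) - (y v - Y (project m v))"
      by simp
    then have "cmod (y u - y v) \<le> cmod (y u - Y (project m u)) + cmod (Y (project m u) - Y (project m v)) + cmod (y v - Y (project m v))"
      by (metis add_right_mono norm_triangle_ineq norm_triangle_ineq4 order_trans)
    ultimately have "cmod (y u - y v) \<le> L * (2 * H + 1) * T m"
      using tail[OF u mN] tail[OF v mN] by (simp add: algebra_simps)
    also have "\<dots> \<le> L * (2 * H + 1) * ((exp \<beta> * \<tau> (u - v) powr \<beta>) * ln (1 + inverse (\<tau> (u - v))) powr P)"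
    proof -
      have "exp (- (\<beta> * real m)) \<le> exp (\<beta> + \<beta> * ln (\<tau> (u - v)))"
        using mult_left_mono[OF m2, of \<beta>] \<open>0 < \<beta>\<close> by (simp add: algebra_simps)
      also have "\<dots> = exp \<beta> * \<tau> (u - v) powr \<beta>" using t0 by (simp add: exp_add powr_def)
      finally have 1: "exp (- (\<beta> * real m)) \<le> exp \<beta> * \<tau> (u - v) powr \<beta>" .
      have "- ln (\<tau> (u - v)) = ln (inverse (\<tau> (u - v)))" using t0 by (simp add: ln_inverse)
      also have "\<dots> \<le> ln (1 + inverse (\<tau> (u - v)))" using t0 by (subst ln_le_cancel_iff) (auto intro: add_pos_pos)
      finally have "real m powr P \<le> ln (1 + inverse (\<tau> (u - v))) powr P"
        using m1 \<open>0 \<le> P\<close> by (intro powr_mono2) auto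
      then show ?thesis unfolding T_def using 1 H0 \<open>0 \<le> L\<close> by (intro mult_left_mono mult_mono) auto
    qed
    finally show ?thesis by (simp add: B1_def mult_ac)
  qed
  have "\<exists>B2\<ge>0. \<forall>u v. norm u \<le> R \<longrightarrow> norm v \<le> R \<longrightarrow> u \<noteq> v \<longrightarrow> exp (- real N) \<le> \<tau> (u - v) \<longrightarrow>
     cmod (y u - y v) \<le> B2 * (\<tau> (u - v) powr \<beta> * ln (1 + inverse (\<tau> (u - v))) powr P)"
  proof -
    define S where "S = (\<Sum>p\<in>grid N. cmod (Y p)) + L * H * T N"
    have S: "cmod (y u) \<le> S" if u: "norm u \<le> R" for u
    proof -
      have "cmod (Y (project N u)) \<le> (\<Sum>p\<in>grid N. cmod (Y p))"
        using in_grid[OF u] finite_grid by (intro member_le_sum) auto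
      moreover have "cmod (y u) \<le> cmod (y u - Y (project N u)) + cmod (Y (project N u))"
        using norm_triangle_ineq[of "y u - Y (project N u)" "Y (project N u)"] by simp
      ultimately show ?thesis using tail[OF u order_refl] by (simp add: S_def)
    qed
    have S0: "0 \<le> S" unfolding S_def using H0 T0 \<open>0 \<le> L\<close> by (auto intro!: add_nonneg_nonneg sum_nonneg mult_nonneg_nonneg)
    have "compact (\<tau> ` cball 0 (2 * R))"
      by (intro compact_continuous_image gauge_continuous[OF gauge] compact_cball)
    then obtain Tm where Tm: "\<And>x. norm x \<le> 2 * R \<Longrightarrow> \<tau> x \<le> Tm"
      using bounded_imp_bdd_above[OF compact_imp_bounded] by (fastforce simp: bdd_above_def)
    define D where "D = exp (- real N) powr \<beta> * ln (1 + inverse (max Tm 1)) powr P"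
    have "0 < ln (1 + inverse (max Tm 1))"
      by (rule ln_gt_zero) (simp add: less_max_iff_disj)
    then have D: "0 < D" unfolding D_def by simp
    have "cmod (y u - y v) \<le> 2 * S / D * (\<tau> (u - v) powr \<beta> * ln (1 + inverse (\<tau> (u - v))) powr P)"
      if u: "norm u \<le> R" and v: "norm v \<le> R" and ne: "u \<noteq> v" and large: "exp (- real N) \<le> \<tau> (u - v)" for u v
    proof -
      have t0: "0 < \<tau> (u - v)" using ne by (intro gauge_pos[OF gauge]) simp
      have "\<tau> (u - v) \<le> max Tm 1" using Tm[of "u - v"] u v norm_triangle_ineq4[of u v] by simp
      then have "ln (1 + inverse (max Tm 1)) \<le> ln (1 + inverse (\<tau> (u - v)))"
        using t0 by (subst ln_le_cancel_iff) (auto intro!: le_imp_inverse_le add_pos_pos)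
      then have "D \<le> \<tau> (u - v) powr \<beta> * ln (1 + inverse (\<tau> (u - v))) powr P"
        unfolding D_def using large \<open>0 < \<beta>\<close> \<open>0 \<le> P\<close>
        by (intro mult_mono powr_mono2) (auto intro!: ln_ge_zero)
      then have "2 * S / D * D \<le> 2 * S / D * (\<tau> (u - v) powr \<beta> * ln (1 + inverse (\<tau> (u - v))) powr P)"
        using S0 D by (intro mult_left_mono) auto
      moreover have "cmod (y u - y v) \<le> 2 * S"
        using norm_triangle_ineq4[of "y u" "y v"] S[OF u] S[OF v] by linarith
      ultimately show ?thesis using D by simp
    qed
    moreover have "0 \<le> 2 * S / D" using S0 D by simp
    ultimately show ?thesis by blast
  qed
  then obtain B2 where B2: "0 \<le> B2" and far: "\<And>u v. norm u \<le> R \<Longrightarrow> norm v \<le> R \<Longrightarrow> u \<noteq> v \<Longrightarrow> exp (- real N) \<le> \<tau> (u - v) \<Longrightarrow>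
     cmod (y u - y v) \<le> B2 * (\<tau> (u - v) powr \<beta> * ln (1 + inverse (\<tau> (u - v))) powr P)" by blast
  have "cmod (y u - y v) \<le> max B1 B2 * (\<tau> (u - v) powr \<beta> * ln (1 + inverse (\<tau> (u - v))) powr P)"
    if "norm u \<le> R" "norm v \<le> R" "u \<noteq> v" for u v
  proof (cases "\<tau> (u - v) \<le> exp (- real N)")
    case True
    show ?thesis by (rule order_trans[OF close[OF that True]]) (rule mult_right_mono, auto)
  next
    case False
    then have large: "exp (- real N) \<le> \<tau> (u - v)" by simp
    show ?thesis by (rule order_trans[OF far[OF that large]]) (rule mult_right_mono, auto)
  qed
  then show ?thesis unfolding y_def by blast
qed

end

section \<open>The modulus of continuity\<close>

text \<open>The last two assumptions bound the envelope of the kernel increments at scale \<open>n\<close>; they are the only way in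
which the decay of \<open>\<psi>\<close> and the gauge of the transposed matrix enter the probabilistic argument.\<close>

locale harmonizable_sampling = stable_integral P \<alpha> lborel M + anisotropic_grid E \<tau> C a R1
  for P :: "'w measure" and \<alpha> and M :: "(real^'n \<Rightarrow> complex) \<Rightarrow> 'w \<Rightarrow> complex"
    and E :: "real^'n^'n" and \<tau> C a R1 +
  fixes \<psi> :: "real^'n \<Rightarrow> complex" and \<beta> K :: real
  assumes beta_pos: "0 < \<beta>" and K_pos: "0 < K" and psi[measurable]: "\<psi> \<in> borel_measurable borel"
    and low: "integrable lborel (\<lambda>\<xi>. min 1 (norm \<xi> powr \<alpha>) * cmod (\<psi> \<xi>) powr \<alpha>)"
    and envelope_in: "\<And>n. (\<lambda>\<xi>. complex_of_real (cutoff (transpose E) reach n \<xi> * cmod (\<psi> \<xi>))) \<in> L_alpha lborel \<alpha>"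
    and envelope_mass: "\<And>n. (LINT \<xi>|lborel. (cutoff (transpose E) reach n \<xi> * cmod (\<psi> \<xi>)) powr \<alpha>)
       \<le> K * exp (- (real n * \<alpha> * \<beta>))"
begin

definition envelope :: "nat \<Rightarrow> real^'n \<Rightarrow> real" where
  "envelope n \<xi> = cutoff (transpose E) reach n \<xi> * cmod (\<psi> \<xi>)"

abbreviation kernel :: "real^'n \<Rightarrow> real^'n \<Rightarrow> complex" where
  "kernel u \<equiv> (\<lambda>\<xi>. (iexp (u \<bullet> \<xi>) - 1) * \<psi> \<xi>)"

abbreviation X :: "real^'n \<Rightarrow> 'w \<Rightarrow> complex" where
  "X u \<equiv> M (kernel u)"

lemma kernel_in: "kernel u \<in> L_alpha lborel \<alpha>"
  by (rule harmonizable_kernel_in_L_alpha[OF alpha_pos psi low])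

lemma X_measurable: "X u \<in> borel_measurable P"
  by (rule M_measurable[OF kernel_in])

lemma envelope_nonneg: "0 \<le> envelope n \<xi>"
  using reach_pos by (simp add: envelope_def)

lemma envelope_L_alpha: "(\<lambda>\<xi>. complex_of_real (envelope n \<xi>)) \<in> L_alpha lborel \<alpha>"
  unfolding envelope_def by (rule envelope_in)

lemma envelope_integral: "(LINT \<xi>|lborel. envelope n \<xi> powr \<alpha>) \<le> K * exp (- (real n * \<alpha> * \<beta>))"
  unfolding envelope_def by (rule envelope_mass)

lemma kernel_increment_le:
  assumes w: "norm w \<le> reach" and p: "p - p' = flow E (- real n) *v w"
  shows "cmod (kernel p \<xi> - kernel p' \<xi>) \<le> envelope n \<xi>"
proof -
  have "iexp (p \<bullet> \<xi>) - iexp (p' \<bullet> \<xi>) = iexp (p' \<bullet> \<xi>) * (iexp ((p - p') \<bullet> \<xi>) - 1)"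
    by (simp add: inner_diff_left exp_diff algebra_simps)
  then have e: "cmod (iexp (p \<bullet> \<xi>) - iexp (p' \<bullet> \<xi>)) = cmod (iexp ((p - p') \<bullet> \<xi>) - 1)"
    by (simp add: norm_mult)
  have 1: "cmod (iexp ((p - p') \<bullet> \<xi>) - 1) \<le> 2"
    using norm_triangle_ineq4[of "iexp ((p - p') \<bullet> \<xi>)" 1] by simp
  have "cmod (iexp ((p - p') \<bullet> \<xi>) - 1) \<le> \<bar>(p - p') \<bullet> \<xi>\<bar>"
    using iexp_approx1[of "(p - p') \<bullet> \<xi>" 0] by simp
  moreover have "(p - p') \<bullet> \<xi> = w \<bullet> (flow (transpose E) (- real n) *v \<xi>)"
    unfolding p flow_transpose dot_lmul_matrix[symmetric] by (simp del: transpose_matrix_vector)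
  moreover have "\<bar>w \<bullet> (flow (transpose E) (- real n) *v \<xi>)\<bar> \<le> norm w * norm (flow (transpose E) (- real n) *v \<xi>)" by (rule Cauchy_Schwarz_ineq2)
  moreover have "norm w * norm (flow (transpose E) (- real n) *v \<xi>) \<le> reach * norm (flow (transpose E) (- real n) *v \<xi>)"
    by (intro mult_right_mono w) simp
  ultimately have "cmod (iexp (p \<bullet> \<xi>) - iexp (p' \<bullet> \<xi>)) \<le> cutoff (transpose E) reach n \<xi>"
    using 1 unfolding e by linarith
  then have "cmod (iexp (p \<bullet> \<xi>) - iexp (p' \<bullet> \<xi>)) * cmod (\<psi> \<xi>) \<le> envelope n \<xi>"
    unfolding envelope_def by (rule mult_right_mono) simp
  moreover have "kernel p \<xi> - kernel p' \<xi> = (iexp (p \<bullet> \<xi>) - iexp (p' \<bullet> \<xi>)) * \<psi> \<xi>"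
    by (simp add: algebra_simps)
  ultimately show ?thesis by (simp only: norm_mult)
qed

text \<open>The stable scales of the errors decay geometrically, so convergence in probability improves to almost
sure convergence; this identifies the limit along the grids as a modification.\<close>

lemma project_tendsto: "AE \<omega> in P. (\<lambda>n. X (project n u) \<omega>) \<longlonglongrightarrow> X u \<omega>"
proof -
  define R where "R n = (\<lambda>\<xi>. kernel u \<xi> - kernel (project n u) \<xi>)" for n
  define y where "y n = exp (- (\<beta> / 2 * real n))" for n
  have y: "0 < y n" for n by (simp add: y_def)
  have R_in: "R n \<in> L_alpha lborel \<alpha>" and R_ae: "AE \<omega> in P. M (R n) \<omega> = X u \<omega> - X (project n u) \<omega>" for n
    unfolding R_def by (rule M_diff[OF kernel_in kernel_in])+
  have mass: "mass (R n) \<le> K * exp (- (real n * \<alpha> * \<beta>))" for n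
  proof -
    obtain r where r: "norm r \<le> real CARD('n)" "u - project n u = flow E (- real n) *v r"
      by (rule project_error)
    have "0 \<le> C * real CARD('n)" using C_pos by simp
    then have "norm r \<le> reach" using r(1) R1_nonneg unfolding reach_def by linarith
    then have "cmod (R n \<xi>) \<le> 1 * cmod (complex_of_real (envelope n \<xi>))" for \<xi>
      using kernel_increment_le[OF _ r(2)] envelope_nonneg[of n \<xi>] by (simp add: R_def)
    then have "mass (R n) \<le> 1 powr \<alpha> * (LINT \<xi>|lborel. cmod (complex_of_real (envelope n \<xi>)) powr \<alpha>)"
      by (intro L_alpha_dominated(2)[OF envelope_L_alpha alpha_pos _ L_alpha_measurable[OF R_in]]) auto
    then have "mass (R n) \<le> (LINT \<xi>|lborel. envelope n \<xi> powr \<alpha>)"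
      by (simp add: envelope_nonneg)
    also note envelope_integral
    finally show ?thesis .
  qed
  define A where "A n = {\<omega>\<in>space P. y n \<le> cmod (M (R n) \<omega>)}" for n
  have [measurable]: "M (R n) \<in> borel_measurable P" for n by (rule M_measurable[OF R_in])
  have "prob (A n) \<le> 12 * stable_const \<alpha> * K * exp (- (\<alpha> * \<beta> / 2)) ^ n" for n
  proof -
    have "prob (A n) \<le> 12 * stable_const \<alpha> * y n powr - \<alpha> * mass (R n)"
      unfolding A_def by (rule prob_norm_ge_le[OF R_in y])
    also have "\<dots> \<le> 12 * stable_const \<alpha> * y n powr - \<alpha> * (K * exp (- (real n * \<alpha> * \<beta>)))"
      using stable_const_nonneg[of \<alpha>] by (intro mult_left_mono mass) auto
    also have "\<dots> = 12 * stable_const \<alpha> * (y n powr - \<alpha> * (K * exp (- (real n * \<alpha> * \<beta>))))"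
      by (simp only: mult.assoc)
    also have "y n powr - \<alpha> * (K * exp (- (real n * \<alpha> * \<beta>))) = K * exp (- (\<alpha> * \<beta> / 2)) ^ n"
    proof -
      have "y n powr - \<alpha> * exp (- (real n * \<alpha> * \<beta>)) = exp (real n * (- (\<alpha> * \<beta> / 2)))"
        by (simp add: y_def powr_def exp_add[symmetric] algebra_simps)
      also have "\<dots> = exp (- (\<alpha> * \<beta> / 2)) ^ n" by (rule exp_of_nat_mult)
      finally show ?thesis by (simp add: mult.left_commute)
    qed
    finally show ?thesis by (simp add: mult.assoc)
  qed
  then have le: "norm (prob (A n)) \<le> 12 * stable_const \<alpha> * K * exp (- (\<alpha> * \<beta> / 2)) ^ n" for n
    by simp
  have "summable (\<lambda>n. 12 * stable_const \<alpha> * K * exp (- (\<alpha> * \<beta> / 2)) ^ n)"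
    by (rule summable_mult, rule summable_geometric) (simp add: alpha_pos beta_pos)
  then have "summable (\<lambda>n. prob (A n))"
    by (rule summable_comparison_test'[where N=0]) (rule le)
  then have bc: "AE \<omega> in P. eventually (\<lambda>n. \<omega> \<in> space P - A n) sequentially"
    by (intro borel_cantelli_AE1) (auto simp: A_def emeasure_eq_measure)
  have "AE \<omega> in P. \<forall>n. M (R n) \<omega> = X u \<omega> - X (project n u) \<omega>"
    using R_ae by (simp add: AE_all_countable)
  with bc show ?thesis
  proof eventually_elim
    case (elim \<omega>)
    have "eventually (\<lambda>n. norm (X (project n u) \<omega> - X u \<omega>) \<le> y n) sequentially"
      using elim(1) by eventually_elim (use elim(2) in \<open>auto simp: A_def norm_minus_commute\<close>)
    moreover have "y \<longlonglongrightarrow> 0" unfolding y_def using beta_pos by real_asymp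
    ultimately have "(\<lambda>n. X (project n u) \<omega> - X u \<omega>) \<longlonglongrightarrow> 0"
      by (rule Lim_null_comparison)
    then show ?case by (rule LIM_zero_cancel)
  qed
qed

text \<open>The maximal inequality is applied with \<open>x n\<close> just above \<open>exp (- (\<beta> * n)) * n powr (1 / \<alpha>)\<close>, which makes the
heavy-tailed part \<open>real n powr (- (1 + \<alpha> * \<delta>))\<close> summable, and with \<open>t n\<close> larger by a factor of order \<open>sqrt n\<close>, so
that the Gaussian part beats the exponentially many links. The two factors are the origin of the exponents
\<open>1 / \<alpha>\<close> and \<open>1 / 2\<close> of the logarithm.\<close>

lemma links_eventually_bounded:
  fixes \<delta> :: real
  assumes "0 < \<delta>"
  shows "\<exists>L\<ge>0. AE \<omega> in P. \<exists>N0. \<forall>n\<ge>N0. \<forall>(p, p')\<in>links n.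
     cmod (X p \<omega> - X p' \<omega>) \<le> L * (exp (- (\<beta> * real n)) * real n powr (1 / 2 + 1 / \<alpha> + \<delta>))"
proof -
  define s where "s = 2 * real CARD('n) * ln (real mesh) + 1"
  have s: "0 < s" using mesh_ge_1 by (auto simp: s_def intro!: add_nonneg_pos mult_nonneg_nonneg)
  define x where "x n = exp (- (\<beta> * real n)) * real n powr (1 / \<alpha> + \<delta>)" for n
  define t where "t n = x n * sqrt (2 * s * real n)" for n
  define Kc where "Kc = 4 * (3 * real mesh) ^ (2 * CARD('n))"
  define F where "F pp = (\<lambda>\<xi>. kernel (fst pp) \<xi> - kernel (snd pp) \<xi>)" for pp
  have F_in: "F pp \<in> L_alpha lborel \<alpha>" and F_ae: "AE \<omega> in P. M (F pp) \<omega> = X (fst pp) \<omega> - X (snd pp) \<omega>" for pp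
    unfolding F_def by (rule M_diff[OF kernel_in kernel_in])+
  have [measurable]: "M (F pp) \<in> borel_measurable P" for pp by (rule M_measurable[OF F_in])
  define A where "A n = {\<omega>\<in>space P. \<exists>pp\<in>links n. 3 * t n < cmod (M (F pp) \<omega>)}" for n
  have A_meas: "A n \<in> sets P" for n
    unfolding A_def by (rule sets.sets_Collect_finite_Ex[OF _ finite_links]) measurable
  have pA: "prob (A n) \<le> 12 * stable_const \<alpha> * K * real n powr (- (1 + \<alpha> * \<delta>)) + 4 * Kc * exp (- 1) ^ n" if n: "1 \<le> n" for n
  proof -
    have xn: "0 < x n" using n by (simp add: x_def)
    have tn: "0 < t n" using xn n s by (simp add: t_def)
    have "prob (A n) \<le> 12 * stable_const \<alpha> * x n powr - \<alpha> * (LINT \<xi>|lborel. envelope n \<xi> powr \<alpha>) +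
        4 * card (links n) * exp (- ((t n)\<^sup>2 / (2 * (x n)\<^sup>2)))"
      unfolding A_def
    proof (rule maximal_inequality[OF finite_links envelope_L_alpha envelope_nonneg _ _ xn tn])
      fix pp assume "pp \<in> links n"
      then obtain w where "norm w \<le> reach" "fst pp - snd pp = flow E (- real n) *v w" by (auto simp: links_def)
      then show "cmod (F pp \<xi>) \<le> envelope n \<xi>" for \<xi> unfolding F_def by (rule kernel_increment_le)
    qed (rule L_alpha_measurable[OF F_in])
    also have "\<dots> \<le> 12 * stable_const \<alpha> * x n powr - \<alpha> * (K * exp (- (real n * \<alpha> * \<beta>))) +
        4 * (Kc * exp (real n * (2 * real CARD('n) * ln (real mesh)))) * exp (- (s * real n))"
    proof (intro add_mono mult_mono order_refl)
      show "(LINT \<xi>|lborel. envelope n \<xi> powr \<alpha>) \<le> K * exp (- (real n * \<alpha> * \<beta>))"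
        by (rule envelope_integral)
      show "real (4 * card (links n)) \<le> 4 * (Kc * exp (real n * (2 * real CARD('n) * ln (real mesh))))"
      proof -
        have "real (card (links n)) \<le> Kc * exp (real n * (2 * real CARD('n) * ln (real mesh)))"
          unfolding Kc_def by (rule card_links_le)
        then show ?thesis by linarith
      qed
      have "(t n)\<^sup>2 / (2 * (x n)\<^sup>2) = s * real n"
        using xn s by (simp add: t_def power_mult_distrib)
      then show "exp (- ((t n)\<^sup>2 / (2 * (x n)\<^sup>2))) \<le> exp (- (s * real n))" by simp
    qed (use stable_const_nonneg[of \<alpha>] K_pos in \<open>auto simp: Kc_def intro!: Bochner_Integration.integral_nonneg\<close>)
    also have "12 * stable_const \<alpha> * x n powr - \<alpha> * (K * exp (- (real n * \<alpha> * \<beta>))) =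
        12 * stable_const \<alpha> * (x n powr - \<alpha> * (K * exp (- (real n * \<alpha> * \<beta>))))"
      by (simp only: mult.assoc)
    also have "x n powr - \<alpha> * (K * exp (- (real n * \<alpha> * \<beta>))) = K * real n powr (- (1 + \<alpha> * \<delta>))"
    proof -
      have "x n powr - \<alpha> = exp (real n * \<alpha> * \<beta>) * real n powr (- (1 + \<alpha> * \<delta>))"
      proof -
        have "x n powr - \<alpha> = exp (- (\<beta> * real n)) powr - \<alpha> * (real n powr (1 / \<alpha> + \<delta>)) powr - \<alpha>"
          unfolding x_def by (simp add: powr_mult)
        moreover have "exp (- (\<beta> * real n)) powr - \<alpha> = exp (real n * \<alpha> * \<beta>)" by (simp add: powr_def mult_ac)
        moreover have "(1 / \<alpha> + \<delta>) * - \<alpha> = - (1 + \<alpha> * \<delta>)" using alpha_pos by (simp add: field_simps)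
        ultimately show ?thesis by (simp only: powr_powr)
      qed
      then show ?thesis by (simp add: exp_minus field_simps)
    qed
    also have "4 * (Kc * exp (real n * (2 * real CARD('n) * ln (real mesh)))) * exp (- (s * real n)) = 4 * Kc * exp (- 1) ^ n"
    proof -
      have "exp (real n * (2 * real CARD('n) * ln (real mesh))) * exp (- (s * real n)) = exp (real n * (- 1))"
        by (simp only: exp_add[symmetric]) (simp add: s_def algebra_simps)
      also have "\<dots> = exp (- 1) ^ n" by (rule exp_of_nat_mult)
      finally show ?thesis by (simp only: mult.assoc)
    qed
    finally show ?thesis by (simp add: mult.assoc)
  qed
  have "summable (\<lambda>n. 12 * stable_const \<alpha> * K * real n powr (- (1 + \<alpha> * \<delta>)) + 4 * Kc * exp (- 1) ^ n)"
    using alpha_pos assms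
    by (intro summable_add summable_mult summable_geometric) (auto simp: summable_real_powr_iff)
  then have "summable (\<lambda>n. prob (A n))"
    by (rule summable_comparison_test'[where N=1]) (use pA in auto)
  then have bc: "AE \<omega> in P. eventually (\<lambda>n. \<omega> \<in> space P - A n) sequentially"
    using A_meas by (intro borel_cantelli_AE1) (auto simp: emeasure_eq_measure)
  have ae: "AE \<omega> in P. \<forall>n. \<forall>pp\<in>links n. M (F pp) \<omega> = X (fst pp) \<omega> - X (snd pp) \<omega>"
    unfolding AE_all_countable using F_ae by (auto simp: AE_finite_all[OF finite_links])
  define L where "L = 3 * sqrt (2 * s)"
  have t_eq: "3 * t n = L * (exp (- (\<beta> * real n)) * real n powr (1 / 2 + 1 / \<alpha> + \<delta>))" for n
    by (simp add: t_def x_def L_def real_sqrt_mult powr_add powr_half_sqrt[symmetric] add.assoc mult_ac)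
  have "AE \<omega> in P. \<exists>N0. \<forall>n\<ge>N0. \<forall>(p, p')\<in>links n.
     cmod (X p \<omega> - X p' \<omega>) \<le> L * (exp (- (\<beta> * real n)) * real n powr (1 / 2 + 1 / \<alpha> + \<delta>))"
    using bc ae
  proof eventually_elim
    case (elim \<omega>)
    then obtain N0 where N0: "\<And>n. N0 \<le> n \<Longrightarrow> \<omega> \<in> space P - A n" by (auto simp: eventually_sequentially)
    show ?case unfolding t_eq[symmetric]
    proof (intro exI[of _ N0] allI impI ballI, clarify)
      fix n p p' assume "N0 \<le> n" "(p, p') \<in> links n"
      then have "cmod (M (F (p, p')) \<omega>) \<le> 3 * t n" using N0[of n] by (force simp: A_def)
      then show "cmod (X p \<omega> - X p' \<omega>) \<le> 3 * t n" using elim(2) \<open>(p, p') \<in> links n\<close> by force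
    qed
  qed
  moreover have "0 \<le> L" using s by (simp add: L_def)
  ultimately show ?thesis by blast
qed

end

theorem proposition5p1:
  fixes P :: "'w measure"
    and M :: "(real^'n \<Rightarrow> complex) \<Rightarrow> 'w \<Rightarrow> complex"
    and \<psi> :: "real^'n \<Rightarrow> complex"
    and E :: "real^'n^'n"
    and \<tau>E \<tau>Et :: "real^'n \<Rightarrow> real"
    and \<alpha>0 c\<psi> A \<beta> :: real
  assumes "prob_space P"
    and "0 < \<alpha>0" and "\<alpha>0 < 2"
    and "isotropic_stable_random_measure P \<alpha>0 lborel M"
    and "\<psi> \<in> borel_measurable borel"
    and "integrable lborel (\<lambda>\<xi>. min 1 (norm \<xi> powr \<alpha>0) * cmod (\<psi> \<xi>) powr \<alpha>0)"
    and "\<forall>l\<in>complex_spectrum E. 0 < Re l"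
    and "homogeneous_gauge E \<tau>E"
    and "homogeneous_gauge (transpose E) \<tau>Et"
    and "0 < c\<psi>" and "0 < A"
    and "0 < \<beta>" and "\<beta> < Min (Re ` complex_spectrum E)"
    and "AE \<xi> in lborel. norm \<xi> > A \<longrightarrow>
           cmod (\<psi> \<xi>) \<le> c\<psi> * \<tau>Et \<xi> powr (- \<beta> - trace E / \<alpha>0)"
  shows "\<exists>X'. modification P (harmonizable_field M \<psi>) X' \<and>
           (AE \<omega> in P. \<forall>\<epsilon>>0. \<forall>K. compact K \<and> K \<noteq> {} \<longrightarrow>
              (SUP (u, v) \<in> {(u, v). u \<in> K \<and> v \<in> K \<and> u \<noteq> v}.
                 ereal (cmod (X' u \<omega> - X' v \<omega>) /
                   (\<tau>E (u - v) powr \<beta> *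
                    ln (1 + inverse (\<tau>E (u - v))) powr (\<epsilon> + 1 / 2 + 1 / \<alpha>0)))) < \<infinity>)"
proof -
  \<comment> \<open>Some slack between \<open>\<beta>\<close> and the real parts of the eigenvalues; any value above \<open>\<beta>\<close> serves for an empty spectrum.\<close>
  define a where "a = (if complex_spectrum E = {} then \<beta> + 1 else (\<beta> + Min (Re ` complex_spectrum E)) / 2)"
  have ba: "\<beta> < a" using \<open>\<beta> < Min (Re ` complex_spectrum E)\<close> by (simp add: a_def)
  then have a0: "0 < a" using \<open>0 < \<beta>\<close> by linarith
  have spectrum_gt: "a < Re l" if "l \<in> complex_spectrum E" for l
  proof -
    have "Min (Re ` complex_spectrum E) \<le> Re l"
      using that finite_complex_spectrum by (intro Min_le) auto
    then show ?thesis using that \<open>\<beta> < Min (Re ` complex_spectrum E)\<close> by (auto simp: a_def)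
  qed
  obtain C1 where "0 < C1 \<and> (\<forall>t\<ge>0. \<forall>i j. \<bar>flow E (- t) $ i $ j\<bar> \<le> C1 * exp (- a * t))"
    using flow_decay[OF spectrum_gt] by (rule exE)
  then have C1: "0 < C1" "\<And>t i j. 0 \<le> t \<Longrightarrow> \<bar>flow E (- t) $ i $ j\<bar> \<le> C1 * exp (- a * t)"
    by simp_all
  define C where "C = real CARD('n) * real CARD('n) * C1"
  have C0: "0 < C" using C1 by (simp add: C_def)
  have contr: "norm (flow E (- t) *v x) \<le> C * exp (- a * t) * norm x" if "0 \<le> t" for t x
    using norm_matrix_vector_mult_le[of "flow E (- t)", OF C1(2)[OF that]] by (simp add: C_def mult.assoc)
  have contr': "norm (flow (transpose E) (- t) *v x) \<le> C * exp (- a * t) * norm x" if "0 \<le> t" for t x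
  proof -
    have "\<bar>flow (transpose E) (- t) $ i $ j\<bar> \<le> C1 * exp (- a * t)" for i j
      using C1(2)[OF that, of j i] unfolding flow_transpose by (simp add: transpose_def)
    from norm_matrix_vector_mult_le[of "flow (transpose E) (- t)", OF this] show ?thesis
      by (simp add: C_def mult.assoc)
  qed
  obtain R1 where R1: "\<And>x. \<tau>E x \<le> 1 \<Longrightarrow> norm x \<le> R1"
    using gauge_sublevel_bounded[OF \<open>homogeneous_gauge E \<tau>E\<close> a0 contr] by blast
  interpret anisotropic_grid E \<tau>E C a R1
    by unfold_locales (fact a0 C0 contr R1 \<open>homogeneous_gauge E \<tau>E\<close>)+
  have tr: "trace (transpose E) = trace E" by (simp add: trace_def transpose_def)
  have "AE \<xi> in lborel. norm \<xi> > A \<longrightarrow> cmod (\<psi> \<xi>) \<le> c\<psi> * \<tau>Et \<xi> powr (- \<beta> - trace (transpose E) / \<alpha>0)"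
    unfolding tr by fact
  from increment_mass_bound[OF \<open>homogeneous_gauge (transpose E) \<tau>Et\<close> \<open>0 < \<alpha>0\<close> \<open>0 < \<beta>\<close> ba C0 reach_pos contr'
        assms(5,6) \<open>0 < c\<psi>\<close> \<open>0 < A\<close> this]
  obtain K where K: "0 < K \<and> (\<forall>n. (\<lambda>\<xi>. complex_of_real (cutoff (transpose E) reach n \<xi> * cmod (\<psi> \<xi>))) \<in> L_alpha lborel \<alpha>0 \<and>
     (LINT \<xi>|lborel. (cutoff (transpose E) reach n \<xi> * cmod (\<psi> \<xi>)) powr \<alpha>0) \<le> K * exp (- (real n * \<alpha>0 * \<beta>)))"
    by (rule exE)
  interpret prob_space P by fact
  interpret harmonizable_sampling P \<alpha>0 M E \<tau>E C a R1 \<psi> \<beta> K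
  proof unfold_locales
    show "isotropic_stable_random_measure P \<alpha>0 lborel M" by fact
  qed (use assms(2,3,5,6,12) K in \<open>simp_all only: simp_thms\<close>)
  have field: "harmonizable_field M \<psi> u = X u" for u by (simp add: harmonizable_field_def)
  define X' where "X' u \<omega> = lim (\<lambda>n. X (project n u) \<omega>)" for u \<omega>
  have "modification P (harmonizable_field M \<psi>) X'"
    unfolding modification_def field
  proof (intro conjI allI)
    show "X' u \<in> borel_measurable P" for u
      unfolding X'_def by (intro borel_measurable_lim_metric X_measurable)
    show "AE \<omega> in P. X' u \<omega> = X u \<omega>" for u
      using project_tendsto[of u] by eventually_elim (simp add: X'_def limI)
  qed
  moreover have "AE \<omega> in P. \<forall>\<epsilon>>0. \<forall>K. compact K \<and> K \<noteq> {} \<longrightarrow>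
              (SUP (u, v) \<in> {(u, v). u \<in> K \<and> v \<in> K \<and> u \<noteq> v}.
                 ereal (cmod (X' u \<omega> - X' v \<omega>) /
                   (\<tau>E (u - v) powr \<beta> *
                    ln (1 + inverse (\<tau>E (u - v))) powr (\<epsilon> + 1 / 2 + 1 / \<alpha>0)))) < \<infinity>"
  proof -
    \<comment> \<open>One null set has to serve all \<open>\<epsilon>\<close>: the increments \<open>1 / Suc k\<close> of the exponent form a countable family.\<close>
    have "\<exists>L. \<forall>k. 0 \<le> L k \<and> (AE \<omega> in P. \<exists>N0. \<forall>n\<ge>N0. \<forall>(p, p')\<in>links n.
       cmod (X p \<omega> - X p' \<omega>) \<le> L k * (exp (- (\<beta> * real n)) * real n powr (1 / 2 + 1 / \<alpha>0 + inverse (real (Suc k)))))"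
      using links_eventually_bounded[of "inverse (real (Suc k))" for k] by (intro choice allI) auto
    then obtain L where L0: "\<And>k. 0 \<le> L k" and L: "\<And>k. AE \<omega> in P. \<exists>N0. \<forall>n\<ge>N0. \<forall>(p, p')\<in>links n.
       cmod (X p \<omega> - X p' \<omega>) \<le> L k * (exp (- (\<beta> * real n)) * real n powr (1 / 2 + 1 / \<alpha>0 + inverse (real (Suc k))))"
      by blast
    have "AE \<omega> in P. \<forall>k. \<exists>N0. \<forall>n\<ge>N0. \<forall>(p, p')\<in>links n.
       cmod (X p \<omega> - X p' \<omega>) \<le> L k * (exp (- (\<beta> * real n)) * real n powr (1 / 2 + 1 / \<alpha>0 + inverse (real (Suc k))))"
      using L by (simp add: AE_all_countable)
    then show ?thesis
    proof eventually_elim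
      case (elim \<omega>)
      show ?case
      proof (intro allI impI)
        fix \<epsilon> :: real and K :: "(real^'n) set"
        assume \<epsilon>: "0 < \<epsilon>" and K: "compact K \<and> K \<noteq> {}"
        obtain R where R: "\<And>u. u \<in> K \<Longrightarrow> norm u \<le> R"
          using compact_imp_bounded[of K] K by (auto simp: bounded_iff)
        obtain k where k: "inverse (real (Suc k)) < \<epsilon>" using reals_Archimedean[OF \<epsilon>] by blast
        from spec[OF elim, of k]
        obtain N0 where "\<forall>n\<ge>N0. \<forall>(p, p')\<in>links n.
            cmod (X p \<omega> - X p' \<omega>) \<le> L k * (exp (- (\<beta> * real n)) * real n powr (1 / 2 + 1 / \<alpha>0 + inverse (real (Suc k))))"
          by (rule exE)
        then have N0: "cmod (X p \<omega> - X p' \<omega>) \<le> L k * (exp (- (\<beta> * real n)) * real n powr (1 / 2 + 1 / \<alpha>0 + inverse (real (Suc k))))"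
          if "N0 \<le> n" "(p, p') \<in> links n" for n p p'
          using that by (simp add: case_prod_unfold Ball_def)
        let ?P = "\<epsilon> + 1 / 2 + 1 / \<alpha>0"
        have link_le: "cmod (X p \<omega> - X p' \<omega>) \<le> L k * (exp (- (\<beta> * real n)) * real n powr ?P)"
          if "max N0 1 \<le> n" "(p, p') \<in> links n" for n p p'
        proof -
          have "real n powr (1 / 2 + 1 / \<alpha>0 + inverse (real (Suc k))) \<le> real n powr ?P"
            using that(1) k by (intro powr_mono) auto
          then have "L k * (exp (- (\<beta> * real n)) * real n powr (1 / 2 + 1 / \<alpha>0 + inverse (real (Suc k)))) \<le>
              L k * (exp (- (\<beta> * real n)) * real n powr ?P)"
            by (intro mult_left_mono L0) auto
          with N0[of n p p'] that show ?thesis by auto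
        qed
        have P_nonneg: "0 \<le> ?P" using \<epsilon> \<open>0 < \<alpha>0\<close> by simp
        have "\<exists>B. \<forall>u v. norm u \<le> R \<longrightarrow> norm v \<le> R \<longrightarrow> u \<noteq> v \<longrightarrow>
           cmod (X' u \<omega> - X' v \<omega>) \<le> B * (\<tau>E (u - v) powr \<beta> * ln (1 + inverse (\<tau>E (u - v))) powr ?P)"
          unfolding X'_def by (rule chaining_modulus[OF \<open>0 < \<beta>\<close> P_nonneg L0[of k] link_le])
        then obtain B where B: "\<And>u v. norm u \<le> R \<Longrightarrow> norm v \<le> R \<Longrightarrow> u \<noteq> v \<Longrightarrow>
           cmod (X' u \<omega> - X' v \<omega>) \<le> B * (\<tau>E (u - v) powr \<beta> * ln (1 + inverse (\<tau>E (u - v))) powr ?P)"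
          by blast
        have "(SUP (u, v) \<in> {(u, v). u \<in> K \<and> v \<in> K \<and> u \<noteq> v}.
                 ereal (cmod (X' u \<omega> - X' v \<omega>) / (\<tau>E (u - v) powr \<beta> * ln (1 + inverse (\<tau>E (u - v))) powr ?P))) \<le> ereal B"
        proof (rule SUP_least, clarify)
          fix u v assume uv: "u \<in> K" "v \<in> K" "u \<noteq> v"
          have t: "0 < \<tau>E (u - v)" using uv by (intro gauge_pos[OF gauge]) simp
          then have "0 < ln (1 + inverse (\<tau>E (u - v)))" by (intro ln_gt_zero) simp
          then have "0 < \<tau>E (u - v) powr \<beta> * ln (1 + inverse (\<tau>E (u - v))) powr ?P" using t by simp
          then show "ereal (cmod (X' u \<omega> - X' v \<omega>) / (\<tau>E (u - v) powr \<beta> * ln (1 + inverse (\<tau>E (u - v))) powr ?P)) \<le> ereal B"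
            using B[OF R[OF uv(1)] R[OF uv(2)] uv(3)] by (simp only: ereal_less_eq pos_divide_le_eq)
        qed
        also have "ereal B < \<infinity>" by simp
        finally show "(SUP (u, v) \<in> {(u, v). u \<in> K \<and> v \<in> K \<and> u \<noteq> v}.
                 ereal (cmod (X' u \<omega> - X' v \<omega>) / (\<tau>E (u - v) powr \<beta> * ln (1 + inverse (\<tau>E (u - v))) powr ?P))) < \<infinity>" .
      qed
    qed
  qed
  ultimately show ?thesis by blast
qed

end
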